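(* Let $(X^{n+1},g)$, $n\geq 2$, be a strongly causal space-time which is refocusing at $x\in X$, and let $\rho:(\widetilde{X},\widetilde{g})\to (X,g)$ be a Lorentz covering map. Then $(\widetilde{X}^{n+1},\widetilde{g})$ is a strongly causal space-time which is refocusing at $\widetilde{x}$ for all $\widetilde{x}\in\rho^{-1}(x)$. Moreover, if $(X^{n+1},g)$ is strongly causal and strongly refocusing at $x$, then $(\widetilde{X}^{n+1},\widetilde{g})$ is strongly causal and strongly refocusing at $\widetilde{x}$ for all $\widetilde{x}\in\rho^{-1}(x)$.
   Context: All manifolds and maps are smooth ($C^\infty$). A space-time $(X^{n+1},g)$ is a connected, time-oriented smooth Lorentz manifold (signature $(+,\dots,+,-)$) of dimension $n+1$; its points are called events. A nonzero tangent vector $v$ is timelike, null or nonspacelike if $g(v,v)<0$, $g(v,v)=0$ or $g(v,v)\le 0$, respectively. A nonspacelike curve is a piecewise-smooth curve whose velocity vectors are nonspacelike and all future-directed (or all past-directed). An open set $U\subset X$ is causally convex if no nonspacelike curve in $X$ intersects $U$ in a disconnected set. $(X,g)$ is strongly causal at $p$ if every open neighborhood of $p$ contains a causally convex open neighborhood of $p$; it is strongly causal if this holds at every event. Null-geodesics are geodesics with null velocity and are taken to be inextendible; a null-geodesic enters a set $U$ if its image meets $U$. A Lorentz covering map $\rho:(\widetilde X,\widetilde g)\to(X,g)$ is a smooth covering map $\rho:\widetilde X\to X$ with $\widetilde X$ a connected smooth $(n+1)$-manifold, $\widetilde g=\rho^*g$ the pullback metric, and $\widetilde X$ time-oriented by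 the unique (timelike) vector field projecting under $d\rho$ to a timelike vector field defining the time-orientation of $X$. A strongly causal space-time is strongly refocusing at $x$ if there is an event $y\ne x$ such that all null-geodesics through $y$ pass through $x$. A strongly causal space-time $(X,g)$ is refocusing at $x\in X$ if one (equivalently, all) of the following conditions holds. (i) There is an open neighborhood $V$ of $x$ such that for all open $U$ with $x\in U\subset V$ there is an event $y\notin U$ such that all null-geodesics through $y$ enter $U$. (ii) There is an open neighborhood $V$ of $x$ such that for all open $U$ with $x\in U\subset V$ there is an event $y\notin V$ such that all null-geodesics through $y$ enter $U$. (iii) There are an open neighborhood $V$ of $x$ and a sequence $\{y_n\}_{n=1}^\infty$ in $X\setminus V$ such that for all open $U$ with $x\in U\subset V$ there is $K\in\mathbb{N}$ such that for all $n\ge K$ all null-geodesics through $y_n$ enter $U$. *)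

theory Defs
  imports "HOL-Analysis.Analysis"
begin

section \<open>Smooth maps between Euclidean spaces\<close>

text \<open>Only meaningful on an open set, because derivatives are taken with respect to the
  full neighbourhood filter. For finite-dimensional domains, continuity of all iterated
  directional derivatives of \<open>f\<close> is continuity of the iterated derivatives themselves.\<close>

primrec C_diff_on :: "nat \<Rightarrow> 'a::real_normed_vector set \<Rightarrow> ('a \<Rightarrow> 'b::real_normed_vector) \<Rightarrow> bool" where
  "C_diff_on 0 S f \<longleftrightarrow> continuous_on S f"
| "C_diff_on (Suc k) S f \<longleftrightarrow>
     (\<forall>x\<in>S. f differentiable (at x)) \<and>
     (\<forall>v. C_diff_on k S (\<lambda>x. frechet_derivative f (at x) v))"

definition smooth_on :: "'a::real_normed_vector set \<Rightarrow> ('a \<Rightarrow> 'b::real_normed_vector) \<Rightarrow> bool" where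
  "smooth_on S f \<longleftrightarrow> open S \<and> (\<forall>k. C_diff_on k S f)"

section \<open>Smooth manifolds\<close>

text \<open>A manifold is the whole of a type \<open>'a\<close> of class
  \<open>{t2_space, second_countable_topology}\<close>, together with a maximal smooth atlas modelled on a
  Euclidean space \<open>'e\<close>; its dimension is \<open>DIM('e)\<close>. A chart is a pair consisting of its domain
  and its coordinate map; values of the coordinate map outside the domain are irrelevant.\<close>

type_synonym ('a, 'e) chart = "'a set \<times> ('a \<Rightarrow> 'e)"

abbreviation chart_inv :: "('a, 'e) chart \<Rightarrow> 'e \<Rightarrow> 'a" where
  "chart_inv c \<equiv> inv_into (fst c) (snd c)"

definition is_chart :: "('a::topological_space, 'e::euclidean_space) chart \<Rightarrow> bool" where
  "is_chart c \<longleftrightarrow> open (fst c) \<and> open (snd c ` fst c) \<and>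
     homeomorphism (fst c) (snd c ` fst c) (snd c) (chart_inv c)"

definition smoothly_compatible ::
  "('a::topological_space, 'e::euclidean_space) chart \<Rightarrow> ('a, 'e) chart \<Rightarrow> bool" where
  "smoothly_compatible c d \<longleftrightarrow>
     smooth_on (snd c ` (fst c \<inter> fst d)) (snd d \<circ> chart_inv c) \<and>
     smooth_on (snd d ` (fst c \<inter> fst d)) (snd c \<circ> chart_inv d)"

definition smooth_structure :: "('a::topological_space, 'e::euclidean_space) chart set \<Rightarrow> bool" where
  "smooth_structure A \<longleftrightarrow>
     (\<forall>c\<in>A. is_chart c) \<and> (\<Union>c\<in>A. fst c) = UNIV \<and>
     (\<forall>c\<in>A. \<forall>d\<in>A. smoothly_compatible c d) \<and>
     (\<forall>c. is_chart c \<and> (\<forall>d\<in>A. smoothly_compatible c d) \<longrightarrow> c \<in> A)"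

definition smooth_map_on ::
  "('a::topological_space, 'e::euclidean_space) chart set \<Rightarrow>
   ('b::topological_space, 'f::euclidean_space) chart set \<Rightarrow> 'a set \<Rightarrow> ('a \<Rightarrow> 'b) \<Rightarrow> bool" where
  "smooth_map_on A B S f \<longleftrightarrow> open S \<and> continuous_on S f \<and>
     (\<forall>c\<in>A. \<forall>d\<in>B. smooth_on (snd c ` (fst c \<inter> S \<inter> f -` fst d)) (snd d \<circ> f \<circ> chart_inv c))"

subsection \<open>Tangent vectors\<close>

text \<open>A tangent vector at \<open>p\<close> is the family of its coordinate representations in all charts
  around \<open>p\<close>, related by the derivatives of the chart changes (and set to \<open>0\<close> at the other
  charts, so that equality of tangent vectors is equality of functions).\<close>

type_synonym ('a, 'e) tvec = "('a, 'e) chart \<Rightarrow> 'e"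

definition tangent_space ::
  "('a::topological_space, 'e::euclidean_space) chart set \<Rightarrow> 'a \<Rightarrow> ('a, 'e) tvec set" where
  "tangent_space A p = {v.
     (\<forall>c. \<not> (c \<in> A \<and> p \<in> fst c) \<longrightarrow> v c = 0) \<and>
     (\<forall>c\<in>A. \<forall>d\<in>A. p \<in> fst c \<inter> fst d \<longrightarrow>
        v d = frechet_derivative (snd d \<circ> chart_inv c) (at (snd c p)) (v c))}"

text \<open>The tangent vector at \<open>p\<close> with coordinates \<open>u\<close> in the chart \<open>c\<close>.\<close>

definition coord_vec ::
  "('a::topological_space, 'e::euclidean_space) chart set \<Rightarrow> ('a, 'e) chart \<Rightarrow> 'a \<Rightarrow> 'e \<Rightarrow> ('a, 'e) tvec" where
  "coord_vec A c p u = (\<lambda>d. if d \<in> A \<and> p \<in> fst d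
     then frechet_derivative (snd d \<circ> chart_inv c) (at (snd c p)) u else 0)"

text \<open>The differential at \<open>p\<close>. The chart chosen around \<open>p\<close> does not matter, by the chain rule.\<close>

definition differential ::
  "('a::topological_space, 'e::euclidean_space) chart set \<Rightarrow>
   ('b::topological_space, 'f::euclidean_space) chart set \<Rightarrow>
   ('a \<Rightarrow> 'b) \<Rightarrow> 'a \<Rightarrow> ('a, 'e) tvec \<Rightarrow> ('b, 'f) tvec" where
  "differential A B f p v =
     (let c = (SOME c. c \<in> A \<and> p \<in> fst c) in
      (\<lambda>d. if d \<in> B \<and> f p \<in> fst d
           then frechet_derivative (snd d \<circ> f \<circ> chart_inv c) (at (snd c p)) (v c) else 0))"

definition smooth_vector_field ::
  "('a::topological_space, 'e::euclidean_space) chart set \<Rightarrow> ('a \<Rightarrow> ('a, 'e) tvec) \<Rightarrow> bool" where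
  "smooth_vector_field A T \<longleftrightarrow> (\<forall>p. T p \<in> tangent_space A p) \<and>
     (\<forall>c\<in>A. smooth_on (snd c ` fst c) (\<lambda>q. T (chart_inv c q) c))"

section \<open>Lorentz manifolds and space-times\<close>

type_synonym ('a, 'e) metric = "'a \<Rightarrow> ('a, 'e) tvec \<Rightarrow> ('a, 'e) tvec \<Rightarrow> real"

definition metric_coeff ::
  "('a::topological_space, 'e::euclidean_space) chart set \<Rightarrow> ('a, 'e) metric \<Rightarrow>
   ('a, 'e) chart \<Rightarrow> 'e \<Rightarrow> 'e \<Rightarrow> 'e \<Rightarrow> real" where
  "metric_coeff A g c q u v =
     (let p = chart_inv c q in g p (coord_vec A c p u) (coord_vec A c p v))"

definition lorentz_form :: "('e::euclidean_space \<Rightarrow> 'e \<Rightarrow> real) \<Rightarrow> bool" where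
  "lorentz_form G \<longleftrightarrow> bilinear G \<and> (\<forall>u v. G u v = G v u) \<and>
     (\<exists>b0 B. b0 \<notin> B \<and> independent (insert b0 B) \<and> span (insert b0 B) = UNIV \<and>
        G b0 b0 < 0 \<and> (\<forall>b\<in>B. G b b > 0) \<and> (\<forall>b\<in>B. G b0 b = 0) \<and>
        (\<forall>b\<in>B. \<forall>b'\<in>B. b \<noteq> b' \<longrightarrow> G b b' = 0))"

definition lorentz_metric ::
  "('a::topological_space, 'e::euclidean_space) chart set \<Rightarrow> ('a, 'e) metric \<Rightarrow> bool" where
  "lorentz_metric A g \<longleftrightarrow>
     (\<forall>c\<in>A. (\<forall>q \<in> snd c ` fst c. lorentz_form (metric_coeff A g c q)) \<and>
        (\<forall>u v. smooth_on (snd c ` fst c) (\<lambda>q. metric_coeff A g c q u v)))"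

text \<open>The timelike vector field \<open>T\<close> represents the time-orientation.\<close>

definition space_time ::
  "('a::{t2_space, second_countable_topology}, 'e::euclidean_space) chart set \<Rightarrow>
   ('a, 'e) metric \<Rightarrow> ('a \<Rightarrow> ('a, 'e) tvec) \<Rightarrow> bool" where
  "space_time A g T \<longleftrightarrow>
     connected (UNIV :: 'a set) \<and> smooth_structure A \<and> lorentz_metric A g \<and>
     smooth_vector_field A T \<and> (\<forall>p. g p (T p) (T p) < 0)"

definition nonspacelike :: "('a, 'e::real_vector) metric \<Rightarrow> 'a \<Rightarrow> ('a, 'e) tvec \<Rightarrow> bool" where
  "nonspacelike g p v \<longleftrightarrow> v \<noteq> (\<lambda>_. 0) \<and> g p v v \<le> 0"

definition null_vec :: "('a, 'e::real_vector) metric \<Rightarrow> 'a \<Rightarrow> ('a, 'e) tvec \<Rightarrow> bool" where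
  "null_vec g p v \<longleftrightarrow> v \<noteq> (\<lambda>_. 0) \<and> g p v v = 0"

section \<open>Nonspacelike curves and strong causality\<close>

definition smooth_curve_on ::
  "('a::topological_space, 'e::euclidean_space) chart set \<Rightarrow> real set \<Rightarrow> (real \<Rightarrow> 'a) \<Rightarrow> bool" where
  "smooth_curve_on A J \<sigma> \<longleftrightarrow> open J \<and> continuous_on J \<sigma> \<and>
     (\<forall>c\<in>A. smooth_on (J \<inter> \<sigma> -` fst c) (snd c \<circ> \<sigma>))"

text \<open>The velocity at \<open>t\<close>; it is one-sided if \<open>t\<close> is an end point of the interval \<open>S\<close>.\<close>

definition velocity ::
  "('a::topological_space, 'e::euclidean_space) chart set \<Rightarrow> (real \<Rightarrow> 'a) \<Rightarrow> real set \<Rightarrow> real \<Rightarrow> ('a, 'e) tvec" where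
  "velocity A \<gamma> S t = (\<lambda>c. if c \<in> A \<and> \<gamma> t \<in> fst c
     then vector_derivative (snd c \<circ> \<gamma>) (at t within S) else 0)"

text \<open>Smooth on a compact interval: the restriction of a smooth curve on an open set.\<close>

definition smooth_arc ::
  "('a::topological_space, 'e::euclidean_space) chart set \<Rightarrow> (real \<Rightarrow> 'a) \<Rightarrow> real \<Rightarrow> real \<Rightarrow> bool" where
  "smooth_arc A \<gamma> s t \<longleftrightarrow>
     (\<exists>J \<sigma>. {s..t} \<subseteq> J \<and> smooth_curve_on A J \<sigma> \<and> (\<forall>r\<in>{s..t}. \<sigma> r = \<gamma> r))"

definition piecewise_smooth_curve ::
  "('a::topological_space, 'e::euclidean_space) chart set \<Rightarrow> real set \<Rightarrow> (real \<Rightarrow> 'a) \<Rightarrow> bool" where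
  "piecewise_smooth_curve A I \<gamma> \<longleftrightarrow>
     is_interval I \<and> interior I \<noteq> {} \<and> continuous_on I \<gamma> \<and>
     (\<forall>a b. a < b \<and> {a..b} \<subseteq> I \<longrightarrow>
        (\<exists>D. finite D \<and>
          (\<forall>s t. a \<le> s \<and> s < t \<and> t \<le> b \<and> {s<..<t} \<inter> D = {} \<longrightarrow> smooth_arc A \<gamma> s t)))"

text \<open>All velocity vectors, with their base points; at a break point these are the one-sided
  velocities.\<close>

definition velocity_vectors ::
  "('a::topological_space, 'e::euclidean_space) chart set \<Rightarrow> real set \<Rightarrow> (real \<Rightarrow> 'a) \<Rightarrow>
   ('a \<times> ('a, 'e) tvec) set" where
  "velocity_vectors A I \<gamma> = {(\<gamma> r, velocity A \<gamma> {s..t} r) | r s t.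
     s < t \<and> {s..t} \<subseteq> I \<and> smooth_arc A \<gamma> s t \<and> r \<in> {s..t}}"

definition nonspacelike_curve ::
  "('a::topological_space, 'e::euclidean_space) chart set \<Rightarrow> ('a, 'e) metric \<Rightarrow>
   ('a \<Rightarrow> ('a, 'e) tvec) \<Rightarrow> real set \<Rightarrow> (real \<Rightarrow> 'a) \<Rightarrow> bool" where
  "nonspacelike_curve A g T I \<gamma> \<longleftrightarrow>
     piecewise_smooth_curve A I \<gamma> \<and>
     (\<forall>(p, v) \<in> velocity_vectors A I \<gamma>. nonspacelike g p v) \<and>
     ((\<forall>(p, v) \<in> velocity_vectors A I \<gamma>. g p v (T p) < 0) \<or>
      (\<forall>(p, v) \<in> velocity_vectors A I \<gamma>. g p v (T p) > 0))"

definition causally_convex ::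
  "('a::topological_space, 'e::euclidean_space) chart set \<Rightarrow> ('a, 'e) metric \<Rightarrow>
   ('a \<Rightarrow> ('a, 'e) tvec) \<Rightarrow> 'a set \<Rightarrow> bool" where
  "causally_convex A g T U \<longleftrightarrow>
     open U \<and> (\<forall>I \<gamma>. nonspacelike_curve A g T I \<gamma> \<longrightarrow> connected (\<gamma> ` I \<inter> U))"

definition strongly_causal_at ::
  "('a::topological_space, 'e::euclidean_space) chart set \<Rightarrow> ('a, 'e) metric \<Rightarrow>
   ('a \<Rightarrow> ('a, 'e) tvec) \<Rightarrow> 'a \<Rightarrow> bool" where
  "strongly_causal_at A g T p \<longleftrightarrow>
     (\<forall>W. open W \<and> p \<in> W \<longrightarrow> (\<exists>U. causally_convex A g T U \<and> p \<in> U \<and> U \<subseteq> W))"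

definition strongly_causal_space_time ::
  "('a::{t2_space, second_countable_topology}, 'e::euclidean_space) chart set \<Rightarrow>
   ('a, 'e) metric \<Rightarrow> ('a \<Rightarrow> ('a, 'e) tvec) \<Rightarrow> bool" where
  "strongly_causal_space_time A g T \<longleftrightarrow> space_time A g T \<and> (\<forall>p. strongly_causal_at A g T p)"

section \<open>Null-geodesics\<close>

text \<open>The vector \<open>\<Gamma>(u,v)\<close> with components \<open>\<Gamma>\<^sup>k\<^sub>i\<^sub>j u\<^sup>i v\<^sup>j\<close> at the coordinate point \<open>q\<close>, where
  \<open>\<Gamma>\<^sup>k\<^sub>i\<^sub>j\<close> are the Christoffel symbols of the Levi-Civita connection. The index \<open>k\<close> is
  raised by nondegeneracy of the metric.\<close>

definition christoffel ::
  "('a::topological_space, 'e::euclidean_space) chart set \<Rightarrow> ('a, 'e) metric \<Rightarrow>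
   ('a, 'e) chart \<Rightarrow> 'e \<Rightarrow> 'e \<Rightarrow> 'e \<Rightarrow> 'e" where
  "christoffel A g c q u v =
     (let G = metric_coeff A g c in
      THE z. \<forall>w. G q z w = (1/2) *
        (frechet_derivative (\<lambda>q. G q v w) (at q) u +
         frechet_derivative (\<lambda>q. G q u w) (at q) v -
         frechet_derivative (\<lambda>q. G q u v) (at q) w))"

definition geodesic ::
  "('a::topological_space, 'e::euclidean_space) chart set \<Rightarrow> ('a, 'e) metric \<Rightarrow>
   real set \<Rightarrow> (real \<Rightarrow> 'a) \<Rightarrow> bool" where
  "geodesic A g J \<gamma> \<longleftrightarrow>
     is_interval J \<and> J \<noteq> {} \<and> smooth_curve_on A J \<gamma> \<and>
     (\<forall>t\<in>J. \<forall>c\<in>A. \<gamma> t \<in> fst c \<longrightarrow>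
        (let x = snd c \<circ> \<gamma>; x' = (\<lambda>s. vector_derivative x (at s)) in
         vector_derivative x' (at t) + christoffel A g c (x t) (x' t) (x' t) = 0))"

text \<open>Null-geodesics are inextendible by definition.\<close>

definition null_geodesic ::
  "('a::topological_space, 'e::euclidean_space) chart set \<Rightarrow> ('a, 'e) metric \<Rightarrow>
   real set \<Rightarrow> (real \<Rightarrow> 'a) \<Rightarrow> bool" where
  "null_geodesic A g J \<gamma> \<longleftrightarrow>
     geodesic A g J \<gamma> \<and> (\<forall>t\<in>J. null_vec g (\<gamma> t) (velocity A \<gamma> J t)) \<and>
     \<not> (\<exists>J' \<gamma>'. J \<subset> J' \<and> geodesic A g J' \<gamma>' \<and> (\<forall>t\<in>J. \<gamma>' t = \<gamma> t))"

definition all_null_geodesics_enter ::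
  "('a::topological_space, 'e::euclidean_space) chart set \<Rightarrow> ('a, 'e) metric \<Rightarrow>
   'a \<Rightarrow> 'a set \<Rightarrow> bool" where
  "all_null_geodesics_enter A g y U \<longleftrightarrow>
     (\<forall>J \<gamma>. null_geodesic A g J \<gamma> \<and> y \<in> \<gamma> ` J \<longrightarrow> \<gamma> ` J \<inter> U \<noteq> {})"

section \<open>Refocusing\<close>

text \<open>Both notions are meant for strongly causal space-times. In that setting the event \<open>y\<close>
  in \<open>refocusing_at\<close> may equivalently be required only to lie outside \<open>U\<close>, or be taken from a
  sequence outside \<open>V\<close> that works for every \<open>U\<close> eventually.\<close>

definition refocusing_at ::
  "('a::topological_space, 'e::euclidean_space) chart set \<Rightarrow> ('a, 'e) metric \<Rightarrow> 'a \<Rightarrow> bool" where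
  "refocusing_at A g x \<longleftrightarrow>
     (\<exists>V. open V \<and> x \<in> V \<and>
       (\<forall>U. open U \<and> x \<in> U \<and> U \<subseteq> V \<longrightarrow> (\<exists>y. y \<notin> V \<and> all_null_geodesics_enter A g y U)))"

definition strongly_refocusing_at ::
  "('a::topological_space, 'e::euclidean_space) chart set \<Rightarrow> ('a, 'e) metric \<Rightarrow> 'a \<Rightarrow> bool" where
  "strongly_refocusing_at A g x \<longleftrightarrow>
     (\<exists>y. y \<noteq> x \<and> (\<forall>J \<gamma>. null_geodesic A g J \<gamma> \<and> y \<in> \<gamma> ` J \<longrightarrow> x \<in> \<gamma> ` J))"

section \<open>Lorentz covering maps\<close>

text \<open>As the library's \<open>covering_space\<close>, with sheets mapped diffeomorphically.\<close>

definition smooth_covering_map ::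
  "('b::topological_space, 'e::euclidean_space) chart set \<Rightarrow>
   ('a::topological_space, 'e) chart set \<Rightarrow> ('b \<Rightarrow> 'a) \<Rightarrow> bool" where
  "smooth_covering_map A' A \<rho> \<longleftrightarrow>
     smooth_map_on A' A UNIV \<rho> \<and> surj \<rho> \<and>
     (\<forall>x. \<exists>U \<V>. open U \<and> x \<in> U \<and> \<Union>\<V> = \<rho> -` U \<and> (\<forall>V\<in>\<V>. open V) \<and> pairwise disjnt \<V> \<and>
        (\<forall>V\<in>\<V>. \<exists>q. homeomorphism V U \<rho> q \<and> smooth_map_on A' A V \<rho> \<and> smooth_map_on A A' U q))"

lemma smooth_covering_map_imp_covering_space:
  assumes "smooth_covering_map A' A \<rho>"
  shows "covering_space UNIV \<rho> UNIV"
proof -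
  have "\<exists>T. x \<in> T \<and> openin (top_of_set UNIV) T \<and>
      (\<exists>v. \<Union>v = UNIV \<inter> \<rho> -` T \<and> (\<forall>u\<in>v. openin (top_of_set UNIV) u) \<and>
        pairwise disjnt v \<and> (\<forall>u\<in>v. \<exists>q. homeomorphism u T \<rho> q))" for x
  proof -
    obtain U \<V> where "open U" "x \<in> U" and \<V>: "\<Union>\<V> = \<rho> -` U" "\<forall>V\<in>\<V>. open V" "pairwise disjnt \<V>"
      "\<forall>V\<in>\<V>. \<exists>q. homeomorphism V U \<rho> q"
      using assms unfolding smooth_covering_map_def by meson
    show ?thesis
    proof (intro exI [of _ U] conjI exI [of _ \<V>])
      show "openin (top_of_set UNIV) U" "\<forall>u\<in>\<V>. openin (top_of_set UNIV) u"
        using \<open>open U\<close> \<V>(2) by (simp_all add: openin_open)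
      show "\<Union>\<V> = UNIV \<inter> \<rho> -` U"
        using \<V>(1) by blast
    qed (fact \<open>x \<in> U\<close> \<V>)+
  qed
  moreover have "continuous_on UNIV \<rho>" "\<rho> ` UNIV = UNIV"
    using assms by (simp_all add: smooth_covering_map_def smooth_map_on_def)
  ultimately show ?thesis
    unfolding covering_space_def by simp
qed

text \<open>The metric and the time-orientation upstairs are determined by those downstairs; that they
  make the total space a space-time is not assumed.\<close>

definition lorentz_covering ::
  "('b::{t2_space, second_countable_topology}, 'e::euclidean_space) chart set \<Rightarrow>
   ('b, 'e) metric \<Rightarrow> ('b \<Rightarrow> ('b, 'e) tvec) \<Rightarrow>
   ('a::{t2_space, second_countable_topology}, 'e) chart set \<Rightarrow>
   ('a, 'e) metric \<Rightarrow> ('a \<Rightarrow> ('a, 'e) tvec) \<Rightarrow> ('b \<Rightarrow> 'a) \<Rightarrow> bool" where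
  "lorentz_covering A' g' T' A g T \<rho> \<longleftrightarrow>
     connected (UNIV :: 'b set) \<and> smooth_structure A' \<and> smooth_covering_map A' A \<rho> \<and>
     (\<forall>p. \<forall>v \<in> tangent_space A' p. \<forall>w \<in> tangent_space A' p.
        g' p v w = g (\<rho> p) (differential A' A \<rho> p v) (differential A' A \<rho> p w)) \<and>
     (\<forall>p. T' p \<in> tangent_space A' p \<and> differential A' A \<rho> p (T' p) = T (\<rho> p))"

end

theory Submission
  imports Defs
begin

text \<open>The space-time structure, geodesics and nonspacelike curves upstairs are the lifts of those
  downstairs, since \<open>\<rho>\<close> is the identity in suitable charts. In a strongly causal space-time a
  nonspacelike curve is injective and therefore meets a causally convex set \<open>U\<close> in an interval of
  parameters. If \<open>U\<close> is evenly covered, a lift of a null geodesic that enters \<open>\<rho> -` U\<close> consequently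
  does so in one sheet only. Suppose all null geodesics through \<open>y\<close> enter \<open>U\<close>, and let \<open>\<rho> y' = y\<close>.
  By continuous dependence on the initial velocity, the sheet entered by the null geodesic through
  \<open>y'\<close> in a given direction depends continuously on this direction, and for \<open>n \<ge> 2\<close> the null
  directions form a connected space; so all null geodesics through \<open>y'\<close> enter the same sheet. The
  lift \<open>y'\<close> can be chosen such that this sheet is the one around a given point over \<open>x\<close>.\<close>

section \<open>Calculus of smooth maps\<close>

text \<open>Causal convexity constrains the trace of a curve, whereas lifting needs control over
  parameters; this forces the detour through injectivity, where strong causality is used a second
  time to exclude loops. The directions at \<open>y'\<close> whose geodesics enter the prescribed
  sheet and those whose geodesics enter another one are both open. They cover all directions because
  every projection enters \<open>U\<close>, and they are disjoint by the interval property, so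
  connectedness decides. The null vectors form two half-cones, but \<open>v\<close> and
  \<open>- v\<close> give the same geodesic traversed in opposite senses. One half-cone is enough;
  it is a copy of punctured n-dimensional space, which falls apart for n = 1. The distance of the
  focal event from the point costs nothing in the version of refocusing with
  \<open>y \<notin> V\<close>: every event over \<open>y\<close> avoids the preimage of
  \<open>V\<close>. Geodesics are treated throughout as solutions of a first-order equation for
  position and velocity, since this equation is literally the same in an adapted chart upstairs and
  the chart below it.\<close>

lemma has_derivative_cong_open:
  assumes "open S" "x \<in> S" "\<And>y. y \<in> S \<Longrightarrow> f y = g y"
  shows "(f has_derivative D) (at x) \<longleftrightarrow> (g has_derivative D) (at x)"
  using has_derivative_transform_within_open[OF _ assms(1,2)] assms(3) by metis

lemma frechet_derivative_cong_open:
  assumes "open S" "x \<in> S" "\<And>y. y \<in> S \<Longrightarrow> f y = g y"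
  shows "frechet_derivative f (at x) = frechet_derivative g (at x)"
  unfolding frechet_derivative_def using has_derivative_cong_open[OF assms] by simp

lemma C_diff_on_cong:
  assumes "open S" "\<And>x. x \<in> S \<Longrightarrow> f x = g x"
  shows "C_diff_on k S f \<longleftrightarrow> C_diff_on k S g"
  using assms(2)
proof (induction k arbitrary: f g)
  case 0
  then show ?case by (simp cong: continuous_on_cong)
next
  case (Suc k)
  have "f differentiable (at x) \<longleftrightarrow> g differentiable (at x)" if "x \<in> S" for x
    unfolding differentiable_def using has_derivative_cong_open[OF assms(1) that, of f g] Suc.prems by simp
  moreover have "C_diff_on k S (\<lambda>x. frechet_derivative f (at x) v) \<longleftrightarrow>
      C_diff_on k S (\<lambda>x. frechet_derivative g (at x) v)" for v
    by (rule Suc.IH) (use frechet_derivative_cong_open[OF assms(1), of _ f g] Suc.prems in auto)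
  ultimately show ?case by simp
qed

text \<open>\<open>frechet_derivative\<close> is a choice of derivative; by uniqueness of
  derivatives, any derivative found in closed form may replace it on an open set.\<close>

lemma C_diff_on_SucI:
  assumes "open S" "\<And>x. x \<in> S \<Longrightarrow> (f has_derivative f' x) (at x)"
    and "\<And>v. C_diff_on k S (\<lambda>x. f' x v)"
  shows "C_diff_on (Suc k) S f"
proof -
  have "C_diff_on k S (\<lambda>x. frechet_derivative f (at x) v) \<longleftrightarrow> C_diff_on k S (\<lambda>x. f' x v)" for v
    by (rule C_diff_on_cong[OF assms(1)]) (metis assms(2) frechet_derivative_at)
  then show ?thesis
    using assms(2,3) by (auto simp: differentiable_def)
qed

lemma C_diff_on_Suc_has_derivative:
  "C_diff_on (Suc k) S f \<Longrightarrow> x \<in> S \<Longrightarrow> (f has_derivative frechet_derivative f (at x)) (at x)"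
  by (simp add: frechet_derivative_works)

lemma C_diff_on_SucD: "C_diff_on (Suc k) S f \<Longrightarrow> C_diff_on k S f"
proof (induction k arbitrary: f)
  case 0
  then show ?case
    by (auto intro!: continuous_at_imp_continuous_on differentiable_imp_continuous_within)
next
  case (Suc k)
  then show ?case by simp
qed

lemma C_diff_on_subset: "C_diff_on k S f \<Longrightarrow> R \<subseteq> S \<Longrightarrow> C_diff_on k R f"
  by (induction k arbitrary: f) (auto intro: continuous_on_subset)

lemma C_diff_on_local:
  assumes "open S" "\<And>x. x \<in> S \<Longrightarrow> \<exists>R. open R \<and> x \<in> R \<and> C_diff_on k (S \<inter> R) f"
  shows "C_diff_on k S f"
  using assms(2)
proof (induction k arbitrary: f)
  case 0
  have "isCont f x" if x: "x \<in> S" for x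
  proof -
    obtain R where "open R" "x \<in> R" "continuous_on (S \<inter> R) f" using 0 x by auto
    then show ?thesis using x \<open>open S\<close>
      by (metis IntI continuous_on_eq_continuous_at open_Int)
  qed
  then show ?case by (simp add: continuous_at_imp_continuous_on)
next
  case (Suc k)
  have "f differentiable (at x)" if "x \<in> S" for x
    using Suc.prems[OF that] that by auto
  moreover have "C_diff_on k S (\<lambda>x. frechet_derivative f (at x) v)" for v
  proof (rule Suc.IH)
    fix x assume "x \<in> S"
    then obtain R where "open R" "x \<in> R" "C_diff_on (Suc k) (S \<inter> R) f" using Suc.prems by blast
    then show "\<exists>R. open R \<and> x \<in> R \<and> C_diff_on k (S \<inter> R) (\<lambda>x. frechet_derivative f (at x) v)" by auto
  qed
  ultimately show ?case by simp
qed

lemma C_diff_on_const: "open S \<Longrightarrow> C_diff_on k S (\<lambda>x. c)"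
proof (induction k arbitrary: c)
  case (Suc k)
  then show ?case by (intro C_diff_on_SucI[where f' = "\<lambda>_ _. 0"]) auto
qed simp

lemma C_diff_on_id: "open S \<Longrightarrow> C_diff_on k S (\<lambda>x. x)"
proof (induction k)
  case (Suc k)
  then show ?case
    by (intro C_diff_on_SucI[where f' = "\<lambda>_ v. v"]) (auto intro: C_diff_on_const has_derivative_ident)
qed simp

lemma C_diff_on_bounded_linear:
  assumes "open S" "bounded_linear L" "C_diff_on k S f"
  shows "C_diff_on k S (\<lambda>x. L (f x))"
  using assms(3)
proof (induction k arbitrary: f)
  case 0
  then show ?case using bounded_linear.continuous_on[OF assms(2)] by simp
next
  case (Suc k)
  have "C_diff_on k S (\<lambda>x. L (frechet_derivative f (at x) v))" for v
    using Suc by simp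
  then show ?case
    by (intro C_diff_on_SucI[where f' = "\<lambda>x v. L (frechet_derivative f (at x) v)"] assms)
       (use Suc.prems in \<open>auto intro!: bounded_linear.has_derivative[OF assms(2)]
          C_diff_on_Suc_has_derivative\<close>)
qed

lemma C_diff_on_add:
  assumes "open S" "C_diff_on k S f" "C_diff_on k S g"
  shows "C_diff_on k S (\<lambda>x. f x + g x)"
  using assms(2,3)
proof (induction k arbitrary: f g)
  case 0
  then show ?case by (auto intro: continuous_on_add)
next
  case (Suc k)
  have "C_diff_on k S (\<lambda>x. frechet_derivative f (at x) v + frechet_derivative g (at x) v)" for v
    using Suc by simp
  then show ?case
    by (intro C_diff_on_SucI[where f' = "\<lambda>x v. frechet_derivative f (at x) v + frechet_derivative g (at x) v"] assms)
       (use Suc.prems in \<open>auto intro!: has_derivative_add C_diff_on_Suc_has_derivative\<close>)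
qed

lemma C_diff_on_sum:
  assumes "open S" "finite I" "\<And>i. i \<in> I \<Longrightarrow> C_diff_on k S (f i)"
  shows "C_diff_on k S (\<lambda>x. \<Sum>i\<in>I. f i x)"
  using assms(2,3)
  by (induction I rule: finite_induct) (auto intro: C_diff_on_const C_diff_on_add assms(1))

lemma C_diff_on_bilinear:
  assumes "open S" "bounded_bilinear bp" "C_diff_on k S f" "C_diff_on k S g"
  shows "C_diff_on k S (\<lambda>x. bp (f x) (g x))"
  using assms(3,4)
proof (induction k arbitrary: f g)
  case 0
  then show ?case using bounded_bilinear.continuous_on[OF assms(2)] by simp
next
  case (Suc k)
  have "C_diff_on k S (\<lambda>x. bp (f x) (frechet_derivative g (at x) v) + bp (frechet_derivative f (at x) v) (g x))" for v
    using Suc.prems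
    by (intro C_diff_on_add assms Suc.IH) (simp_all add: C_diff_on_SucD[OF Suc.prems(1)] C_diff_on_SucD[OF Suc.prems(2)])
  then show ?case
    by (intro C_diff_on_SucI[where f' = "\<lambda>x v. bp (f x) (frechet_derivative g (at x) v) + bp (frechet_derivative f (at x) v) (g x)"] assms)
       (use Suc.prems in \<open>auto intro!: bounded_bilinear.FDERIV[OF assms(2)] C_diff_on_Suc_has_derivative\<close>)
qed

lemma linear_basis_expansion:
  fixes L :: "'a::euclidean_space \<Rightarrow> 'b::real_vector"
  assumes "linear L"
  shows "L u = (\<Sum>b\<in>Basis. (u \<bullet> b) *\<^sub>R L b)"
proof -
  have "L u = L (\<Sum>b\<in>Basis. (u \<bullet> b) *\<^sub>R b)" by (simp add: euclidean_representation)
  also have "\<dots> = (\<Sum>b\<in>Basis. (u \<bullet> b) *\<^sub>R L b)"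
    by (simp add: linear_sum[OF assms] linear_cmul[OF assms])
  finally show ?thesis .
qed

text \<open>In the chain rule both the base point and the direction move with \<open>x\<close>,
  while the recursion defining \<open>C_diff_on\<close> keeps the direction fixed. Expanding the
  direction in the basis leaves products of scalar functions with
  \<open>frechet_derivative f (at (g x)) b\<close> for fixed \<open>b\<close>, to which the
  induction hypothesis applies. Hence the Euclidean middle space.\<close>

lemma C_diff_on_compose:
  fixes f :: "'b::euclidean_space \<Rightarrow> 'c::real_normed_vector" and g :: "'a::real_normed_vector \<Rightarrow> 'b"
  assumes "open S" "open R" "C_diff_on k R f" "C_diff_on k S g" "\<And>x. x \<in> S \<Longrightarrow> g x \<in> R"
  shows "C_diff_on k S (\<lambda>x. f (g x))"
  using assms(3,4)
proof (induction k arbitrary: f)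
  case 0
  then show ?case
    using continuous_on_compose2[of R f S g] assms(5) by auto
next
  case (Suc k)
  let ?f' = "\<lambda>x v. frechet_derivative f (at (g x)) (frechet_derivative g (at x) v)"
  let ?h = "\<lambda>v x. \<Sum>b\<in>Basis. (frechet_derivative g (at x) v \<bullet> b) *\<^sub>R frechet_derivative f (at (g x)) b"
  have f: "(f has_derivative frechet_derivative f (at y)) (at y)" if "y \<in> R" for y
    using C_diff_on_Suc_has_derivative Suc.prems(1) that .
  have g: "(g has_derivative frechet_derivative g (at x)) (at x)" if "x \<in> S" for x
    using C_diff_on_Suc_has_derivative Suc.prems(2) that .
  have eq: "?h v x = ?f' x v" if "x \<in> S" for v x
    by (rule linear_basis_expansion[OF has_derivative_linear[OF f], symmetric]) (rule assms(5)[OF that])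
  have "C_diff_on k S (?h v)" for v
    by (intro C_diff_on_sum C_diff_on_bilinear[OF _ bounded_bilinear_scaleR] assms Suc.IH finite_Basis
        C_diff_on_bounded_linear[OF _ bounded_linear_inner_left] C_diff_on_SucD[OF Suc.prems(2)])
       (use Suc.prems in simp_all)
  moreover have "C_diff_on k S (?h v) \<longleftrightarrow> C_diff_on k S (\<lambda>x. ?f' x v)" for v
    by (rule C_diff_on_cong[OF assms(1)]) (rule eq)
  ultimately have "C_diff_on k S (\<lambda>x. ?f' x v)" for v by simp
  then show ?case
    by (intro C_diff_on_SucI[where f' = ?f'] assms)
       (use f g assms(5) in \<open>auto intro!: has_derivative_compose[of g _ _ UNIV f]\<close>)
qed

section \<open>Closure properties of smooth maps on open sets\<close>

lemma smooth_on_open: "smooth_on S f \<Longrightarrow> open S"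
  and smooth_on_C_diff: "smooth_on S f \<Longrightarrow> C_diff_on k S f"
  by (simp_all add: smooth_on_def)

lemma smooth_on_has_derivative:
  "smooth_on S f \<Longrightarrow> x \<in> S \<Longrightarrow> (f has_derivative frechet_derivative f (at x)) (at x)"
  by (rule C_diff_on_Suc_has_derivative[OF smooth_on_C_diff])

lemma smooth_on_linear_derivative: "smooth_on S f \<Longrightarrow> x \<in> S \<Longrightarrow> linear (frechet_derivative f (at x))"
  by (rule has_derivative_linear[OF smooth_on_has_derivative])

lemma smooth_on_frechet_derivative: "smooth_on S f \<Longrightarrow> smooth_on S (\<lambda>x. frechet_derivative f (at x) v)"
  unfolding smooth_on_def by (metis C_diff_on.simps(2))

lemma smooth_on_imp_continuous_on: "smooth_on S f \<Longrightarrow> continuous_on S f"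
  using smooth_on_C_diff[of S f 0] by simp

lemma smooth_on_cong: "(\<And>x. x \<in> S \<Longrightarrow> f x = g x) \<Longrightarrow> smooth_on S f \<longleftrightarrow> smooth_on S g"
  unfolding smooth_on_def using C_diff_on_cong by blast

lemma smooth_on_subset: "smooth_on S f \<Longrightarrow> open R \<Longrightarrow> R \<subseteq> S \<Longrightarrow> smooth_on R f"
  unfolding smooth_on_def using C_diff_on_subset by blast

lemma smooth_on_local:
  assumes "\<And>x. x \<in> S \<Longrightarrow> \<exists>R. x \<in> R \<and> R \<subseteq> S \<and> smooth_on R f"
  shows "smooth_on S f"
proof -
  have "open S" by (subst open_subopen) (use assms smooth_on_open in meson)
  moreover have "C_diff_on k S f" for k
    by (rule C_diff_on_local[OF \<open>open S\<close>]) (metis assms inf.absorb2 smooth_on_C_diff smooth_on_open)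
  ultimately show ?thesis by (simp add: smooth_on_def)
qed

lemma smooth_on_const: "open S \<Longrightarrow> smooth_on S (\<lambda>x. c)"
  and smooth_on_id: "open S \<Longrightarrow> smooth_on S (\<lambda>x. x)"
  by (simp_all add: smooth_on_def C_diff_on_const C_diff_on_id)

lemma smooth_on_bounded_linear: "bounded_linear L \<Longrightarrow> smooth_on S f \<Longrightarrow> smooth_on S (\<lambda>x. L (f x))"
  by (simp add: smooth_on_def C_diff_on_bounded_linear)

lemma smooth_on_add: "smooth_on S f \<Longrightarrow> smooth_on S g \<Longrightarrow> smooth_on S (\<lambda>x. f x + g x)"
  by (simp add: smooth_on_def C_diff_on_add)

lemma smooth_on_bilinear:
  "bounded_bilinear bp \<Longrightarrow> smooth_on S f \<Longrightarrow> smooth_on S g \<Longrightarrow> smooth_on S (\<lambda>x. bp (f x) (g x))"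
  by (simp add: smooth_on_def C_diff_on_bilinear)

lemma smooth_on_sum:
  "open S \<Longrightarrow> finite I \<Longrightarrow> (\<And>i. i \<in> I \<Longrightarrow> smooth_on S (f i)) \<Longrightarrow> smooth_on S (\<lambda>x. \<Sum>i\<in>I. f i x)"
  by (simp add: smooth_on_def C_diff_on_sum)

lemma smooth_on_compose:
  fixes f :: "'b::euclidean_space \<Rightarrow> 'c::real_normed_vector" and g :: "'a::real_normed_vector \<Rightarrow> 'b"
  shows "smooth_on R f \<Longrightarrow> smooth_on S g \<Longrightarrow> (\<And>x. x \<in> S \<Longrightarrow> g x \<in> R) \<Longrightarrow> smooth_on S (\<lambda>x. f (g x))"
  unfolding smooth_on_def using C_diff_on_compose[of S R] by blast

lemma smooth_on_Pair:
  assumes "smooth_on S f" "smooth_on S g"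
  shows "smooth_on S (\<lambda>x. (f x, g x))"
proof -
  have "smooth_on S (\<lambda>x. (f x, 0) + (0, g x))"
    by (intro smooth_on_add smooth_on_bounded_linear[OF _ assms(1)] smooth_on_bounded_linear[OF _ assms(2)]
        bounded_linear_Pair bounded_linear_ident bounded_linear_zero)
  then show ?thesis by simp
qed

text \<open>The same basis expansion once more. With \<open>u\<close> as the fibre coordinate this
  is smoothness of the tangent map.\<close>

lemma smooth_on_frechet_derivative_apply:
  fixes f :: "'b::euclidean_space \<Rightarrow> 'c::real_normed_vector"
  assumes "smooth_on R f" "smooth_on S g" "smooth_on S u" "\<And>x. x \<in> S \<Longrightarrow> g x \<in> R"
  shows "smooth_on S (\<lambda>x. frechet_derivative f (at (g x)) (u x))"
proof -
  have "frechet_derivative f (at (g x)) (u x) =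
      (\<Sum>b\<in>Basis. (u x \<bullet> b) *\<^sub>R frechet_derivative f (at (g x)) b)" if "x \<in> S" for x
    by (rule linear_basis_expansion[OF smooth_on_linear_derivative[OF assms(1) assms(4)[OF that]]])
  moreover have "smooth_on S (\<lambda>x. \<Sum>b\<in>Basis. (u x \<bullet> b) *\<^sub>R frechet_derivative f (at (g x)) b)"
    by (intro smooth_on_sum smooth_on_bilinear[OF bounded_bilinear_scaleR] finite_Basis
        smooth_on_bounded_linear[OF bounded_linear_inner_left] assms(3)
        smooth_on_compose[OF smooth_on_frechet_derivative[OF assms(1)] assms(2)] assms(4)
        smooth_on_open[OF assms(2)])
  ultimately show ?thesis
    by (subst smooth_on_cong)
qed

subsection \<open>Symmetry of second derivatives\<close>

text \<open>The mean value theorem is applied twice: in the direction \<open>u\<close> to the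
  increment of \<open>f\<close> along \<open>v\<close>, then in the direction \<open>v\<close> to
  the derivative along \<open>u\<close>.\<close>

lemma second_difference:
  fixes f :: "'a::real_normed_vector \<Rightarrow> real"
  assumes f: "smooth_on S f" and h: "h > 0"
    and S: "\<And>s t. 0 \<le> s \<Longrightarrow> s \<le> h \<Longrightarrow> 0 \<le> t \<Longrightarrow> t \<le> h \<Longrightarrow> x + s *\<^sub>R u + t *\<^sub>R v \<in> S"
  shows "\<exists>s t. 0 \<le> s \<and> s \<le> h \<and> 0 \<le> t \<and> t \<le> h \<and>
    f (x + h *\<^sub>R u + h *\<^sub>R v) - f (x + h *\<^sub>R u) - f (x + h *\<^sub>R v) + f x =
    h * h * frechet_derivative (\<lambda>y. frechet_derivative f (at y) u) (at (x + s *\<^sub>R u + t *\<^sub>R v)) v"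
proof -
  let ?D = "\<lambda>y. frechet_derivative f (at y) u"
  have df: "((\<lambda>s. f (x + s *\<^sub>R u + t *\<^sub>R v)) has_real_derivative ?D (x + s *\<^sub>R u + t *\<^sub>R v)) (at s)"
    if "0 \<le> s" "s \<le> h" "0 \<le> t" "t \<le> h" for s t
  proof -
    have "((\<lambda>s. f (x + s *\<^sub>R u + t *\<^sub>R v)) has_derivative
        (\<lambda>r. frechet_derivative f (at (x + s *\<^sub>R u + t *\<^sub>R v)) (r *\<^sub>R u))) (at s)"
      by (rule has_derivative_compose[OF _ smooth_on_has_derivative[OF f]])
         (use S that in \<open>auto intro!: derivative_eq_intros\<close>)
    then show ?thesis
      unfolding has_field_derivative_def
      by (simp add: linear_cmul[OF smooth_on_linear_derivative[OF f S[OF that]]] mult_commute_abs)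
  qed
  note D = smooth_on_frechet_derivative[OF f, of u]
  have dD: "((\<lambda>t. ?D (x + s *\<^sub>R u + t *\<^sub>R v)) has_real_derivative
      frechet_derivative ?D (at (x + s *\<^sub>R u + t *\<^sub>R v)) v) (at t)"
    if "0 \<le> s" "s \<le> h" "0 \<le> t" "t \<le> h" for s t
  proof -
    have "((\<lambda>t. ?D (x + s *\<^sub>R u + t *\<^sub>R v)) has_derivative
        (\<lambda>r. frechet_derivative ?D (at (x + s *\<^sub>R u + t *\<^sub>R v)) (r *\<^sub>R v))) (at t)"
      by (rule has_derivative_compose[OF _ smooth_on_has_derivative[OF D]])
         (use S that in \<open>auto intro!: derivative_eq_intros\<close>)
    then show ?thesis
      unfolding has_field_derivative_def
      by (simp add: linear_cmul[OF smooth_on_linear_derivative[OF D S[OF that]]] mult_commute_abs)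
  qed
  let ?g = "\<lambda>s. f (x + s *\<^sub>R u + h *\<^sub>R v) - f (x + s *\<^sub>R u + 0 *\<^sub>R v)"
  have "\<exists>s. 0 < s \<and> s < h \<and>
      ?g h - ?g 0 = (h - 0) * (?D (x + s *\<^sub>R u + h *\<^sub>R v) - ?D (x + s *\<^sub>R u + 0 *\<^sub>R v))"
    by (rule MVT2[OF h]) (intro derivative_intros df, use h in auto)
  then obtain s where s: "0 < s" "s < h"
    "?g h - ?g 0 = h * (?D (x + s *\<^sub>R u + h *\<^sub>R v) - ?D (x + s *\<^sub>R u + 0 *\<^sub>R v))" by auto
  have "\<exists>t. 0 < t \<and> t < h \<and> ?D (x + s *\<^sub>R u + h *\<^sub>R v) - ?D (x + s *\<^sub>R u + 0 *\<^sub>R v) =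
      (h - 0) * frechet_derivative ?D (at (x + s *\<^sub>R u + t *\<^sub>R v)) v"
    by (rule MVT2[OF h]) (rule dD, use s in auto)
  then obtain t where t: "0 < t" "t < h" "?D (x + s *\<^sub>R u + h *\<^sub>R v) - ?D (x + s *\<^sub>R u + 0 *\<^sub>R v) =
      h * frechet_derivative ?D (at (x + s *\<^sub>R u + t *\<^sub>R v)) v" by auto
  show ?thesis
    by (rule exI[of _ s], rule exI[of _ t]) (use s t in \<open>auto simp: algebra_simps\<close>)
qed

text \<open>The second difference over a parallelogram does not change when \<open>u\<close> and
  \<open>v\<close> are exchanged. So one mixed derivative at some point of the parallelogram equals
  the other one at another point, and continuity moves both points to \<open>x\<close>.\<close>

lemma second_derivative_symmetric_real:
  fixes f :: "'a::real_normed_vector \<Rightarrow> real"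
  assumes f: "smooth_on S f" and x: "x \<in> S"
  shows "frechet_derivative (\<lambda>y. frechet_derivative f (at y) u) (at x) v =
    frechet_derivative (\<lambda>y. frechet_derivative f (at y) v) (at x) u"
proof -
  let ?H = "\<lambda>u v y. frechet_derivative (\<lambda>y. frechet_derivative f (at y) u) (at y) v"
  have cont: "isCont (?H u v) x" for u v
    using smooth_on_imp_continuous_on[OF smooth_on_frechet_derivative[OF smooth_on_frechet_derivative[OF f]]]
      smooth_on_open[OF f] x by (simp add: continuous_on_eq_continuous_at)
  have "\<bar>?H u v x - ?H v u x\<bar> < e" if e: "e > 0" for e
  proof -
    obtain d1 where d1: "d1 > 0" "\<And>y. dist y x < d1 \<Longrightarrow> dist (?H u v y) (?H u v x) < e/2"
      using cont[of u v] e unfolding continuous_at_eps_delta by (metis half_gt_zero)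
    obtain d2 where d2: "d2 > 0" "\<And>y. dist y x < d2 \<Longrightarrow> dist (?H v u y) (?H v u x) < e/2"
      using cont[of v u] e unfolding continuous_at_eps_delta by (metis half_gt_zero)
    obtain d3 where d3: "d3 > 0" "ball x d3 \<subseteq> S"
      using smooth_on_open[OF f] x openE by blast
    define d where "d = min d1 (min d2 d3)"
    \<comment> \<open>Every point of the parallelogram is then closer to \<open>x\<close> than
      \<open>d\<close>; the summand 1 covers the case \<open>u = v = 0\<close>.\<close>
    define h where "h = d / (norm u + norm v + 1)"
    have "d > 0" using d1 d2 d3 by (simp add: d_def)
    have pos: "norm u + norm v + 1 > 0" by (simp add: add_nonneg_pos)
    have h: "h > 0" using \<open>d > 0\<close> pos by (simp add: h_def)
    have near: "dist (x + s *\<^sub>R a + t *\<^sub>R b) x < d" if "0 \<le> s" "s \<le> h" "0 \<le> t" "t \<le> h"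
      "a = u \<and> b = v \<or> a = v \<and> b = u" for s t a b
    proof -
      have "dist (x + s *\<^sub>R a + t *\<^sub>R b) x = norm (s *\<^sub>R a + t *\<^sub>R b)"
        by (simp add: dist_norm add.assoc)
      also have "\<dots> \<le> s * norm a + t * norm b"
        using norm_triangle_ineq[of "s *\<^sub>R a" "t *\<^sub>R b"] that by simp
      also have "\<dots> \<le> h * norm a + h * norm b"
        using that by (intro add_mono mult_right_mono) auto
      also have "\<dots> = h * (norm u + norm v)" using that by (auto simp: algebra_simps)
      also have "\<dots> < h * (norm u + norm v + 1)" using h by simp
      also have "\<dots> = d" using pos by (simp add: h_def)
      finally show ?thesis .
    qed
    have inS: "x + s *\<^sub>R a + t *\<^sub>R b \<in> S" if "0 \<le> s" "s \<le> h" "0 \<le> t" "t \<le> h"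
      "a = u \<and> b = v \<or> a = v \<and> b = u" for s t a b
      using near[OF that] d3(2) by (auto simp: d_def dist_commute subset_iff)
    obtain s t where st: "0 \<le> s" "s \<le> h" "0 \<le> t" "t \<le> h" and
      1: "f (x + h *\<^sub>R u + h *\<^sub>R v) - f (x + h *\<^sub>R u) - f (x + h *\<^sub>R v) + f x = h * h * ?H u v (x + s *\<^sub>R u + t *\<^sub>R v)"
      using second_difference[OF f h, of x u v] inS by blast
    obtain s' t' where st': "0 \<le> s'" "s' \<le> h" "0 \<le> t'" "t' \<le> h" and
      2: "f (x + h *\<^sub>R v + h *\<^sub>R u) - f (x + h *\<^sub>R v) - f (x + h *\<^sub>R u) + f x = h * h * ?H v u (x + s' *\<^sub>R v + t' *\<^sub>R u)"
      using second_difference[OF f h, of x v u] inS by blast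
    have "h * h * ?H u v (x + s *\<^sub>R u + t *\<^sub>R v) = h * h * ?H v u (x + s' *\<^sub>R v + t' *\<^sub>R u)"
      unfolding 1[symmetric] 2[symmetric] by (simp add: algebra_simps)
    then have "?H u v (x + s *\<^sub>R u + t *\<^sub>R v) = ?H v u (x + s' *\<^sub>R v + t' *\<^sub>R u)" using h by simp
    moreover have "dist (?H u v (x + s *\<^sub>R u + t *\<^sub>R v)) (?H u v x) < e/2"
      by (rule d1(2)) (use near[OF st, of u v] in \<open>simp add: d_def\<close>)
    moreover have "dist (?H v u (x + s' *\<^sub>R v + t' *\<^sub>R u)) (?H v u x) < e/2"
      by (rule d2(2)) (use near[OF st', of v u] in \<open>simp add: d_def\<close>)
    ultimately show ?thesis unfolding dist_real_def by linarith
  qed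
  \<comment> \<open>With the gap itself as \<open>e\<close>, a positive gap would be smaller than
    itself.\<close>
  from this[of "\<bar>?H u v x - ?H v u x\<bar>"] show ?thesis by linarith
qed

lemma second_derivative_symmetric:
  fixes f :: "'a::real_normed_vector \<Rightarrow> 'b::euclidean_space"
  assumes f: "smooth_on S f" and x: "x \<in> S"
  shows "frechet_derivative (\<lambda>y. frechet_derivative f (at y) u) (at x) v =
    frechet_derivative (\<lambda>y. frechet_derivative f (at y) v) (at x) u"
proof (rule euclidean_eqI)
  fix b :: 'b assume "b \<in> Basis"
  let ?fb = "\<lambda>y. f y \<bullet> b"
  have inner: "frechet_derivative (\<lambda>y. h y \<bullet> b) (at y) w = frechet_derivative h (at y) w \<bullet> b"
    if "smooth_on S h" "y \<in> S" for h :: "'a \<Rightarrow> 'b" and y w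
    using frechet_derivative_at[OF has_derivative_inner_left[OF smooth_on_has_derivative[OF that]]]
    by (metis)
  have "frechet_derivative (\<lambda>y. frechet_derivative ?fb (at y) u) (at x) v =
      frechet_derivative (\<lambda>y. frechet_derivative f (at y) u) (at x) v \<bullet> b" for u v
  proof -
    have "frechet_derivative (\<lambda>y. frechet_derivative ?fb (at y) u) (at x) =
        frechet_derivative (\<lambda>y. frechet_derivative f (at y) u \<bullet> b) (at x)"
      by (rule frechet_derivative_cong_open[OF smooth_on_open[OF f] x]) (rule inner[OF f])
    then show ?thesis using inner[OF smooth_on_frechet_derivative[OF f] x] by simp
  qed
  then show "frechet_derivative (\<lambda>y. frechet_derivative f (at y) u) (at x) v \<bullet> b =
      frechet_derivative (\<lambda>y. frechet_derivative f (at y) v) (at x) u \<bullet> b"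
    using second_derivative_symmetric_real[OF smooth_on_bounded_linear[OF bounded_linear_inner_left f] x]
    by metis
qed

section \<open>Ordinary differential equations\<close>

text \<open>The operator norm of the derivative is at most the sum of the norms of the partial
  derivatives, which is continuous and so bounded on the compact ball. Convexity turns this bound
  into a Lipschitz constant.\<close>

lemma smooth_on_lipschitz_cball:
  fixes F :: "'z::euclidean_space \<Rightarrow> 'b::real_normed_vector"
  assumes F: "smooth_on S F" and S: "cball z r \<subseteq> S"
  obtains L where "L > 0" "\<And>x y. x \<in> cball z r \<Longrightarrow> y \<in> cball z r \<Longrightarrow> norm (F x - F y) \<le> L * norm (x - y)"
proof -
  let ?N = "\<lambda>x. \<Sum>b\<in>Basis. norm (frechet_derivative F (at x) b)"
  have "continuous_on (cball z r) ?N"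
    by (intro continuous_intros continuous_on_subset[OF smooth_on_imp_continuous_on[OF smooth_on_frechet_derivative[OF F]] S])
  then have "bounded (?N ` cball z r)"
    using compact_continuous_image compact_imp_bounded compact_cball by blast
  then obtain B where B: "\<And>x. x \<in> cball z r \<Longrightarrow> ?N x \<le> B"
    unfolding bounded_real by (metis abs_le_D1 image_eqI)
  have "norm (F x - F y) \<le> B * norm (x - y)" if "x \<in> cball z r" "y \<in> cball z r" for x y
  proof (rule differentiable_bound[OF convex_cball[of z r] _ _ that])
    fix x assume x: "x \<in> cball z r"
    then have D: "(F has_derivative frechet_derivative F (at x)) (at x)"
      using smooth_on_has_derivative[OF F] S by blast
    then show "(F has_derivative frechet_derivative F (at x)) (at x within cball z r)"
      by (rule has_derivative_at_withinI)
    have "onorm (frechet_derivative F (at x)) \<le> ?N x"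
      by (rule onorm_componentwise[OF has_derivative_bounded_linear[OF D]])
    then show "onorm (frechet_derivative F (at x)) \<le> B" using B[OF x] by simp
  qed
  moreover have "B * norm (x - y) \<le> (\<bar>B\<bar> + 1) * norm (x - y)" for x y :: 'z
    by (intro mult_right_mono) auto
  \<comment> \<open>\<open>B\<close> itself need not be positive, for instance when \<open>F\<close>
    is constant.\<close>
  ultimately show ?thesis by (intro that[of "\<bar>B\<bar> + 1"]) (use order_trans in \<open>auto, blast\<close>)
qed

text \<open>Unlike the norm, its square is differentiable also where \<open>d\<close> vanishes.
  Multiplied by \<open>exp (-2 * L * t)\<close> it has a nonpositive derivative.\<close>

lemma gronwall_forward:
  fixes d :: "real \<Rightarrow> 'z::real_inner"
  assumes ab: "a \<le> b"
    and d: "\<And>t. t \<in> {a..b} \<Longrightarrow> (d has_vector_derivative d' t) (at t)"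
    and L: "\<And>t. t \<in> {a..b} \<Longrightarrow> norm (d' t) \<le> L * norm (d t)"
  shows "norm (d b) \<le> norm (d a) * exp (L * (b - a))"
proof -
  let ?D = "\<lambda>t. (d t \<bullet> d t) * exp (-2 * L * t)"
  have "?D b \<le> ?D a"
  proof (rule DERIV_nonpos_imp_nonincreasing[OF ab])
    fix t assume t: "a \<le> t" "t \<le> b"
    have "((\<lambda>t. d t \<bullet> d t) has_real_derivative 2 * (d t \<bullet> d' t)) (at t)"
    proof -
      have "(d has_derivative (\<lambda>h. h *\<^sub>R d' t)) (at t)"
        using d t by (simp add: has_vector_derivative_def)
      from has_derivative_inner[OF this this] show ?thesis
        unfolding has_field_derivative_def
        by (rule has_derivative_eq_rhs) (simp add: fun_eq_iff inner_commute)
    qed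
    then have "(?D has_real_derivative (2 * (d t \<bullet> d' t) - 2 * L * (d t \<bullet> d t)) * exp (-2 * L * t)) (at t)"
      by (auto intro!: derivative_eq_intros simp: algebra_simps)
    moreover have "d t \<bullet> d' t \<le> L * (d t \<bullet> d t)"
    proof -
      have "d t \<bullet> d' t \<le> norm (d t) * norm (d' t)" by (rule norm_cauchy_schwarz)
      also have "\<dots> \<le> norm (d t) * (L * norm (d t))" using L t by (intro mult_left_mono) auto
      also have "\<dots> = L * (d t \<bullet> d t)" by (simp add: dot_square_norm power2_eq_square)
      finally show ?thesis .
    qed
    then have "(2 * (d t \<bullet> d' t) - 2 * L * (d t \<bullet> d t)) * exp (-2 * L * t) \<le> 0"
      by (intro mult_nonpos_nonneg) auto
    ultimately show "\<exists>y. (?D has_real_derivative y) (at t) \<and> y \<le> 0" by blast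
  qed
  then have "(d b \<bullet> d b) \<le> (d a \<bullet> d a) * (exp (-2 * L * a) / exp (-2 * L * b))"
    by (simp add: field_simps)
  also have "exp (-2 * L * a) / exp (-2 * L * b) = (exp (L * (b - a)))\<^sup>2"
    by (simp add: exp_diff[symmetric] power2_eq_square exp_add[symmetric] algebra_simps)
  finally have "(norm (d b))\<^sup>2 \<le> (norm (d a) * exp (L * (b - a)))\<^sup>2"
    by (simp add: dot_square_norm power_mult_distrib)
  then show ?thesis by (rule power2_le_imp_le) simp
qed

lemma gronwall:
  fixes d :: "real \<Rightarrow> 'z::real_inner"
  assumes st: "s \<in> I" "t \<in> I" and I: "is_interval I"
    and d: "\<And>t. t \<in> I \<Longrightarrow> (d has_vector_derivative d' t) (at t)"
    and L: "\<And>t. t \<in> I \<Longrightarrow> norm (d' t) \<le> L * norm (d t)"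
  shows "norm (d t) \<le> norm (d s) * exp (L * \<bar>t - s\<bar>)"
proof (cases "s \<le> t")
  case True
  then have "{s..t} \<subseteq> I" using I st connected_contains_Icc is_interval_connected_1 by blast
  then have "norm (d t) \<le> norm (d s) * exp (L * (t - s))"
    by (intro gronwall_forward[where d' = d'] True d L) auto
  then show ?thesis using True by simp
next
  case False
  then have sub: "{t..s} \<subseteq> I" using I st connected_contains_Icc is_interval_connected_1 by blast
  have "norm ((d \<circ> uminus) (-t)) \<le> norm ((d \<circ> uminus) (-s)) * exp (L * (-t - (-s)))"
  proof (rule gronwall_forward)
    fix r assume r: "r \<in> {-s..-t}"
    then have *: "-r \<in> I" using sub by auto
    show "(d \<circ> uminus has_vector_derivative - d' (-r)) (at r)"
    proof -
      have "((\<lambda>x. - x) has_vector_derivative -1) (at r)"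
        by (auto intro!: derivative_eq_intros)
      from vector_diff_chain_at[OF this d[OF *]] show ?thesis by (simp add: o_def)
    qed
    show "norm (- d' (-r)) \<le> L * norm ((d \<circ> uminus) r)" using L[OF *] by simp
  qed (use False in auto)
  then show ?thesis using False by simp
qed

text \<open>Banach's fixed point theorem for bounded continuous functions on the whole line. Two
  integrals enter the Picard operator, each with Lipschitz constant \<open>2 * e * L\<close>, so the
  bound on \<open>6 * e * L\<close> yields the contraction factor 2/3.\<close>

lemma picard_lindelof_global:
  fixes F :: "'z::euclidean_space \<Rightarrow> 'z"
  assumes L: "L > 0" "\<And>x y. norm (F x - F y) \<le> L * norm (x - y)" and e: "e > 0" "6 * e * L \<le> 1"
  shows "\<exists>z. z 0 = z0 \<and> (\<forall>t. \<bar>t\<bar> < e \<longrightarrow> (z has_vector_derivative F (z t)) (at t))"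
proof -
  \<comment> \<open>Clamping time to \<open>{-e..e}\<close> turns the Picard iterate into a bounded
    function on the whole line, an element of a complete space.\<close>
  define c where "c t = max (-e) (min e t)" for t
  have c: "c t \<in> {-e..e}" for t using e by (auto simp: c_def)
  have contF: "continuous_on UNIV F"
    by (rule lipschitz_on_continuous_on[of L]) (use L in \<open>auto simp: lipschitz_on_def dist_norm\<close>)
  have contFf: "continuous_on S (\<lambda>t. F (apply_bcontfun f t))" for S :: "real set" and f
    by (rule continuous_on_compose2[OF contF]) auto
  \<comment> \<open>The difference of the two integrals is the oriented integral from 0 to
    \<open>c t\<close>, whatever the sign of \<open>c t\<close>.\<close>
  define P where "P f t = z0 + integral {-e..c t} (\<lambda>t. F (apply_bcontfun f t))
      - integral {-e..0} (\<lambda>t. F (apply_bcontfun f t))" for f :: "real \<Rightarrow>\<^sub>C 'z" and t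
  have "P f \<in> bcontfun" for f
  proof -
    have ci: "continuous_on {-e..e} (\<lambda>u. integral {-e..u} (\<lambda>t. F (apply_bcontfun f t)))"
      by (intro indefinite_integral_continuous_1 integrable_continuous_real contFf)
    have "continuous_on UNIV c" unfolding c_def by (intro continuous_intros)
    then have "continuous_on UNIV (\<lambda>t. integral {-e..c t} (\<lambda>t. F (apply_bcontfun f t)))"
      using c by (intro continuous_on_compose2[OF ci]) auto
    then have "continuous_on UNIV (P f)" unfolding P_def by (intro continuous_intros)
    moreover have "range (P f) \<subseteq> (\<lambda>u. z0 + integral {-e..u} (\<lambda>t. F (apply_bcontfun f t))
      - integral {-e..0} (\<lambda>t. F (apply_bcontfun f t))) ` {-e..e}"
      using c unfolding P_def by blast
    moreover have "compact \<dots>"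
      by (intro compact_continuous_image continuous_intros ci) auto
    ultimately show ?thesis
      unfolding bcontfun_def using bounded_subset compact_imp_bounded by blast
  qed
  then have P: "apply_bcontfun (Bcontfun (P f)) = P f" for f by (rule Bcontfun_inverse)
  have est: "norm (integral {-e..u} (\<lambda>t. F (apply_bcontfun f t)) - integral {-e..u} (\<lambda>t. F (apply_bcontfun g t)))
      \<le> 2 * e * (L * dist f g)" if u: "u \<in> {-e..e}" for f g u
  proof -
    have "norm (integral {-e..u} (\<lambda>t. F (apply_bcontfun f t) - F (apply_bcontfun g t))) \<le> (L * dist f g) * (u - (-e))"
    proof (rule integral_bound)
      show "norm (F (apply_bcontfun f t) - F (apply_bcontfun g t)) \<le> L * dist f g" for t
      proof (rule order_trans[OF L(2)])
        have "norm (apply_bcontfun f t - apply_bcontfun g t) \<le> dist f g"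
          using dist_bounded[of f t g] by (simp add: dist_norm)
        then show "L * norm (apply_bcontfun f t - apply_bcontfun g t) \<le> L * dist f g"
          using L(1) by (intro mult_left_mono) auto
      qed
    qed (use u contFf in \<open>auto intro!: continuous_intros\<close>)
    also have "\<dots> \<le> (L * dist f g) * (2 * e)" using u L(1) by (intro mult_left_mono) auto
    also have "\<dots> = 2 * e * (L * dist f g)" by (simp only: mult.commute)
    finally show ?thesis
      by (simp only: Henstock_Kurzweil_Integration.integral_diff[OF integrable_continuous_real[OF contFf] integrable_continuous_real[OF contFf]])
  qed
  have "dist (Bcontfun (P f)) (Bcontfun (P g)) \<le> 2/3 * dist f g" for f g
  proof (rule dist_bound)
    fix t
    let ?I = "\<lambda>f u. integral {-e..u} (\<lambda>t. F (apply_bcontfun f t))"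
    have "dist (P f t) (P g t) = norm ((?I f (c t) - ?I g (c t)) - (?I f 0 - ?I g 0))"
      by (simp add: P_def dist_norm algebra_simps)
    also have "\<dots> \<le> 2 * e * (L * dist f g) + 2 * e * (L * dist f g)"
      by (rule order_trans[OF norm_triangle_ineq4 add_mono[OF est[OF c] est]]) (use e(1) in auto)
    also have "\<dots> = (6 * e * L) * (2/3 * dist f g)" by simp
    also have "\<dots> \<le> 1 * (2/3 * dist f g)" using e(2) by (intro mult_right_mono) auto
    finally show "dist (apply_bcontfun (Bcontfun (P f)) t) (apply_bcontfun (Bcontfun (P g)) t) \<le> 2/3 * dist f g"
      by (simp add: P)
  qed
  then have "\<exists>!f. Bcontfun (P f) = f" by (intro banach_fix_type[of "2/3"]) auto
  then obtain f where "Bcontfun (P f) = f" by blast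
  then have f: "apply_bcontfun f t = P f t" for t using P[of f] by metis
  show ?thesis
  proof (intro exI[of _ "apply_bcontfun f"] conjI allI impI)
    have "c 0 = 0" using e by (simp add: c_def)
    then show "apply_bcontfun f 0 = z0" by (simp add: f[of 0] P_def)
  next
    fix t assume t: "\<bar>t\<bar> < e"
    let ?G = "\<lambda>u. z0 + integral {-e..u} (\<lambda>t. F (apply_bcontfun f t)) - integral {-e..0} (\<lambda>t. F (apply_bcontfun f t))"
    have "((\<lambda>u. integral {-e..u} (\<lambda>t. F (apply_bcontfun f t))) has_vector_derivative F (apply_bcontfun f t)) (at t within {-e..e})"
      by (rule integral_has_vector_derivative[OF contFf]) (use t in auto)
    moreover have "at t within {-e..e} = at t"
      by (rule at_within_interior) (use t in \<open>auto simp: interior_atLeastAtMost_real\<close>)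
    ultimately have "(?G has_vector_derivative F (apply_bcontfun f t)) (at t)"
      by (auto intro!: derivative_eq_intros)
    moreover have "?G u = apply_bcontfun f u" if "u \<in> {-e<..<e}" for u
      using that by (simp add: f[of u] P_def c_def)
    ultimately show "(apply_bcontfun f has_vector_derivative F (apply_bcontfun f t)) (at t)"
      by - (rule has_vector_derivative_transform_within_open[where S = "{-e<..<e}"], assumption, use t in auto)
  qed
qed

text \<open>Composed with the nearest-point projection onto the larger ball, \<open>F\<close>
  becomes globally Lipschitz and is unchanged on that ball. A solution starting in the smaller ball
  has no time to leave the larger one, so the same \<open>e\<close> serves all starting
  points.\<close>

lemma local_flow:
  fixes F :: "'z::euclidean_space \<Rightarrow> 'z"
  assumes F: "smooth_on S F" and z0: "z0 \<in> S"
  obtains r e L where "r > 0" "e > 0" "L > 0" "cball z0 (2 * r) \<subseteq> S"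
    "\<And>x y. x \<in> cball z0 (2 * r) \<Longrightarrow> y \<in> cball z0 (2 * r) \<Longrightarrow> norm (F x - F y) \<le> L * norm (x - y)"
    "\<And>z1. z1 \<in> cball z0 r \<Longrightarrow> \<exists>z. z 0 = z1 \<and>
       (\<forall>t. \<bar>t\<bar> < e \<longrightarrow> z t \<in> cball z0 (2 * r) \<and> (z has_vector_derivative F (z t)) (at t))"
proof -
  obtain R where R: "R > 0" "cball z0 R \<subseteq> S"
    using smooth_on_open[OF F] z0 open_contains_cball by blast
  define r where "r = R / 2"
  have r: "r > 0" "cball z0 (2 * r) \<subseteq> S" using R by (auto simp: r_def)
  let ?B = "cball z0 (2 * r)"
  obtain L where L: "L > 0" "\<And>x y. x \<in> ?B \<Longrightarrow> y \<in> ?B \<Longrightarrow> norm (F x - F y) \<le> L * norm (x - y)"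
    using smooth_on_lipschitz_cball[OF F r(2)] by blast
  have "bounded (F ` ?B)"
    by (intro compact_imp_bounded compact_continuous_image compact_cball
        continuous_on_subset[OF smooth_on_imp_continuous_on[OF F] r(2)])
  then obtain M where M: "M > 0" "\<And>x. x \<in> ?B \<Longrightarrow> norm (F x) \<le> M"
    unfolding bounded_pos by auto
  let ?F = "\<lambda>z. F (closest_point ?B z)"
  have cp: "closest_point ?B z \<in> ?B" for z
    by (rule closest_point_in_set) (use r in auto)
  have Lg: "norm (?F x - ?F y) \<le> L * norm (x - y)" for x y
  proof -
    have "dist (closest_point ?B x) (closest_point ?B y) \<le> dist x y"
      by (rule closest_point_lipschitz) (use r in auto)
    then have "L * norm (closest_point ?B x - closest_point ?B y) \<le> L * norm (x - y)"
      using L(1) by (intro mult_left_mono) (auto simp: dist_norm)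
    then show ?thesis by (rule order_trans[OF L(2)[OF cp cp]])
  qed
  \<comment> \<open>The first bound is required by \<open>picard_lindelof_global\<close>; the second
    confines a motion of speed at most \<open>M\<close> to distance \<open>r\<close>.\<close>
  define e where "e = min (1 / (6 * L)) (r / M)"
  have e: "e > 0" "6 * e * L \<le> 1" "e * M \<le> r"
    using L(1) M(1) r(1) by (auto simp: e_def min_def field_simps)
  have sol: "\<exists>z. z 0 = z1 \<and> (\<forall>t. \<bar>t\<bar> < e \<longrightarrow> z t \<in> ?B \<and> (z has_vector_derivative F (z t)) (at t))"
    if z1: "z1 \<in> cball z0 r" for z1
  proof -
    obtain z where z': "z 0 = z1 \<and> (\<forall>t. \<bar>t\<bar> < e \<longrightarrow> (z has_vector_derivative ?F (z t)) (at t))"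
      using picard_lindelof_global[OF L(1) Lg e(1,2), of z1] ..
    have z: "z 0 = z1" "\<And>t. \<bar>t\<bar> < e \<Longrightarrow> (z has_vector_derivative ?F (z t)) (at t)"
      using z' by simp_all
    have zB: "z t \<in> ?B" if t: "\<bar>t\<bar> < e" for t
    proof -
      have "norm (z t - z 0) \<le> M * norm (t - 0)"
      proof (rule differentiable_bound[where S = "{-e<..<e}" and f' = "\<lambda>x h. h *\<^sub>R ?F (z x)"])
        fix x assume x: "x \<in> {-e<..<e}"
        then show "(z has_derivative (\<lambda>h. h *\<^sub>R ?F (z x))) (at x within {-e<..<e})"
          using z(2)[of x] by (auto simp: has_vector_derivative_def intro: has_derivative_at_withinI)
        show "onorm (\<lambda>h. h *\<^sub>R ?F (z x)) \<le> M"
          using M(2)[OF cp[of "z x"]] by (intro onorm_le) (simp add: mult.commute[of M] mult_left_mono)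
      qed (use t e in auto)
      also have "\<dots> \<le> M * e" using t M(1) by (intro mult_left_mono) auto
      also have "\<dots> \<le> r" using e by (simp add: mult.commute)
      finally have "dist (z t) z1 \<le> r" using z(1) by (simp add: dist_norm)
      then show ?thesis using z1 dist_triangle[of z0 "z t" z1] by (simp add: dist_commute[of z1])
    qed
    then have "(z has_vector_derivative F (z t)) (at t)" if "\<bar>t\<bar> < e" for t
      using z(2)[OF that] closest_point_self[of "z t" ?B] that by simp
    then show ?thesis by (intro exI[of _ z] conjI allI impI z(1) zB)
  qed
  show ?thesis by (rule that[OF r(1) e(1) L(1) r(2) L(2) sol])
qed

text \<open>Gronwall for the difference of two solutions. It gives uniqueness when the values at
  \<open>s\<close> agree, and otherwise Lipschitz dependence on the initial value.\<close>

lemma ode_solutions_dist: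
  fixes z w :: "real \<Rightarrow> 'z::real_inner"
  assumes "is_interval I" "s \<in> I" "t \<in> I"
    and "\<And>x y. x \<in> B \<Longrightarrow> y \<in> B \<Longrightarrow> norm (F x - F y) \<le> L * norm (x - y)"
    and "\<And>t. t \<in> I \<Longrightarrow> (z has_vector_derivative F (z t)) (at t)" "\<And>t. t \<in> I \<Longrightarrow> z t \<in> B"
    and "\<And>t. t \<in> I \<Longrightarrow> (w has_vector_derivative F (w t)) (at t)" "\<And>t. t \<in> I \<Longrightarrow> w t \<in> B"
  shows "norm (z t - w t) \<le> norm (z s - w s) * exp (L * \<bar>t - s\<bar>)"
  by (rule gronwall[where d' = "\<lambda>t. F (z t) - F (w t)" and I = I])
     (use assms in \<open>auto intro!: has_vector_derivative_diff\<close>)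

text \<open>Bootstrapping: if \<open>z\<close> is of class k, so is its derivative
  \<open>F \<circ> z\<close>, and then \<open>z\<close> is of class k + 1.\<close>

lemma ode_solution_smooth:
  fixes F :: "'z::euclidean_space \<Rightarrow> 'z"
  assumes F: "smooth_on S F" and J: "open J"
    and z: "\<And>t. t \<in> J \<Longrightarrow> z t \<in> S" "\<And>t. t \<in> J \<Longrightarrow> (z has_vector_derivative F (z t)) (at t)"
  shows "smooth_on J z"
proof -
  have "C_diff_on k J z" for k
  proof (induction k)
    case 0
    then show ?case
      using z(2) by (auto intro!: continuous_at_imp_continuous_on has_vector_derivative_continuous)
  next
    case (Suc k)
    have "C_diff_on k J (\<lambda>t. F (z t))"
      by (rule C_diff_on_compose[OF J smooth_on_open[OF F] smooth_on_C_diff[OF F] Suc z(1)])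
    then have "C_diff_on k J (\<lambda>t. v *\<^sub>R F (z t))" for v
      by (rule C_diff_on_bounded_linear[OF J bounded_linear_scaleR_right])
    then show ?case
      using z(2) by (intro C_diff_on_SucI[where f' = "\<lambda>t v. v *\<^sub>R F (z t)"] J)
        (auto simp: has_vector_derivative_def)
  qed
  then show ?thesis using J by (simp add: smooth_on_def)
qed

section \<open>Lorentz forms\<close>

lemma bilinear_basis_expansion:
  fixes B :: "'a::euclidean_space \<Rightarrow> 'b::euclidean_space \<Rightarrow> 'c::real_vector"
  assumes "bilinear B"
  shows "B u v = (\<Sum>i\<in>Basis. \<Sum>j\<in>Basis. ((u \<bullet> i) * (v \<bullet> j)) *\<^sub>R B i j)"
proof -
  have l: "linear (\<lambda>u. B u v)" "linear (\<lambda>v. B u v)" for u v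
    using assms by (simp_all add: bilinear_def)
  have "B u v = (\<Sum>i\<in>Basis. (u \<bullet> i) *\<^sub>R B i v)" by (rule linear_basis_expansion[OF l(1)])
  also have "\<dots> = (\<Sum>i\<in>Basis. (u \<bullet> i) *\<^sub>R (\<Sum>j\<in>Basis. (v \<bullet> j) *\<^sub>R B i j))"
    by (intro sum.cong refl arg_cong2[where f = scaleR] linear_basis_expansion[OF l(2)])
  finally show ?thesis by (simp add: scaleR_sum_right)
qed

context
  fixes G :: "'e::euclidean_space \<Rightarrow> 'e \<Rightarrow> real"
  assumes G: "lorentz_form G"
begin

lemma lorentz_form_bilinear: "bilinear G"
  and lorentz_form_sym: "G u v = G v u"
  using G unfolding lorentz_form_def by blast+

lemma lorentz_form_simps:
  "G (u + v) w = G u w + G v w" "G w (u + v) = G w u + G w v"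
  "G (u - v) w = G u w - G v w" "G w (u - v) = G w u - G w v"
  "G (c *\<^sub>R u) w = c * G u w" "G w (c *\<^sub>R u) = c * G w u"
  "G (- u) w = - G u w" "G w (- u) = - G w u"
  "G 0 w = 0" "G w 0 = 0"
  using lorentz_form_bilinear
  by (simp_all add: bilinear_ladd bilinear_radd bilinear_lsub bilinear_rsub bilinear_lmul
      bilinear_rmul bilinear_lneg bilinear_rneg bilinear_lzero bilinear_rzero)

text \<open>\<open>H\<close> is the span of the spacelike basis vectors. These are orthogonal to
  each other, so \<open>G h h\<close> is a sum of squared coordinates with positive weights.\<close>

lemma lorentz_form_splitting:
  obtains b0 H where "subspace H" "dim H + 1 = DIM('e)" "G b0 b0 < 0"
    "\<And>h. h \<in> H \<Longrightarrow> G b0 h = 0" "\<And>h. h \<in> H \<Longrightarrow> h \<noteq> 0 \<Longrightarrow> G h h > 0"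
    "\<And>v. \<exists>a. \<exists>h\<in>H. v = a *\<^sub>R b0 + h"
proof -
  obtain b0 B where bB: "b0 \<notin> B \<and> independent (insert b0 B) \<and> span (insert b0 B) = UNIV \<and>
      G b0 b0 < 0 \<and> (\<forall>b\<in>B. G b b > 0) \<and> (\<forall>b\<in>B. G b0 b = 0) \<and>
      (\<forall>b\<in>B. \<forall>b'\<in>B. b \<noteq> b' \<longrightarrow> G b b' = 0)"
    using conjunct2[OF conjunct2[OF G[unfolded lorentz_form_def]]] by (elim exE)
  have b: "b0 \<notin> B" "independent (insert b0 B)" "span (insert b0 B) = UNIV"
    "G b0 b0 < 0" "\<forall>b\<in>B. G b b > 0" "\<forall>b\<in>B. G b0 b = 0" "\<forall>b\<in>B. \<forall>b'\<in>B. b \<noteq> b' \<longrightarrow> G b b' = 0"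
    using bB by blast+
  have ind: "independent B" by (rule independent_mono[OF b(2) subset_insertI])
  have fin: "finite B" by (rule finiteI_independent[OF ind])
  have "dim (span B) = card B" by (rule dim_span_eq_card_independent[OF ind])
  moreover have "card (insert b0 B) = DIM('e)"
    using dim_span_eq_card_independent[OF b(2)] b(3) by simp
  ultimately have d: "dim (span B) + 1 = DIM('e)" using b(1) fin by simp
  have orth: "G b0 h = 0" if "h \<in> span B" for h
    using that by (induction rule: span_induct_alt) (use b(6) in \<open>auto simp: lorentz_form_simps\<close>)
  have pos: "G h h > 0" if h: "h \<in> span B" "h \<noteq> 0" for h
  proof -
    obtain c where c: "h = (\<Sum>b\<in>B. c b *\<^sub>R b)" using h(1) span_finite[OF fin] by auto
    have "G h h = (\<Sum>(i,j)\<in>B \<times> B. G (c i *\<^sub>R i) (c j *\<^sub>R j))"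
      unfolding c by (rule bilinear_sum[OF lorentz_form_bilinear])
    also have "\<dots> = (\<Sum>i\<in>B. \<Sum>j\<in>B. G (c i *\<^sub>R i) (c j *\<^sub>R j))"
      by (simp add: sum.cartesian_product)
    also have "\<dots> = (\<Sum>i\<in>B. G (c i *\<^sub>R i) (c i *\<^sub>R i))"
    proof (rule sum.cong[OF refl])
      fix i assume i: "i \<in> B"
      have "(\<Sum>j\<in>B. G (c i *\<^sub>R i) (c j *\<^sub>R j)) = (\<Sum>j\<in>{i}. G (c i *\<^sub>R i) (c j *\<^sub>R j))"
        by (rule sum.mono_neutral_right[OF fin]) (use i b(7) in \<open>auto simp: lorentz_form_simps\<close>)
      then show "(\<Sum>j\<in>B. G (c i *\<^sub>R i) (c j *\<^sub>R j)) = G (c i *\<^sub>R i) (c i *\<^sub>R i)" by simp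
    qed
    finally have sum: "G h h = (\<Sum>i\<in>B. (c i)\<^sup>2 * G i i)"
      by (simp add: lorentz_form_simps power2_eq_square mult.assoc)
    have "\<exists>i\<in>B. c i \<noteq> 0"
    proof (rule ccontr)
      assume "\<not> (\<exists>i\<in>B. c i \<noteq> 0)"
      then have "h = 0" unfolding c by (intro sum.neutral) auto
      then show False using h(2) by simp
    qed
    then obtain i where i: "i \<in> B" "c i \<noteq> 0" by blast
    then have "0 < (c i)\<^sup>2 * G i i" using b(5) by simp
    moreover have "0 \<le> (c j)\<^sup>2 * G j j" if "j \<in> B" for j using b(5) that by (simp add: less_imp_le)
    ultimately show ?thesis unfolding sum using i(1) fin by (intro sum_pos2) auto
  qed
  have decomp: "\<exists>a. \<exists>h\<in>span B. v = a *\<^sub>R b0 + h" for v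
  proof -
    have "v \<in> span (insert b0 B)" using b(3) by simp
    then obtain k where "v - k *\<^sub>R b0 \<in> span B" using span_breakdown[of b0 "insert b0 B" v] b(1) by auto
    then show ?thesis by (intro exI[of _ k] bexI[of _ "v - k *\<^sub>R b0"]) auto
  qed
  show ?thesis by (rule that[of "span B" b0]) (use d b(4) orth pos decomp in auto)
qed

lemma lorentz_form_nondegenerate:
  assumes "\<And>w. G z w = 0"
  shows "z = 0"
proof -
  obtain b0 H where H: "subspace H" "G b0 b0 < 0" "\<And>h. h \<in> H \<Longrightarrow> G b0 h = 0"
    "\<And>h. h \<in> H \<Longrightarrow> h \<noteq> 0 \<Longrightarrow> G h h > 0" "\<And>v. \<exists>a. \<exists>h\<in>H. v = a *\<^sub>R b0 + h"
    by (rule lorentz_form_splitting) auto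
  obtain a h where z: "h \<in> H" "z = a *\<^sub>R b0 + h" using H(5)[of z] by auto
  have "G z b0 = a * G b0 b0"
    using H(3)[OF z(1)] lorentz_form_sym[of h b0] by (simp add: z(2) lorentz_form_simps)
  then have "a = 0" using assms[of b0] H(2) by simp
  then show ?thesis using H(4)[OF z(1)] assms[of h] z(2) by auto
qed

text \<open>Keeps causal vectors from being orthogonal to the time-orientation, which is why a null
  geodesic cannot change its time-direction.\<close>

lemma lorentz_form_timelike_orthogonal:
  assumes "G t t < 0" "G v t = 0" "G v v \<le> 0"
  shows "v = 0"
proof -
  obtain b0 H where H: "subspace H" "G b0 b0 < 0" "\<And>h. h \<in> H \<Longrightarrow> G b0 h = 0"
    "\<And>h. h \<in> H \<Longrightarrow> h \<noteq> 0 \<Longrightarrow> G h h > 0" "\<And>v. \<exists>a. \<exists>h\<in>H. v = a *\<^sub>R b0 + h"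
    by (rule lorentz_form_splitting) auto
  obtain a h where v: "h \<in> H" "v = a *\<^sub>R b0 + h" using H(5)[of v] by auto
  obtain c k where t: "k \<in> H" "t = c *\<^sub>R b0 + k" using H(5)[of t] by auto
  \<comment> \<open>The combination in which the \<open>b0\<close> components cancel. It lies in
    \<open>H\<close>, so \<open>G u u \<ge> 0\<close>, whereas both terms of its expansion are
    nonpositive.\<close>
  define u where "u = c *\<^sub>R v - a *\<^sub>R t"
  have "u = c *\<^sub>R h - a *\<^sub>R k" by (simp add: u_def v t algebra_simps)
  then have "u \<in> H" using v(1) t(1) H(1) by (simp add: subspace_diff subspace_scale)
  then have "0 \<le> G u u" using H(4)[of u] by (cases "u = 0") (auto simp: lorentz_form_simps)
  moreover have "G u u = c\<^sup>2 * G v v + a\<^sup>2 * G t t"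
    using assms(2) lorentz_form_sym[of t v]
    by (simp add: u_def lorentz_form_simps power2_eq_square algebra_simps)
  moreover have "c\<^sup>2 * G v v \<le> 0" using assms(3) by (simp add: mult_nonneg_nonpos)
  ultimately have "a\<^sup>2 * G t t \<ge> 0" by linarith
  then have "a = 0" using assms(1) by (auto simp: zero_le_mult_iff)
  then show ?thesis using H(4)[OF v(1)] v(2) assms(3) by fastforce
qed

text \<open>\<open>N\<close> is the half-cone with positive \<open>b0\<close> coordinate, a graph
  over the hyperplane \<open>H\<close> without 0. The dimension bound gives \<open>H\<close>
  dimension at least 2, and a punctured space of that dimension is connected.\<close>

lemma null_cone_connected:
  assumes "DIM('e) \<ge> 3"
  obtains N where "connected N" "\<And>v. v \<in> N \<Longrightarrow> v \<noteq> 0 \<and> G v v = 0"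
    "\<And>v. v \<noteq> 0 \<Longrightarrow> G v v = 0 \<Longrightarrow> v \<in> N \<or> - v \<in> N"
proof -
  obtain b0 H where H: "subspace H" "dim H + 1 = DIM('e)" "G b0 b0 < 0" "\<And>h. h \<in> H \<Longrightarrow> G b0 h = 0"
    "\<And>h. h \<in> H \<Longrightarrow> h \<noteq> 0 \<Longrightarrow> G h h > 0" "\<And>v. \<exists>a. \<exists>h\<in>H. v = a *\<^sub>R b0 + h"
    by (rule lorentz_form_splitting) auto
  have b0H: "G h b0 = 0" if "h \<in> H" for h using H(4)[OF that] lorentz_form_sym by simp
  \<comment> \<open>The nonnegative root of \<open>s\<^sup>2 * G b0 b0 + G h h = 0\<close>, the
    condition for \<open>f h\<close> to be null.\<close>
  define s where "s h = sqrt (G h h / - G b0 b0)" for h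
  define f where "f h = s h *\<^sub>R b0 + h" for h
  have "connected (H - {0})"
    by (rule connected_punctured_convex) (use H(1,2) assms in \<open>auto simp: subspace_imp_convex aff_dim_subspace\<close>)
  moreover have "continuous_on (H - {0}) f"
  proof -
    have "bounded_bilinear G" using lorentz_form_bilinear bilinear_conv_bounded_bilinear by blast
    from bounded_bilinear.continuous_on[OF this continuous_on_id continuous_on_id]
    show ?thesis unfolding f_def s_def using H(3) by (intro continuous_intros) auto
  qed
  ultimately have conn: "connected (f ` (H - {0}))" by (rule connected_continuous_image[rotated])
  have null: "f h \<noteq> 0 \<and> G (f h) (f h) = 0" if h: "h \<in> H - {0}" for h
  proof -
    have "(s h)\<^sup>2 = G h h / - G b0 b0"
      unfolding s_def using H(3) H(5)[of h] h by (intro real_sqrt_pow2) (simp add: divide_le_0_iff less_imp_le)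
    then have "(s h)\<^sup>2 * G b0 b0 = - G h h" using H(3) by (simp add: field_simps)
    then have "G (f h) (f h) = 0"
      using H(4)[of h] b0H[of h] h by (simp add: f_def lorentz_form_simps power2_eq_square algebra_simps)
    moreover have "G (f h) h > 0" using H(4)[of h] H(5)[of h] h by (simp add: f_def lorentz_form_simps)
    ultimately show ?thesis by (auto simp: lorentz_form_simps)
  qed
  have all: "v \<in> f ` (H - {0}) \<or> - v \<in> f ` (H - {0})" if v: "v \<noteq> 0" "G v v = 0" for v
  proof -
    obtain a h where ah: "h \<in> H" "v = a *\<^sub>R b0 + h" using H(6)[of v] by auto
    have "a\<^sup>2 * G b0 b0 + G h h = 0"
      using v(2) H(4)[OF ah(1)] b0H[OF ah(1)] by (simp add: ah lorentz_form_simps power2_eq_square algebra_simps)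
    then have "a\<^sup>2 = G h h / - G b0 b0" using H(3) by (simp add: field_simps)
    then have sh: "s h = \<bar>a\<bar>" unfolding s_def by (metis real_sqrt_abs)
    have "h \<noteq> 0"
    proof
      assume "h = 0"
      then have "a = 0" using sh by (simp add: s_def lorentz_form_simps)
      then show False using v(1) ah \<open>h = 0\<close> by simp
    qed
    moreover have "- h \<in> H" using ah(1) H(1) subspace_neg by blast
    moreover have "s (- h) = s h" by (simp add: s_def lorentz_form_simps)
    ultimately have "a \<ge> 0 \<Longrightarrow> v = f h \<and> h \<in> H - {0}" "\<not> a \<ge> 0 \<Longrightarrow> - v = f (- h) \<and> - h \<in> H - {0}"
      using ah sh by (simp_all add: f_def)
    then show ?thesis by blast
  qed
  show ?thesis by (rule that[OF conn]) (use null all in auto)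
qed

text \<open>Nondegeneracy makes lowering an index injective, hence bijective in finite dimension.
  This gives a meaning to the definite description in \<open>christoffel\<close>.\<close>

lemma lorentz_form_representation:
  assumes "linear l"
  shows "\<exists>!z. \<forall>w. G z w = l w"
proof -
  let ?f = "\<lambda>z. \<Sum>b\<in>Basis. G z b *\<^sub>R b"
  have lin: "linear ?f"
    by (rule linearI) (simp_all add: lorentz_form_simps scaleR_add_left sum.distrib scaleR_sum_right)
  have expand: "G z w = (\<Sum>b\<in>Basis. (w \<bullet> b) * G z b)" for z w
    using linear_basis_expansion[of "G z" w] lorentz_form_bilinear by (simp add: bilinear_def)
  have coord: "?f z \<bullet> b = G z b" if "b \<in> Basis" for z b
    using that by (rule inner_sum_left_Basis)
  have "inj ?f"
    unfolding linear_injective_0[OF lin]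
  proof (intro allI impI)
    fix z assume "?f z = 0"
    then have "G z b = 0" if "b \<in> Basis" for b using coord[OF that, of z] by simp
    then show "z = 0" by (intro lorentz_form_nondegenerate) (subst expand, simp)
  qed
  then have "surj ?f" using linear_injective_imp_surjective[OF lin] by simp
  then obtain z where "(\<Sum>b\<in>Basis. l b *\<^sub>R b) = ?f z" by (rule surjE)
  note z = this[symmetric]
  have eq: "G z b = l b" if "b \<in> Basis" for b
    using coord[OF that, of z] inner_sum_left_Basis[OF that, of l] unfolding z by simp
  have "G z w = l w" for w
  proof -
    have "G z w = (\<Sum>b\<in>Basis. (w \<bullet> b) * l b)"
      unfolding expand[of z w] by (rule sum.cong) (simp_all add: eq)
    also have "\<dots> = l w"
      using linear_basis_expansion[OF assms, of w] unfolding real_scaleR_def by (rule sym)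
    finally show ?thesis .
  qed
  moreover have "z' = z" if "\<forall>w. G z' w = l w" for z'
  proof -
    have "z' - z = 0"
      by (rule lorentz_form_nondegenerate) (use that calculation in \<open>simp add: lorentz_form_simps\<close>)
    then show ?thesis by simp
  qed
  ultimately show ?thesis by (intro ex1I[of _ z]) auto
qed

end

section \<open>Lorentz metrics in coordinates\<close>

definition metric_deriv :: "('e::euclidean_space \<Rightarrow> 'e \<Rightarrow> 'e \<Rightarrow> real) \<Rightarrow> 'e \<Rightarrow> 'e \<Rightarrow> 'e \<Rightarrow> 'e \<Rightarrow> real" where
  "metric_deriv G q a u v = frechet_derivative (\<lambda>q. G q u v) (at q) a"

text \<open>The expression in \<open>christoffel\<close> with the metric coefficients as an argument
  of its own, so that charts of different manifolds can be compared.\<close>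

definition chris :: "('e::euclidean_space \<Rightarrow> 'e \<Rightarrow> 'e \<Rightarrow> real) \<Rightarrow> 'e \<Rightarrow> 'e \<Rightarrow> 'e \<Rightarrow> 'e" where
  "chris G q u v = (THE z. \<forall>w. G q z w =
     (1/2) * (metric_deriv G q u v w + metric_deriv G q v u w - metric_deriv G q w u v))"

locale lorentz_coords =
  fixes Q :: "'e::euclidean_space set" and G :: "'e \<Rightarrow> 'e \<Rightarrow> 'e \<Rightarrow> real"
  assumes open_domain: "open Q"
    and form: "\<And>q. q \<in> Q \<Longrightarrow> lorentz_form (G q)"
    and smooth_coeff: "\<And>u v. smooth_on Q (\<lambda>q. G q u v)"
begin

lemmas bilin = lorentz_form_bilinear[OF form]
  and form_sym = lorentz_form_sym[OF form]
  and simps = lorentz_form_simps[OF form]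
  and nondegenerate = lorentz_form_nondegenerate[OF form]

lemma coeff_has_derivative: "q \<in> Q \<Longrightarrow> ((\<lambda>q. G q u v) has_derivative (\<lambda>a. metric_deriv G q a u v)) (at q)"
  unfolding metric_deriv_def by (rule smooth_on_has_derivative[OF smooth_coeff])

lemma metric_deriv_eqI:
  assumes "q \<in> Q" "((\<lambda>q. f q) has_derivative D) (at q)" "\<And>p. p \<in> Q \<Longrightarrow> G p u v = f p"
  shows "metric_deriv G q a u v = D a"
proof -
  have "((\<lambda>q. G q u v) has_derivative D) (at q)"
    using has_derivative_cong_open[OF open_domain assms(1), of "\<lambda>q. G q u v" f D] assms(2,3) by simp
  then show ?thesis unfolding metric_deriv_def using frechet_derivative_at by metis
qed

lemma metric_deriv_sym: "q \<in> Q \<Longrightarrow> metric_deriv G q a u v = metric_deriv G q a v u"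
  by (rule metric_deriv_eqI[OF _ coeff_has_derivative]) (use form_sym in auto)

lemma metric_deriv_linear: "q \<in> Q \<Longrightarrow> linear (\<lambda>a. metric_deriv G q a u v)"
  by (rule has_derivative_linear[OF coeff_has_derivative])

lemma metric_deriv_linear_left: "q \<in> Q \<Longrightarrow> linear (\<lambda>u. metric_deriv G q a u v)"
proof (rule linearI)
  fix u u' c assume q: "q \<in> Q"
  show "metric_deriv G q a (u + u') v = metric_deriv G q a u v + metric_deriv G q a u' v"
    by (rule metric_deriv_eqI[OF q has_derivative_add[OF coeff_has_derivative[OF q] coeff_has_derivative[OF q]]])
       (simp add: simps)
  show "metric_deriv G q a (c *\<^sub>R u) v = c *\<^sub>R metric_deriv G q a u v"
    by (rule metric_deriv_eqI[OF q has_derivative_scaleR_right[OF coeff_has_derivative[OF q]]])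
       (simp add: simps)
qed

lemma metric_deriv_linear_right: "q \<in> Q \<Longrightarrow> linear (\<lambda>v. metric_deriv G q a u v)"
  using metric_deriv_linear_left[of q a u] by (simp add: metric_deriv_sym)

lemma metric_deriv_bilinear: "q \<in> Q \<Longrightarrow> bilinear (metric_deriv G q a)"
  unfolding bilinear_def using metric_deriv_linear_left metric_deriv_linear_right by auto

lemma chris_ex1:
  assumes q: "q \<in> Q"
  shows "\<exists>!z. \<forall>w. G q z w =
     (1/2) * (metric_deriv G q u v w + metric_deriv G q v u w - metric_deriv G q w u v)"
proof (rule lorentz_form_representation[OF form[OF q]])
  have "linear (\<lambda>w. (1/2) *\<^sub>R (metric_deriv G q u v w + metric_deriv G q v u w - metric_deriv G q w u v))"
    by (intro linear_compose_scale_right linear_compose_sub linear_compose_add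
        metric_deriv_linear metric_deriv_linear_right q)
  then show "linear (\<lambda>w. (1/2) * (metric_deriv G q u v w + metric_deriv G q v u w - metric_deriv G q w u v))"
    by simp
qed

lemma chris_eq:
  assumes "q \<in> Q"
  shows "G q (chris G q u v) w =
     (1/2) * (metric_deriv G q u v w + metric_deriv G q v u w - metric_deriv G q w u v)"
  using theI'[OF chris_ex1[OF assms]] unfolding chris_def by blast

lemma eqI_form: "q \<in> Q \<Longrightarrow> (\<And>w. G q z w = G q z' w) \<Longrightarrow> z = z'"
  using nondegenerate[of q "z - z'"] by (simp add: simps)

lemma chris_bilinear: "q \<in> Q \<Longrightarrow> bilinear (chris G q)"
proof -
  assume q: "q \<in> Q"
  note lin = linear_add[OF metric_deriv_linear[OF q]] linear_cmul[OF metric_deriv_linear[OF q]]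
    linear_add[OF metric_deriv_linear_left[OF q]] linear_cmul[OF metric_deriv_linear_left[OF q]]
    linear_add[OF metric_deriv_linear_right[OF q]] linear_cmul[OF metric_deriv_linear_right[OF q]]
  show ?thesis
    unfolding bilinear_def
    by (intro conjI allI linearI eqI_form[OF q]) (simp_all add: simps[OF q] chris_eq[OF q] lin algebra_simps)
qed

lemma coeff_expansion: "q \<in> Q \<Longrightarrow> G q u v = (\<Sum>i\<in>Basis. \<Sum>j\<in>Basis. ((u \<bullet> i) * (v \<bullet> j)) * G q i j)"
  using bilinear_basis_expansion[OF bilin, of q u v] unfolding real_scaleR_def .

text \<open>A product rule with three moving arguments. Smoothness of the coefficients is known for
  fixed vectors only, so both vectors are first expanded in the basis.\<close>

lemma has_derivative_coeff:
  assumes q: "(q has_derivative q') (at p)" and u: "(u has_derivative u') (at p)"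
    and v: "(v has_derivative v') (at p)" and Q: "q p \<in> Q"
  shows "((\<lambda>p. G (q p) (u p) (v p)) has_derivative
    (\<lambda>h. metric_deriv G (q p) (q' h) (u p) (v p) + G (q p) (u' h) (v p) + G (q p) (u p) (v' h))) (at p)"
proof (rule has_derivative_transform_eventually)
  let ?f = "\<lambda>p. \<Sum>i\<in>Basis. \<Sum>j\<in>Basis. ((u p \<bullet> i) * (v p \<bullet> j)) * G (q p) i j"
  let ?f' = "\<lambda>h. \<Sum>i\<in>Basis. \<Sum>j\<in>Basis. ((u p \<bullet> i) * (v p \<bullet> j)) * metric_deriv G (q p) (q' h) i j +
    ((u p \<bullet> i) * (v' h \<bullet> j) + (u' h \<bullet> i) * (v p \<bullet> j)) * G (q p) i j"
  have "(?f has_derivative ?f') (at p)"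
    by (intro has_derivative_sum has_derivative_mult has_derivative_inner_left u v
        has_derivative_compose[OF q coeff_has_derivative[OF Q]])
  moreover have "?f' = (\<lambda>h. metric_deriv G (q p) (q' h) (u p) (v p) + G (q p) (u' h) (v p) + G (q p) (u p) (v' h))"
  proof
    fix h
    have "metric_deriv G (q p) (q' h) (u p) (v p) =
        (\<Sum>i\<in>Basis. \<Sum>j\<in>Basis. ((u p \<bullet> i) * (v p \<bullet> j)) * metric_deriv G (q p) (q' h) i j)"
      using bilinear_basis_expansion[OF metric_deriv_bilinear[OF Q], of "q' h" "u p" "v p"]
      unfolding real_scaleR_def .
    then show "?f' h = metric_deriv G (q p) (q' h) (u p) (v p) + G (q p) (u' h) (v p) + G (q p) (u p) (v' h)"
      unfolding coeff_expansion[OF Q, of "u' h"] coeff_expansion[OF Q, of "u p" "v' h"]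
      by (simp only: sum.distrib[symmetric]) (intro sum.cong refl, simp add: algebra_simps)
  qed
  ultimately show "(?f has_derivative (\<lambda>h. metric_deriv G (q p) (q' h) (u p) (v p) + G (q p) (u' h) (v p) + G (q p) (u p) (v' h))) (at p)"
    by simp
  have "(q \<longlongrightarrow> q p) (at p)" using has_derivative_continuous[OF q] by (simp add: continuous_within)
  then have "\<forall>\<^sub>F x in at p. q x \<in> Q" using topological_tendstoD[OF _ open_domain Q] by blast
  then show "\<forall>\<^sub>F x in at p. ?f x = G (q x) (u x) (v x)"
    by eventually_elim (simp add: coeff_expansion[symmetric])
  show "?f p = G (q p) (u p) (v p)" by (simp add: coeff_expansion[OF Q, symmetric])
qed simp

lemma smooth_on_coeff:
  assumes "smooth_on S q" "smooth_on S u" "smooth_on S v" "\<And>p. p \<in> S \<Longrightarrow> q p \<in> Q"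
  shows "smooth_on S (\<lambda>p. G (q p) (u p) (v p))"
proof -
  have "smooth_on S (\<lambda>p. \<Sum>i\<in>Basis. \<Sum>j\<in>Basis. ((u p \<bullet> i) * (v p \<bullet> j)) * G (q p) i j)"
    by (intro smooth_on_sum smooth_on_open[OF assms(1)] finite_Basis smooth_on_bilinear[OF bounded_bilinear_mult]
        smooth_on_bounded_linear[OF bounded_linear_inner_left] assms(2,3)
        smooth_on_compose[OF smooth_coeff assms(1,4)])
  moreover have "G (q p) (u p) (v p) = (\<Sum>i\<in>Basis. \<Sum>j\<in>Basis. ((u p \<bullet> i) * (v p \<bullet> j)) * G (q p) i j)"
    if "p \<in> S" for p by (rule coeff_expansion[OF assms(4)[OF that]])
  ultimately show ?thesis by (subst smooth_on_cong)
qed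

text \<open>The dual basis \<open>z\<^sub>b\<close>, \<open>G q (z\<^sub>b q) w = w \<bullet> b\<close>, is differentiable by the inverse function
  theorem, and its derivatives are polynomial in the \<open>z\<^sub>b\<close> and the derivatives of \<open>G\<close>; hence it is smooth.\<close>

definition dual_vec :: "'e \<Rightarrow> 'e \<Rightarrow> 'e" where
  "dual_vec b q = (THE z. \<forall>w. G q z w = w \<bullet> b)"

lemma dual_vec_eq: "q \<in> Q \<Longrightarrow> G q (dual_vec b q) w = w \<bullet> b"
  using theI'[OF lorentz_form_representation[OF form, of q "\<lambda>w. w \<bullet> b"]]
  unfolding dual_vec_def by (simp add: bounded_linear.linear bounded_linear_inner_left)

lemma representation_dual_vec:
  assumes q: "q \<in> Q" and "linear l" "\<And>w. G q z w = l w"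
  shows "z = (\<Sum>b\<in>Basis. l b *\<^sub>R dual_vec b q)"
proof (rule eqI_form[OF q])
  fix w
  have lin: "linear (\<lambda>u. G q u w)" using bilin[OF q] by (simp add: bilinear_def)
  have "G q (\<Sum>b\<in>Basis. l b *\<^sub>R dual_vec b q) w = (\<Sum>b\<in>Basis. l b * (w \<bullet> b))"
    by (simp add: linear_sum[OF lin] simps[OF q] dual_vec_eq[OF q])
  also have "\<dots> = l w" using linear_basis_expansion[OF assms(2), of w] by (simp add: mult.commute)
  finally show "G q z w = G q (\<Sum>b\<in>Basis. l b *\<^sub>R dual_vec b q) w" using assms(3) by simp
qed

lemma dual_vec_differentiable:
  assumes q0: "q0 \<in> Q"
  shows "dual_vec b differentiable (at q0)"
proof -
  \<comment> \<open>\<open>f\<close> lowers the index of a vector over a moving base point and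
    \<open>g\<close> raises it. The form of the inverse function theorem used here asks for
    continuity of \<open>f\<close> and a right inverse of its derivative at a single point, and
    returns differentiability of \<open>g\<close> at the image point.\<close>
  define f where "f = (\<lambda>(q, v). (q, \<Sum>i\<in>Basis. G q v i *\<^sub>R i))"
  define g where "g = (\<lambda>(q, y). (q, \<Sum>i\<in>Basis. (y \<bullet> i) *\<^sub>R dual_vec i q))"
  let ?v = "dual_vec b q0"
  let ?D = "\<lambda>h. \<Sum>i\<in>Basis. metric_deriv G q0 h ?v i *\<^sub>R i"
  let ?f' = "\<lambda>(h, k). (h, \<Sum>i\<in>Basis. (metric_deriv G q0 h ?v i + G q0 k i) *\<^sub>R i)"
  let ?g' = "\<lambda>(h, y). (h, \<Sum>i\<in>Basis. ((y - ?D h) \<bullet> i) *\<^sub>R dual_vec i q0)"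
  have coord: "(\<Sum>i\<in>Basis. c i *\<^sub>R i) \<bullet> j = c j" if "j \<in> Basis" for c and j :: 'e
    using that by (rule inner_sum_left_Basis)
  have gf: "g (f x) = x" if "x \<in> Q \<times> UNIV" for x
  proof -
    obtain q v where x: "x = (q, v)" "q \<in> Q" using \<open>x \<in> Q \<times> UNIV\<close> by auto
    have "v = (\<Sum>i\<in>Basis. G q v i *\<^sub>R dual_vec i q)"
      by (rule representation_dual_vec[OF x(2)]) (use bilin[OF x(2)] in \<open>simp_all add: bilinear_def\<close>)
    then show ?thesis by (simp add: f_def g_def x coord)
  qed
  have G1: "smooth_on (Q \<times> UNIV) (\<lambda>x. G (fst x) (snd x) i)" for i
    by (rule smooth_on_coeff)
       (auto intro!: open_Times open_domain smooth_on_const smooth_on_bounded_linear[OF _ smooth_on_id]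
          bounded_linear_fst bounded_linear_snd)
  have cont: "continuous_on (Q \<times> UNIV) f"
    unfolding f_def case_prod_beta
    by (intro continuous_intros smooth_on_imp_continuous_on[OF G1])
  have D1: "((\<lambda>x. G (fst x) (snd x) i) has_derivative (\<lambda>h. metric_deriv G q0 (fst h) ?v i + G q0 (snd h) i))
      (at (q0, ?v))" for i
    using has_derivative_coeff[OF has_derivative_fst[OF has_derivative_ident]
        has_derivative_snd[OF has_derivative_ident] has_derivative_const, of "(q0, ?v)" i] q0
    by (simp add: simps[OF q0])
  have df: "(f has_derivative ?f') (at (q0, ?v))"
    unfolding f_def case_prod_beta
    by (intro has_derivative_Pair has_derivative_fst has_derivative_ident has_derivative_sum
        has_derivative_scaleR_left D1)
  have "?f' (?g' x) = x" for x
  proof -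
    obtain h y where x: "x = (h, y)" by (cases x)
    have lin: "linear (\<lambda>u. G q0 u i)" for i using bilin[OF q0] by (simp add: bilinear_def)
    have "G q0 (\<Sum>j\<in>Basis. ((y - ?D h) \<bullet> j) *\<^sub>R dual_vec j q0) i = (y - ?D h) \<bullet> i" if "i \<in> Basis" for i
      using that by (simp add: linear_sum[OF lin] simps[OF q0] dual_vec_eq[OF q0] inner_Basis if_distrib sum.delta cong: if_cong)
    then have "(\<Sum>i\<in>Basis. (metric_deriv G q0 h ?v i +
        G q0 (\<Sum>j\<in>Basis. ((y - ?D h) \<bullet> j) *\<^sub>R dual_vec j q0) i) *\<^sub>R i) = (\<Sum>i\<in>Basis. (y \<bullet> i) *\<^sub>R i)"
      by (intro sum.cong refl) (simp add: inner_diff_left coord)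
    then show ?thesis by (simp add: x euclidean_representation)
  qed
  then have comp: "?f' \<circ> ?g' = id" by (intro ext) (simp del: split_paired_All add: o_def)
  have "(g has_derivative ?g') (at (f (q0, ?v)))"
    by (rule has_derivative_inverse_strong[OF open_Times[OF open_domain open_UNIV] _ cont gf df comp])
       (use q0 in auto)
  moreover have "f (q0, ?v) = (q0, b)"
    by (simp add: f_def dual_vec_eq[OF q0] inner_commute[of _ b] euclidean_representation)
  ultimately have dg: "(g has_derivative ?g') (at (q0, b))" by simp
  have "((\<lambda>q. snd (g (q, b))) has_derivative (\<lambda>h. snd (?g' (h, 0)))) (at q0)"
    by (rule has_derivative_snd, rule has_derivative_compose[of "\<lambda>q. (q, b)" "\<lambda>h. (h, 0)" q0 UNIV g ?g'])
       (use dg in \<open>auto intro!: derivative_eq_intros\<close>)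
  moreover have "snd (g (q, b)) = dual_vec b q" if "q \<in> Q" for q
  proof -
    have "dual_vec b q = (\<Sum>i\<in>Basis. (i \<bullet> b) *\<^sub>R dual_vec i q)"
      by (rule representation_dual_vec[OF that])
         (simp_all add: dual_vec_eq that bounded_linear.linear bounded_linear_inner_left)
    then show ?thesis by (simp add: g_def inner_commute)
  qed
  ultimately show ?thesis
    by (rule differentiableI[OF has_derivative_transform_within_open[OF _ open_domain q0]])
qed

lemma dual_vec_derivative:
  assumes q: "q \<in> Q"
  shows "(dual_vec b has_derivative
    (\<lambda>v. \<Sum>c\<in>Basis. (- metric_deriv G q v (dual_vec b q) c) *\<^sub>R dual_vec c q)) (at q)"
proof -
  let ?D = "frechet_derivative (dual_vec b) (at q)"
  have D: "(dual_vec b has_derivative ?D) (at q)"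
    using dual_vec_differentiable[OF q] by (simp add: frechet_derivative_works)
  have eq: "?D v = (\<Sum>c\<in>Basis. (- metric_deriv G q v (dual_vec b q) c) *\<^sub>R dual_vec c q)" for v
  proof (rule representation_dual_vec[OF q])
    show "linear (\<lambda>w. - metric_deriv G q v (dual_vec b q) w)"
      by (intro linear_compose_neg metric_deriv_linear_right q)
    fix w
    have "((\<lambda>q. G q (dual_vec b q) w) has_derivative
        (\<lambda>h. metric_deriv G q h (dual_vec b q) w + G q (?D h) w + G q (dual_vec b q) 0)) (at q)"
      by (rule has_derivative_coeff[OF has_derivative_ident D has_derivative_const q])
    \<comment> \<open>The pairing is constant in \<open>q\<close> on \<open>Q\<close>, so the
      product rule determines the derivative of \<open>dual_vec b\<close>.\<close>
    moreover have "((\<lambda>q. G q (dual_vec b q) w) has_derivative (\<lambda>h. 0)) (at q)"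
      using has_derivative_cong_open[OF open_domain q, of "\<lambda>q. G q (dual_vec b q) w" "\<lambda>q. w \<bullet> b"] dual_vec_eq by simp
    ultimately have "(\<lambda>h. metric_deriv G q h (dual_vec b q) w + G q (?D h) w + G q (dual_vec b q) 0) = (\<lambda>h. 0)"
      by (rule has_derivative_unique)
    then have "metric_deriv G q v (dual_vec b q) w + G q (?D v) w = 0"
      by (simp add: fun_eq_iff simps[OF q])
    then show "G q (?D v) w = - metric_deriv G q v (dual_vec b q) w" by simp
  qed
  show ?thesis by (rule has_derivative_eq_rhs[OF D ext]) (rule eq)
qed

lemma smooth_on_dual_vec: "smooth_on Q (dual_vec b)"
proof -
  have "C_diff_on k Q (dual_vec b)" for k b
  proof (induction k arbitrary: b)
    case 0
    then show ?case
      by (auto intro!: continuous_at_imp_continuous_on differentiable_imp_continuous_within dual_vec_differentiable)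
  next
    case (Suc k)
    have cd: "C_diff_on k Q (\<lambda>q. metric_deriv G q v i c)" for v i c
      unfolding metric_deriv_def by (rule smooth_on_C_diff[OF smooth_on_frechet_derivative[OF smooth_coeff]])
    have 1: "C_diff_on k Q (\<lambda>q. \<Sum>c\<in>Basis. (- (\<Sum>i\<in>Basis. (dual_vec b q \<bullet> i) * metric_deriv G q v i c)) *\<^sub>R dual_vec c q)" for v
      by (intro C_diff_on_sum C_diff_on_bilinear[OF open_domain bounded_bilinear_scaleR]
          C_diff_on_bilinear[OF open_domain bounded_bilinear_mult] finite_Basis open_domain Suc
          C_diff_on_bounded_linear[OF open_domain bounded_linear_minus[OF bounded_linear_ident]]
          C_diff_on_bounded_linear[OF open_domain bounded_linear_inner_left] cd)
    have eq: "(\<Sum>i\<in>Basis. (dual_vec b q \<bullet> i) * metric_deriv G q v i c) = metric_deriv G q v (dual_vec b q) c"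
      if "q \<in> Q" for q v c
      using linear_basis_expansion[OF metric_deriv_linear_left[OF that], of v "dual_vec b q" c]
      unfolding real_scaleR_def by (rule sym)
    have "C_diff_on k Q (\<lambda>q. \<Sum>c\<in>Basis. (- metric_deriv G q v (dual_vec b q) c) *\<^sub>R dual_vec c q)" for v
    proof -
      have "C_diff_on k Q (\<lambda>q. \<Sum>c\<in>Basis. (- metric_deriv G q v (dual_vec b q) c) *\<^sub>R dual_vec c q) \<longleftrightarrow>
        C_diff_on k Q (\<lambda>q. \<Sum>c\<in>Basis. (- (\<Sum>i\<in>Basis. (dual_vec b q \<bullet> i) * metric_deriv G q v i c)) *\<^sub>R dual_vec c q)"
        by (rule C_diff_on_cong[OF open_domain]) (simp only: eq)
      then show ?thesis using 1 by simp
    qed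
    then show ?case by (intro C_diff_on_SucI[OF open_domain dual_vec_derivative])
  qed
  then show ?thesis by (simp add: smooth_on_def open_domain)
qed

section \<open>Smoothness of the Christoffel symbols and the geodesic spray\<close>

lemma smooth_on_chris_coeff: "smooth_on Q (\<lambda>q. chris G q u v)"
proof -
  let ?l = "\<lambda>q w. (1/2) *\<^sub>R (metric_deriv G q u v w + metric_deriv G q v u w + (- metric_deriv G q w u v))"
  have md: "smooth_on Q (\<lambda>q. metric_deriv G q a b c)" for a b c
    unfolding metric_deriv_def by (rule smooth_on_frechet_derivative[OF smooth_coeff])
  have "smooth_on Q (\<lambda>q. \<Sum>b\<in>Basis. ?l q b *\<^sub>R dual_vec b q)"
    by (intro smooth_on_sum open_domain finite_Basis smooth_on_bilinear[OF bounded_bilinear_scaleR]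
        smooth_on_dual_vec smooth_on_bounded_linear[OF bounded_linear_scaleR_right] smooth_on_add md
        smooth_on_bounded_linear[OF bounded_linear_minus[OF bounded_linear_ident]])
  moreover have "chris G q u v = (\<Sum>b\<in>Basis. ?l q b *\<^sub>R dual_vec b q)" if q: "q \<in> Q" for q
  proof (rule representation_dual_vec[OF q])
    show "linear (?l q)"
      by (intro linear_compose_scale_right linear_compose_neg linear_compose_add
          metric_deriv_linear metric_deriv_linear_right q)
  qed (simp add: chris_eq[OF q])
  ultimately show ?thesis by (subst smooth_on_cong)
qed

text \<open>The second-order geodesic equation as a first-order vector field on pairs of position
  and velocity, that is, on the tangent bundle in coordinates.\<close>

definition spray :: "'e \<times> 'e \<Rightarrow> 'e \<times> 'e" where
  "spray z = (snd z, - chris G (fst z) (snd z) (snd z))"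

lemma smooth_on_spray: "smooth_on (Q \<times> UNIV) spray"
proof -
  let ?S = "Q \<times> (UNIV :: 'e set)"
  have op: "open ?S" by (intro open_Times open_domain open_UNIV)
  have fs: "smooth_on ?S fst" "smooth_on ?S snd"
    using smooth_on_bounded_linear[OF bounded_linear_fst smooth_on_id[OF op]]
      smooth_on_bounded_linear[OF bounded_linear_snd smooth_on_id[OF op]] by simp_all
  have "smooth_on ?S (\<lambda>z. \<Sum>i\<in>Basis. \<Sum>j\<in>Basis. ((snd z \<bullet> i) * (snd z \<bullet> j)) *\<^sub>R chris G (fst z) i j)"
    by (intro smooth_on_sum op finite_Basis smooth_on_bilinear[OF bounded_bilinear_scaleR]
        smooth_on_bilinear[OF bounded_bilinear_mult] smooth_on_bounded_linear[OF bounded_linear_inner_left] fs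
        smooth_on_compose[OF smooth_on_chris_coeff fs(1)]) auto
  then have "smooth_on ?S (\<lambda>z. chris G (fst z) (snd z) (snd z))"
    by (subst smooth_on_cong) (auto intro: bilinear_basis_expansion[OF chris_bilinear])
  then show ?thesis
    unfolding spray_def
    by (intro smooth_on_Pair fs smooth_on_bounded_linear[OF bounded_linear_minus[OF bounded_linear_ident]])
qed

lemma chris_diag: "q \<in> Q \<Longrightarrow> G q (chris G q a a) w = metric_deriv G q a a w - (1/2) * metric_deriv G q w a a"
  by (simp add: chris_eq)

end

text \<open>The transformation law of the Christoffel symbols under a local isometry, on the
  diagonal, where the geodesic equation uses it. Differentiating \<open>iso\<close> produces second
  derivatives of \<open>f\<close>; by their symmetry they all cancel except
  \<open>?H a a\<close>.\<close>

lemma chris_transform: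
  assumes "lorentz_coords Q1 G1" "lorentz_coords Q2 G2"
    and f: "smooth_on S f" and S: "S \<subseteq> Q1" "\<And>q. q \<in> S \<Longrightarrow> f q \<in> Q2"
    and iso: "\<And>q u v. q \<in> S \<Longrightarrow> G1 q u v = G2 (f q) (frechet_derivative f (at q) u) (frechet_derivative f (at q) v)"
    and q: "q \<in> S" and surj: "surj (frechet_derivative f (at q))"
  shows "frechet_derivative f (at q) (chris G1 q a a) =
    frechet_derivative (\<lambda>q. frechet_derivative f (at q) a) (at q) a +
    chris G2 (f q) (frechet_derivative f (at q) a) (frechet_derivative f (at q) a)"
proof -
  interpret one: lorentz_coords Q1 G1 by fact
  interpret two: lorentz_coords Q2 G2 by fact
  let ?F = "frechet_derivative f (at q)"
  let ?H = "\<lambda>a b. frechet_derivative (\<lambda>q. frechet_derivative f (at q) b) (at q) a"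
  have q1: "q \<in> Q1" and q2: "f q \<in> Q2" using q S by auto
  have df: "(f has_derivative ?F) (at q)" by (rule smooth_on_has_derivative[OF f q])
  have dF: "((\<lambda>q. frechet_derivative f (at q) b) has_derivative (\<lambda>a. ?H a b)) (at q)" for b
    by (rule smooth_on_has_derivative[OF smooth_on_frechet_derivative[OF f] q])
  have H_sym: "?H a b = ?H b a" for a b by (rule second_derivative_symmetric[OF f q])
  have md: "metric_deriv G1 q a b c =
      metric_deriv G2 (f q) (?F a) (?F b) (?F c) + G2 (f q) (?H a b) (?F c) + G2 (f q) (?F b) (?H a c)" for a b c
  proof -
    have "((\<lambda>q. G1 q b c) has_derivative (\<lambda>a. metric_deriv G2 (f q) (?F a) (?F b) (?F c) +
        G2 (f q) (?H a b) (?F c) + G2 (f q) (?F b) (?H a c))) (at q)"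
      by (rule has_derivative_transform_within_open[OF
            two.has_derivative_coeff[OF df dF[of b] dF[of c] q2] smooth_on_open[OF f] q iso[symmetric]])
    from has_derivative_unique[OF one.coeff_has_derivative[OF q1] this] show ?thesis
      by (simp add: fun_eq_iff)
  qed
  show ?thesis
  proof (rule two.eqI_form[OF q2])
    fix w'
    obtain w where w: "w' = ?F w" using surj by (metis surjD)
    have "G2 (f q) (?F (chris G1 q a a)) w' = G1 q (chris G1 q a a) w"
      by (simp add: w iso[OF q])
    also have "\<dots> = metric_deriv G1 q a a w - (1/2) * metric_deriv G1 q w a a"
      by (rule one.chris_diag[OF q1])
    also have "\<dots> = G2 (f q) (?H a a + chris G2 (f q) (?F a) (?F a)) w'"
      unfolding w two.simps[OF q2] two.chris_diag[OF q2] md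
      using two.form_sym[OF q2, of "?H a w" "?F a"] H_sym[of w a] by (simp add: field_simps)
    finally show "G2 (f q) (?F (chris G1 q a a)) w' = G2 (f q) (?H a a + chris G2 (f q) (?F a) (?F a)) w'" .
  qed
qed

section \<open>Derivatives of smooth curves\<close>

lemma smooth_on_has_vector_derivative:
  fixes x :: "real \<Rightarrow> 'b::real_normed_vector"
  assumes "smooth_on R x" "t \<in> R"
  shows "(x has_vector_derivative vector_derivative x (at t)) (at t)"
    "vector_derivative x (at t) = frechet_derivative x (at t) 1"
proof -
  have "x differentiable (at t)"
    using smooth_on_has_derivative[OF assms] by (rule differentiableI)
  then show "(x has_vector_derivative vector_derivative x (at t)) (at t)"
    by (simp add: vector_derivative_works)
  then show "vector_derivative x (at t) = frechet_derivative x (at t) 1"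
    using frechet_derivative_at unfolding has_vector_derivative_def by (metis scaleR_one)
qed

lemma smooth_on_vector_derivative:
  fixes x :: "real \<Rightarrow> 'b::real_normed_vector"
  assumes "smooth_on R x"
  shows "smooth_on R (\<lambda>t. vector_derivative x (at t))"
  using smooth_on_frechet_derivative[OF assms, of 1] smooth_on_cong[of R "\<lambda>t. vector_derivative x (at t)"]
    smooth_on_has_vector_derivative(2)[OF assms] by simp

text \<open>A product rule for a derivative applied to a moving vector at a moving point. For a
  chart change and the velocity of a curve it yields the acceleration in the new chart.\<close>

lemma has_vector_derivative_frechet_derivative:
  fixes f :: "'b::euclidean_space \<Rightarrow> 'c::real_normed_vector"
  assumes f: "smooth_on S f" and R: "open R" "t \<in> R" "\<And>s. s \<in> R \<Longrightarrow> x s \<in> S"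
    and x: "(x has_vector_derivative x') (at t)" and u: "(u has_vector_derivative u') (at t)"
  shows "((\<lambda>s. frechet_derivative f (at (x s)) (u s)) has_vector_derivative
    frechet_derivative (\<lambda>q. frechet_derivative f (at q) (u t)) (at (x t)) x' + frechet_derivative f (at (x t)) u') (at t)"
proof -
  let ?D = "\<lambda>q v. frechet_derivative f (at q) v"
  let ?H = "\<lambda>v. frechet_derivative (\<lambda>q. ?D q v) (at (x t)) x'"
  have lin: "linear (?D q)" if "q \<in> S" for q by (rule smooth_on_linear_derivative[OF f that])
  have xt: "x t \<in> S" using R by blast
  have D: "((\<lambda>s. ?D (x s) b) has_vector_derivative ?H b) (at t)" for b
  proof -
    have "((\<lambda>s. ?D (x s) b) has_derivative (\<lambda>h. frechet_derivative (\<lambda>q. ?D q b) (at (x t)) (h *\<^sub>R x'))) (at t)"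
      by (rule has_derivative_compose[OF x[unfolded has_vector_derivative_def]
            smooth_on_has_derivative[OF smooth_on_frechet_derivative[OF f] xt]])
    then show ?thesis
      unfolding has_vector_derivative_def
      by (simp add: linear_cmul[OF smooth_on_linear_derivative[OF smooth_on_frechet_derivative[OF f] xt]])
  qed
  \<comment> \<open>The second derivative is linear also in the direction that was differentiated
    first: differentiate the basis expansion of \<open>?D q v\<close> and use uniqueness of the
    derivative.\<close>
  have Hlin: "?H v = (\<Sum>b\<in>Basis. (v \<bullet> b) *\<^sub>R ?H b)" for v
  proof -
    have "((\<lambda>q. \<Sum>b\<in>Basis. (v \<bullet> b) *\<^sub>R ?D q b) has_derivative
        (\<lambda>h. \<Sum>b\<in>Basis. (v \<bullet> b) *\<^sub>R frechet_derivative (\<lambda>q. ?D q b) (at (x t)) h)) (at (x t))"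
      by (intro has_derivative_sum has_derivative_scaleR_right
          smooth_on_has_derivative[OF smooth_on_frechet_derivative[OF f] xt])
    then have "((\<lambda>q. ?D q v) has_derivative
        (\<lambda>h. \<Sum>b\<in>Basis. (v \<bullet> b) *\<^sub>R frechet_derivative (\<lambda>q. ?D q b) (at (x t)) h)) (at (x t))"
      by (rule has_derivative_transform_within_open[OF _ smooth_on_open[OF f] xt])
         (rule linear_basis_expansion[OF lin, symmetric])
    then have "frechet_derivative (\<lambda>q. ?D q v) (at (x t)) =
        (\<lambda>h. \<Sum>b\<in>Basis. (v \<bullet> b) *\<^sub>R frechet_derivative (\<lambda>q. ?D q b) (at (x t)) h)"
      by (rule frechet_derivative_at[symmetric])
    then show ?thesis by (rule fun_cong)
  qed
  have "((\<lambda>s. \<Sum>b\<in>Basis. (u s \<bullet> b) *\<^sub>R ?D (x s) b) has_vector_derivative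
      (\<Sum>b\<in>Basis. (u t \<bullet> b) *\<^sub>R ?H b + (u' \<bullet> b) *\<^sub>R ?D (x t) b)) (at t)"
  proof (rule has_vector_derivative_sum)
    fix b :: 'b assume "b \<in> Basis"
    have ub: "((\<lambda>s. u s \<bullet> b) has_vector_derivative u' \<bullet> b) (at t)"
      by (rule bounded_linear.has_vector_derivative[OF bounded_linear_inner_left u])
    have "((\<lambda>s. (u s \<bullet> b) *\<^sub>R ?D (x s) b) has_derivative
        (\<lambda>h. (u t \<bullet> b) *\<^sub>R (h *\<^sub>R ?H b) + (h *\<^sub>R (u' \<bullet> b)) *\<^sub>R ?D (x t) b)) (at t)"
      by (rule has_derivative_scaleR[OF ub[unfolded has_vector_derivative_def] D[unfolded has_vector_derivative_def]])
    then show "((\<lambda>s. (u s \<bullet> b) *\<^sub>R ?D (x s) b) has_vector_derivative (u t \<bullet> b) *\<^sub>R ?H b + (u' \<bullet> b) *\<^sub>R ?D (x t) b) (at t)"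
      unfolding has_vector_derivative_def by (simp add: scaleR_add_right mult.commute)
  qed
  moreover have "(\<Sum>b\<in>Basis. (u t \<bullet> b) *\<^sub>R ?H b + (u' \<bullet> b) *\<^sub>R ?D (x t) b) = ?H (u t) + ?D (x t) u'"
    unfolding sum.distrib Hlin[of "u t", symmetric] linear_basis_expansion[OF lin[OF xt], of u', symmetric] ..
  ultimately have "((\<lambda>s. \<Sum>b\<in>Basis. (u s \<bullet> b) *\<^sub>R ?D (x s) b) has_vector_derivative ?H (u t) + ?D (x t) u') (at t)"
    by simp
  then show ?thesis
    by (rule has_vector_derivative_transform_within_open[OF _ R(1,2)])
       (rule linear_basis_expansion[OF lin[OF R(3)], symmetric])
qed

section \<open>Charts and tangent vectors\<close>

definition transition :: "('a, 'e) chart \<Rightarrow> ('a, 'e) chart \<Rightarrow> 'e \<Rightarrow> 'e" where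
  "transition c d = snd d \<circ> chart_inv c"

abbreviation dtransition ::
  "('a, 'e::euclidean_space) chart \<Rightarrow> ('a, 'e) chart \<Rightarrow> 'a \<Rightarrow> 'e \<Rightarrow> 'e" where
  "dtransition c d p \<equiv> frechet_derivative (transition c d) (at (snd c p))"

lemma is_chart_inverse:
  assumes "is_chart c"
  shows "p \<in> fst c \<Longrightarrow> chart_inv c (snd c p) = p"
    and "q \<in> snd c ` fst c \<Longrightarrow> snd c (chart_inv c q) = q"
    and "q \<in> snd c ` fst c \<Longrightarrow> chart_inv c q \<in> fst c"
  using assms unfolding is_chart_def homeomorphism_def by (auto simp: f_inv_into_f inv_into_into)

lemma is_chart_image:
  assumes "is_chart c" "U \<subseteq> fst c"
  shows "snd c ` U = (snd c ` fst c) \<inter> chart_inv c -` U"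
  using is_chart_inverse[OF assms(1)] assms(2) by (auto simp: image_iff)

lemma is_chart_continuous:
  assumes "is_chart c"
  shows "continuous_on (fst c) (snd c)" "continuous_on (snd c ` fst c) (chart_inv c)"
    "open (fst c)" "open (snd c ` fst c)"
  using assms unfolding is_chart_def homeomorphism_def by blast+

lemma is_chart_open_image:
  assumes "is_chart c" "open U"
  shows "open (snd c ` (fst c \<inter> U))"
proof -
  have "open ((snd c ` fst c) \<inter> chart_inv c -` (fst c \<inter> U))"
    by (rule continuous_open_preimage[OF is_chart_continuous(2)[OF assms(1)] is_chart_continuous(4)[OF assms(1)]])
       (use is_chart_continuous(3)[OF assms(1)] assms(2) in blast)
  then show ?thesis using is_chart_image[OF assms(1), of "fst c \<inter> U"] by simp
qed

locale manifold =
  fixes A :: "('a::t2_space, 'e::euclidean_space) chart set"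
  assumes atlas: "smooth_structure A"
begin

lemma chart: "c \<in> A \<Longrightarrow> is_chart c"
  using atlas unfolding smooth_structure_def by blast

lemmas chart_inverse[simp] = is_chart_inverse[OF chart]
  and chart_continuous = is_chart_continuous[OF chart]
  and chart_open_image = is_chart_open_image[OF chart]

lemma chart_at: obtains c where "c \<in> A" "p \<in> fst c"
proof -
  have "p \<in> (\<Union>c\<in>A. fst c)" using atlas unfolding smooth_structure_def by simp
  then show ?thesis using that by blast
qed

lemma chart_inj: "c \<in> A \<Longrightarrow> p \<in> fst c \<Longrightarrow> p' \<in> fst c \<Longrightarrow> snd c p = snd c p' \<Longrightarrow> p = p'"
  using chart_inverse(1) by metis

lemma transition_smooth:
  "c \<in> A \<Longrightarrow> d \<in> A \<Longrightarrow> smooth_on (snd c ` (fst c \<inter> fst d)) (transition c d)"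
  using atlas unfolding smooth_structure_def smoothly_compatible_def transition_def by blast

lemma transition_eq [simp]: "c \<in> A \<Longrightarrow> p \<in> fst c \<Longrightarrow> transition c d (snd c p) = snd d p"
  by (simp add: transition_def)

lemma transition_has_derivative:
  "c \<in> A \<Longrightarrow> d \<in> A \<Longrightarrow> p \<in> fst c \<Longrightarrow> p \<in> fst d \<Longrightarrow>
    (transition c d has_derivative dtransition c d p) (at (snd c p))"
  by (rule smooth_on_has_derivative[OF transition_smooth]) auto

lemma dtransition_linear:
  "c \<in> A \<Longrightarrow> d \<in> A \<Longrightarrow> p \<in> fst c \<Longrightarrow> p \<in> fst d \<Longrightarrow> linear (dtransition c d p)"
  by (rule has_derivative_linear[OF transition_has_derivative])

lemma dtransition_compose:
  assumes "c \<in> A" "d \<in> A" "e \<in> A" "p \<in> fst c" "p \<in> fst d" "p \<in> fst e"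
  shows "dtransition c e p u = dtransition d e p (dtransition c d p u)"
proof -
  let ?S = "snd c ` (fst c \<inter> (fst d \<inter> fst e))"
  have "((\<lambda>q. transition d e (transition c d q)) has_derivative (\<lambda>u. dtransition d e p (dtransition c d p u))) (at (snd c p))"
    by (rule has_derivative_compose[OF transition_has_derivative])
       (use assms transition_has_derivative[of d e p] in auto)
  moreover have "transition d e (transition c d q) = transition c e q" if "q \<in> ?S" for q
    using that assms by auto
  moreover have "open ?S" by (intro chart_open_image open_Int chart_continuous(3) assms)
  moreover have "snd c p \<in> ?S" using assms by blast
  ultimately have "(transition c e has_derivative (\<lambda>u. dtransition d e p (dtransition c d p u))) (at (snd c p))"
    using has_derivative_transform_within_open[of _ _ _ UNIV ?S] by blast
  then show ?thesis using frechet_derivative_at by metis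
qed

lemma dtransition_same [simp]:
  assumes "c \<in> A" "p \<in> fst c"
  shows "dtransition c c p u = u"
proof -
  have "(transition c c has_derivative (\<lambda>u. u)) (at (snd c p))"
    by (rule has_derivative_transform_within_open[OF has_derivative_ident chart_continuous(4)[OF assms(1)]])
       (use assms in \<open>auto simp: transition_def\<close>)
  then show ?thesis using frechet_derivative_at by metis
qed

lemma dtransition_inverse:
  "c \<in> A \<Longrightarrow> d \<in> A \<Longrightarrow> p \<in> fst c \<Longrightarrow> p \<in> fst d \<Longrightarrow> dtransition d c p (dtransition c d p u) = u"
  using dtransition_compose[of c d c p u] by simp

lemma dtransition_surj:
  "c \<in> A \<Longrightarrow> d \<in> A \<Longrightarrow> p \<in> fst c \<Longrightarrow> p \<in> fst d \<Longrightarrow> surj (dtransition c d p)"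
  using dtransition_inverse[of d c p] by (metis surjI)

section \<open>Tangent vectors in coordinates\<close>

lemma coord_vec_eq: "coord_vec A c p u = (\<lambda>d. if d \<in> A \<and> p \<in> fst d then dtransition c d p u else 0)"
  unfolding coord_vec_def transition_def ..

lemma coord_vec_tangent:
  assumes "c \<in> A" "p \<in> fst c"
  shows "coord_vec A c p u \<in> tangent_space A p"
  unfolding tangent_space_def coord_vec_eq
proof (intro CollectI conjI allI ballI impI)
  fix d e assume "d \<in> A" "e \<in> A" "p \<in> fst d \<inter> fst e"
  then show "(if e \<in> A \<and> p \<in> fst e then dtransition c e p u else 0) =
      frechet_derivative (snd e \<circ> chart_inv d) (at (snd d p)) (if d \<in> A \<and> p \<in> fst d then dtransition c d p u else 0)"
    using dtransition_compose[OF assms(1) \<open>d \<in> A\<close> \<open>e \<in> A\<close> assms(2)] by (simp add: transition_def[of d e])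
qed auto

lemma coord_vec_self [simp]: "c \<in> A \<Longrightarrow> p \<in> fst c \<Longrightarrow> coord_vec A c p u c = u"
  by (simp add: coord_vec_eq)

lemma tangent_transition:
  "v \<in> tangent_space A p \<Longrightarrow> c \<in> A \<Longrightarrow> d \<in> A \<Longrightarrow> p \<in> fst c \<Longrightarrow> p \<in> fst d \<Longrightarrow> v d = dtransition c d p (v c)"
  unfolding tangent_space_def transition_def by blast

lemma tangent_eq_coord_vec:
  assumes "v \<in> tangent_space A p" "c \<in> A" "p \<in> fst c"
  shows "v = coord_vec A c p (v c)"
proof
  fix d show "v d = coord_vec A c p (v c) d"
  proof (cases "d \<in> A \<and> p \<in> fst d")
    case True
    then show ?thesis using tangent_transition[OF assms(1,2) _ assms(3), of d] by (simp add: coord_vec_eq)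
  next
    case False
    then have "v d = 0" using assms(1) unfolding tangent_space_def by blast
    then show ?thesis using False by (simp only: coord_vec_eq if_False)
  qed
qed

lemma coord_vec_transition:
  assumes "c \<in> A" "d \<in> A" "p \<in> fst c" "p \<in> fst d"
  shows "coord_vec A d p (dtransition c d p u) = coord_vec A c p u"
  using tangent_eq_coord_vec[OF coord_vec_tangent[OF assms(1,3)] assms(2,4), of u] assms
  by (simp add: coord_vec_eq)

lemma tangent_nonzero:
  assumes "v \<in> tangent_space A p" "c \<in> A" "p \<in> fst c"
  shows "v = (\<lambda>_. 0) \<longleftrightarrow> v c = 0"
proof
  assume "v c = 0"
  have "coord_vec A c p 0 = (\<lambda>_. 0)"
  proof
    fix d show "coord_vec A c p 0 d = 0"
      unfolding coord_vec_eq using linear_0[OF dtransition_linear[OF assms(2) _ assms(3)]] by simp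
  qed
  then show "v = (\<lambda>_. 0)" using tangent_eq_coord_vec[OF assms] \<open>v c = 0\<close> by simp
qed simp

subsection \<open>Curves\<close>

lemma curve_in_chart_eventually:
  assumes "continuous (at t within S) \<gamma>" "\<gamma> t \<in> U" "open U"
  shows "\<forall>\<^sub>F s in at t within S. \<gamma> s \<in> U"
  using assms topological_tendstoD unfolding continuous_within by blast

lemma has_vector_derivative_transition:
  assumes c: "c \<in> A" "d \<in> A" "\<gamma> t \<in> fst c" "\<gamma> t \<in> fst d"
    and cont: "continuous (at t within S) \<gamma>" and "t \<in> S"
    and v: "((snd c \<circ> \<gamma>) has_vector_derivative v) (at t within S)"
  shows "((snd d \<circ> \<gamma>) has_vector_derivative dtransition c d (\<gamma> t) v) (at t within S)"
proof -
  have "((\<lambda>s. transition c d ((snd c \<circ> \<gamma>) s)) has_derivative (\<lambda>h. dtransition c d (\<gamma> t) (h *\<^sub>R v))) (at t within S)"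
    by (rule has_derivative_compose[OF v[unfolded has_vector_derivative_def]])
       (use transition_has_derivative[of c d "\<gamma> t"] c in simp)
  then have "((snd d \<circ> \<gamma>) has_derivative (\<lambda>h. dtransition c d (\<gamma> t) (h *\<^sub>R v))) (at t within S)"
  proof (rule has_derivative_transform_eventually)
    show "\<forall>\<^sub>F s in at t within S. transition c d ((snd c \<circ> \<gamma>) s) = (snd d \<circ> \<gamma>) s"
      using curve_in_chart_eventually[OF cont c(3) chart_continuous(3)[OF c(1)]]
      by eventually_elim (simp add: c(1))
  qed (use c \<open>t \<in> S\<close> in simp_all)
  then show ?thesis
    unfolding has_vector_derivative_def by (simp add: linear_cmul[OF dtransition_linear[OF c]])
qed

text \<open>\<open>smooth_curve_on\<close> speaks of all charts, but since chart changes are smooth,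
  one chart near each parameter is enough.\<close>

lemma smooth_curve_onI:
  assumes "open J" "continuous_on J \<gamma>"
    and loc: "\<And>t. t \<in> J \<Longrightarrow> \<exists>c\<in>A. \<exists>R. t \<in> R \<and> R \<subseteq> J \<and> \<gamma> ` R \<subseteq> fst c \<and> smooth_on R (snd c \<circ> \<gamma>)"
  shows "smooth_curve_on A J \<gamma>"
  unfolding smooth_curve_on_def
proof (intro conjI assms ballI)
  fix d assume d: "d \<in> A"
  show "smooth_on (J \<inter> \<gamma> -` fst d) (snd d \<circ> \<gamma>)"
  proof (rule smooth_on_local)
    fix t assume t: "t \<in> J \<inter> \<gamma> -` fst d"
    then obtain c R where c: "c \<in> A" "t \<in> R" "R \<subseteq> J" "\<gamma> ` R \<subseteq> fst c" "smooth_on R (snd c \<circ> \<gamma>)"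
      using loc[of t] by auto
    let ?R = "R \<inter> (J \<inter> \<gamma> -` fst d)"
    have "open (J \<inter> \<gamma> -` fst d)"
      by (rule continuous_open_preimage[OF assms(2,1) chart_continuous(3)[OF d]])
    then have op: "open ?R" using smooth_on_open[OF c(5)] by blast
    have "smooth_on ?R (\<lambda>s. transition c d ((snd c \<circ> \<gamma>) s))"
      by (rule smooth_on_compose[OF transition_smooth[OF c(1) d] smooth_on_subset[OF c(5) op]])
         (use c(4) in auto)
    moreover have "transition c d ((snd c \<circ> \<gamma>) s) = (snd d \<circ> \<gamma>) s" if "s \<in> ?R" for s
      using c(1,4) that by auto
    ultimately have "smooth_on ?R (snd d \<circ> \<gamma>)" using smooth_on_cong[of ?R] by metis
    then show "\<exists>R. t \<in> R \<and> R \<subseteq> J \<inter> \<gamma> -` fst d \<and> smooth_on R (snd d \<circ> \<gamma>)"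
      using t c(2) by (intro exI[of _ ?R]) auto
  qed
qed

lemma smooth_curve_chart:
  assumes "smooth_curve_on A J \<gamma>" "c \<in> A"
  shows "smooth_on (J \<inter> \<gamma> -` fst c) (snd c \<circ> \<gamma>)" "open J" "continuous_on J \<gamma>" "open (J \<inter> \<gamma> -` fst c)"
  using assms smooth_on_open unfolding smooth_curve_on_def by blast+

lemma smooth_curve_on_subset:
  assumes "smooth_curve_on A J \<sigma>" "open K" "K \<subseteq> J"
  shows "smooth_curve_on A K \<sigma>"
proof (rule smooth_curve_onI[OF assms(2)])
  show "continuous_on K \<sigma>" using assms continuous_on_subset unfolding smooth_curve_on_def by blast
  fix t assume t: "t \<in> K"
  obtain c where c: "c \<in> A" "\<sigma> t \<in> fst c" by (rule chart_at)
  have op: "open (K \<inter> (J \<inter> \<sigma> -` fst c))" using assms(2) smooth_curve_chart(4)[OF assms(1) c(1)] by blast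
  show "\<exists>c\<in>A. \<exists>R. t \<in> R \<and> R \<subseteq> K \<and> \<sigma> ` R \<subseteq> fst c \<and> smooth_on R (snd c \<circ> \<sigma>)"
    by (intro bexI[OF _ c(1)] exI[of _ "K \<inter> (J \<inter> \<sigma> -` fst c)"] conjI
        smooth_on_subset[OF smooth_curve_chart(1)[OF assms(1) c(1)] op])
       (use t assms(3) c(2) in auto)
qed

lemma smooth_curve_has_velocity:
  assumes "smooth_curve_on A J \<gamma>" "c \<in> A" "t \<in> J" "\<gamma> t \<in> fst c"
  shows "((snd c \<circ> \<gamma>) has_vector_derivative vector_derivative (snd c \<circ> \<gamma>) (at t)) (at t)"
  by (rule smooth_on_has_vector_derivative(1)[OF smooth_curve_chart(1)[OF assms(1,2)]]) (use assms in auto)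

lemma smooth_curve_continuous: "smooth_curve_on A J \<gamma> \<Longrightarrow> t \<in> J \<Longrightarrow> continuous (at t) \<gamma>"
  unfolding smooth_curve_on_def by (auto simp: continuous_on_eq_continuous_at)

lemma smooth_curve_velocity_transition:
  assumes "smooth_curve_on A J \<gamma>" "c \<in> A" "d \<in> A" "t \<in> J" "\<gamma> t \<in> fst c" "\<gamma> t \<in> fst d"
  shows "vector_derivative (snd d \<circ> \<gamma>) (at t) = dtransition c d (\<gamma> t) (vector_derivative (snd c \<circ> \<gamma>) (at t))"
  by (rule vector_derivative_at, rule has_vector_derivative_transition[OF assms(2,3,5,6) smooth_curve_continuous[OF assms(1,4)] UNIV_I])
     (rule smooth_curve_has_velocity[OF assms(1,2,4,5)])

lemma smooth_curve_velocity:
  assumes "smooth_curve_on A J \<gamma>" "t \<in> J"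
  shows "velocity A \<gamma> UNIV t \<in> tangent_space A (\<gamma> t)"
  unfolding tangent_space_def velocity_def
proof (intro CollectI conjI allI ballI impI)
  fix c d assume "c \<in> A" "d \<in> A" "\<gamma> t \<in> fst c \<inter> fst d"
  then show "(if d \<in> A \<and> \<gamma> t \<in> fst d then vector_derivative (snd d \<circ> \<gamma>) (at t) else 0) =
      frechet_derivative (snd d \<circ> chart_inv c) (at (snd c (\<gamma> t)))
        (if c \<in> A \<and> \<gamma> t \<in> fst c then vector_derivative (snd c \<circ> \<gamma>) (at t) else 0)"
    using smooth_curve_velocity_transition[OF assms(1) \<open>c \<in> A\<close> \<open>d \<in> A\<close> assms(2)]
    by (simp add: transition_def)
qed auto

lemma velocity_open: "open J \<Longrightarrow> t \<in> J \<Longrightarrow> velocity A \<gamma> J t = velocity A \<gamma> UNIV t"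
  unfolding velocity_def using at_within_open[of t J] by (simp cong: if_cong)

section \<open>Metric coefficients in charts\<close>

lemma metric_coeff_eq:
  "c \<in> A \<Longrightarrow> p \<in> fst c \<Longrightarrow> metric_coeff A g c (snd c p) u v = g p (coord_vec A c p u) (coord_vec A c p v)"
  by (simp add: metric_coeff_def)

lemma metric_eq_coeff:
  assumes "c \<in> A" "p \<in> fst c" "v \<in> tangent_space A p" "w \<in> tangent_space A p"
  shows "g p v w = metric_coeff A g c (snd c p) (v c) (w c)"
  using tangent_eq_coord_vec[OF assms(3,1,2)] tangent_eq_coord_vec[OF assms(4,1,2)]
  by (simp add: metric_coeff_eq[OF assms(1,2)])

lemma metric_coeff_transition:
  assumes "c \<in> A" "d \<in> A" "p \<in> fst c" "p \<in> fst d"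
  shows "metric_coeff A g c (snd c p) u v =
    metric_coeff A g d (snd d p) (dtransition c d p u) (dtransition c d p v)"
  using assms by (simp add: metric_coeff_eq coord_vec_transition)

end

section \<open>Geodesics in charts\<close>

locale lorentz_manifold = manifold A for A :: "('a::t2_space, 'e::euclidean_space) chart set" +
  fixes g :: "('a, 'e) metric"
  assumes metric: "lorentz_metric A g"
begin

lemma coords: "c \<in> A \<Longrightarrow> lorentz_coords (snd c ` fst c) (metric_coeff A g c)"
  using metric chart_continuous(4)[of c] unfolding lorentz_metric_def by unfold_locales blast+

lemma christoffel_eq_chris: "christoffel A g c = chris (metric_coeff A g c)"
  unfolding christoffel_def chris_def metric_deriv_def Let_def by (intro ext refl)

abbreviation chart_spray :: "('a, 'e) chart \<Rightarrow> 'e \<times> 'e \<Rightarrow> 'e \<times> 'e" where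
  "chart_spray c \<equiv> lorentz_coords.spray (metric_coeff A g c)"

lemma chart_spray_eq: "c \<in> A \<Longrightarrow> chart_spray c z = (snd z, - chris (metric_coeff A g c) (fst z) (snd z) (snd z))"
  using lorentz_coords.spray_def[OF coords] .

text \<open>The curve together with its velocity, in the coordinates of the tangent bundle; for a
  geodesic it solves the spray equation.\<close>

definition state :: "('a, 'e) chart \<Rightarrow> (real \<Rightarrow> 'a) \<Rightarrow> real \<Rightarrow> 'e \<times> 'e" where
  "state c \<gamma> t = (snd c (\<gamma> t), vector_derivative (snd c \<circ> \<gamma>) (at t))"

lemma geodesic_smooth: "geodesic A g J \<gamma> \<Longrightarrow> smooth_curve_on A J \<gamma>"
  and geodesic_interval: "geodesic A g J \<gamma> \<Longrightarrow> is_interval J"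
  and geodesic_nonempty: "geodesic A g J \<gamma> \<Longrightarrow> J \<noteq> {}"
  unfolding geodesic_def by blast+

lemma geodesic_open: "geodesic A g J \<gamma> \<Longrightarrow> open J"
  using geodesic_smooth unfolding smooth_curve_on_def by blast

lemma geodesic_continuous: "geodesic A g J \<gamma> \<Longrightarrow> continuous_on J \<gamma>"
  using geodesic_smooth unfolding smooth_curve_on_def by blast

lemma geodesic_state_derivative:
  assumes geo: "geodesic A g J \<gamma>" and c: "c \<in> A" "t \<in> J" "\<gamma> t \<in> fst c"
  shows "(state c \<gamma> has_vector_derivative chart_spray c (state c \<gamma> t)) (at t)"
proof -
  let ?x = "snd c \<circ> \<gamma>"
  let ?R = "J \<inter> \<gamma> -` fst c"
  have x: "smooth_on ?R ?x" using smooth_curve_chart(1)[OF geodesic_smooth[OF geo] c(1)] .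
  have t: "t \<in> ?R" using c by simp
  have "vector_derivative (\<lambda>s. vector_derivative ?x (at s)) (at t) +
      christoffel A g c (?x t) (vector_derivative ?x (at t)) (vector_derivative ?x (at t)) = 0"
    using geo c unfolding geodesic_def Let_def by blast
  then have acc: "vector_derivative (\<lambda>s. vector_derivative ?x (at s)) (at t) =
      - chris (metric_coeff A g c) (?x t) (vector_derivative ?x (at t)) (vector_derivative ?x (at t))"
    by (simp add: christoffel_eq_chris eq_neg_iff_add_eq_0)
  have "((\<lambda>t. (?x t, vector_derivative ?x (at t))) has_vector_derivative
      (vector_derivative ?x (at t), vector_derivative (\<lambda>s. vector_derivative ?x (at s)) (at t))) (at t)"
    by (intro has_vector_derivative_Pair smooth_on_has_vector_derivative(1)[OF x t]
        smooth_on_has_vector_derivative(1)[OF smooth_on_vector_derivative[OF x] t])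
  then show ?thesis
    unfolding acc state_def chart_spray_eq[OF c(1)] by simp
qed

text \<open>The first component of the spray is the velocity, so a solution is automatically the
  state of its own position curve.\<close>

lemma chart_solution_velocity:
  assumes c: "c \<in> A" and R: "open R" "s \<in> R"
    and z: "\<And>s. s \<in> R \<Longrightarrow> fst (z s) = snd c (\<gamma> s)"
      "\<And>s. s \<in> R \<Longrightarrow> (z has_vector_derivative chart_spray c (z s)) (at s)"
  shows "((snd c \<circ> \<gamma>) has_vector_derivative snd (z s)) (at s)" "state c \<gamma> s = z s"
proof -
  have "((\<lambda>s. fst (z s)) has_vector_derivative snd (z s)) (at s)"
    using bounded_linear.has_vector_derivative[OF bounded_linear_fst z(2)[OF R(2)]]
    by (simp add: chart_spray_eq[OF c])
  then show *: "((snd c \<circ> \<gamma>) has_vector_derivative snd (z s)) (at s)"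
    by (rule has_vector_derivative_transform_within_open[OF _ R]) (simp add: z(1))
  show "state c \<gamma> s = z s"
    unfolding state_def using vector_derivative_at[OF *] z(1)[OF R(2)] by (simp add: prod_eq_iff)
qed

lemma chart_solution_smooth:
  assumes c: "c \<in> A" and R: "open R"
    and z: "\<And>s. s \<in> R \<Longrightarrow> fst (z s) \<in> snd c ` fst c"
      "\<And>s. s \<in> R \<Longrightarrow> (z has_vector_derivative chart_spray c (z s)) (at s)"
  shows "smooth_on R z"
  by (rule ode_solution_smooth[OF lorentz_coords.smooth_on_spray[OF coords[OF c]] R _ z(2)])
     (use z(1) in \<open>auto simp: mem_Times_iff\<close>)

text \<open>\<open>geodesic\<close> demands smoothness and the equation in every chart around a
  point. A spray solution in one chart suffices: it is smooth because the spray is, and the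
  transformation law carries the equation to the other charts.\<close>

lemma geodesicI:
  assumes J: "is_interval J" "J \<noteq> {}"
    and loc: "\<And>t. t \<in> J \<Longrightarrow> \<exists>c\<in>A. \<exists>R z. open R \<and> t \<in> R \<and> R \<subseteq> J \<and>
      (\<forall>s\<in>R. \<gamma> s \<in> fst c \<and> fst (z s) = snd c (\<gamma> s) \<and> (z has_vector_derivative chart_spray c (z s)) (at s))"
  shows "geodesic A g J \<gamma>"
proof -
  have sm: "smooth_on R (snd c \<circ> \<gamma>)"
    if "c \<in> A" "open R" "\<And>s. s \<in> R \<Longrightarrow> \<gamma> s \<in> fst c" "\<And>s. s \<in> R \<Longrightarrow> fst (z s) = snd c (\<gamma> s)"
      "\<And>s. s \<in> R \<Longrightarrow> (z has_vector_derivative chart_spray c (z s)) (at s)" for c R z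
  proof -
    have "smooth_on R (\<lambda>s. fst (z s))"
      by (rule smooth_on_bounded_linear[OF bounded_linear_fst chart_solution_smooth[OF that(1,2) _ that(5)]])
         (use that in auto)
    moreover have "(snd c \<circ> \<gamma>) s = fst (z s)" if "s \<in> R" for s using that \<open>\<And>s. s \<in> R \<Longrightarrow> fst (z s) = snd c (\<gamma> s)\<close> by simp
    ultimately show ?thesis by (subst smooth_on_cong)
  qed
  let ?P = "\<lambda>t c R z. open R \<and> t \<in> R \<and> R \<subseteq> J \<and>
      (\<forall>s\<in>R. \<gamma> s \<in> fst c \<and> fst (z s) = snd c (\<gamma> s) \<and> (z has_vector_derivative chart_spray c (z s)) (at s))"
  have loc': thesis if t: "t \<in> J" and *: "\<And>c R z. c \<in> A \<Longrightarrow> open R \<Longrightarrow> t \<in> R \<Longrightarrow> R \<subseteq> J \<Longrightarrow>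
      (\<And>s. s \<in> R \<Longrightarrow> \<gamma> s \<in> fst c) \<Longrightarrow> (\<And>s. s \<in> R \<Longrightarrow> fst (z s) = snd c (\<gamma> s)) \<Longrightarrow>
      (\<And>s. s \<in> R \<Longrightarrow> (z has_vector_derivative chart_spray c (z s)) (at s)) \<Longrightarrow> thesis" for t thesis
  proof -
    obtain c where c: "c \<in> A" and "\<exists>R z. ?P t c R z" using loc[OF t] by (rule bexE)
    then obtain R z where "?P t c R z" by (elim exE)
    then show thesis by (intro *[of c R z] c) simp_all
  qed
  have op: "open J"
  proof (subst open_subopen, intro ballI)
    fix t assume t: "t \<in> J"
    show "\<exists>T. open T \<and> t \<in> T \<and> T \<subseteq> J" by (rule loc'[OF t]) blast
  qed
  have "continuous (at t) \<gamma>" if t: "t \<in> J" for t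
  proof -
    obtain c R z where c: "c \<in> A" and R: "open R" "t \<in> R" "R \<subseteq> J"
      "\<And>s. s \<in> R \<Longrightarrow> \<gamma> s \<in> fst c" "\<And>s. s \<in> R \<Longrightarrow> fst (z s) = snd c (\<gamma> s)"
      "\<And>s. s \<in> R \<Longrightarrow> (z has_vector_derivative chart_spray c (z s)) (at s)"
      by (rule loc'[OF t]) (rule that)
    have "continuous_on R (snd c \<circ> \<gamma>)" by (rule smooth_on_imp_continuous_on[OF sm[OF c R(1,4,5,6)]])
    then have "continuous_on R (\<lambda>s. chart_inv c ((snd c \<circ> \<gamma>) s))"
      by (rule continuous_on_compose2[OF chart_continuous(2)[OF c]]) (use R(4) in auto)
    moreover have "chart_inv c ((snd c \<circ> \<gamma>) s) = \<gamma> s" if "s \<in> R" for s using R(4)[OF that] c by simp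
    ultimately have "continuous_on R \<gamma>" by (simp cong: continuous_on_cong)
    then show ?thesis using R(1,2) by (simp add: continuous_on_eq_continuous_at)
  qed
  then have cont: "continuous_on J \<gamma>" by (simp add: continuous_at_imp_continuous_on)
  have smooth: "smooth_curve_on A J \<gamma>"
  proof (rule smooth_curve_onI[OF op cont])
    fix t assume t: "t \<in> J"
    obtain c R z where c: "c \<in> A" and R: "open R" "t \<in> R" "R \<subseteq> J"
      "\<And>s. s \<in> R \<Longrightarrow> \<gamma> s \<in> fst c" "\<And>s. s \<in> R \<Longrightarrow> fst (z s) = snd c (\<gamma> s)"
      "\<And>s. s \<in> R \<Longrightarrow> (z has_vector_derivative chart_spray c (z s)) (at s)"
      by (rule loc'[OF t]) (rule that)
    show "\<exists>c\<in>A. \<exists>R. t \<in> R \<and> R \<subseteq> J \<and> \<gamma> ` R \<subseteq> fst c \<and> smooth_on R (snd c \<circ> \<gamma>)"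
      by (intro bexI[OF _ c] exI[of _ R] conjI R sm[OF c R(1,4,5,6)]) (use R(4) in auto)
  qed
  show ?thesis
    unfolding geodesic_def Let_def
  proof (intro conjI J smooth ballI impI)
    fix t d assume t: "t \<in> J" and d: "d \<in> A" and td: "\<gamma> t \<in> fst d"
    obtain c R z where c: "c \<in> A" and R: "open R" "t \<in> R" "R \<subseteq> J"
      "\<And>s. s \<in> R \<Longrightarrow> \<gamma> s \<in> fst c" "\<And>s. s \<in> R \<Longrightarrow> fst (z s) = snd c (\<gamma> s)"
      "\<And>s. s \<in> R \<Longrightarrow> (z has_vector_derivative chart_spray c (z s)) (at s)"
      by (rule loc'[OF t]) (rule that)
    let ?T = "R \<inter> (J \<inter> \<gamma> -` fst d)"
    have T: "open ?T" "t \<in> ?T"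
      using R(1,2) t td smooth_curve_chart(4)[OF smooth d] by auto
    let ?f = "transition c d"
    let ?D = "\<lambda>q. frechet_derivative ?f (at q)"
    let ?a = "snd (z t)"
    let ?q = "snd c (\<gamma> t)"
    note f = transition_smooth[OF c d]
    have q: "?q \<in> snd c ` (fst c \<inter> fst d)" using R(2,4) td by blast
    have vx: "((snd c \<circ> \<gamma>) has_vector_derivative snd (z s)) (at s)" if "s \<in> R" for s
      by (rule chart_solution_velocity(1)[OF c R(1) that R(5,6)])
    have vy: "vector_derivative (snd d \<circ> \<gamma>) (at s) = ?D ((snd c \<circ> \<gamma>) s) (snd (z s))" if "s \<in> ?T" for s
      using smooth_curve_velocity_transition[OF smooth c d, of s] vector_derivative_at[OF vx[of s]] that R(3,4) by auto
    have z2: "((\<lambda>s. snd (z s)) has_vector_derivative - chris (metric_coeff A g c) ?q ?a ?a) (at t)"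
      using bounded_linear.has_vector_derivative[OF bounded_linear_snd R(6)[OF R(2)]] R(2,5)
      by (simp add: chart_spray_eq[OF c])
    have "((\<lambda>s. ?D ((snd c \<circ> \<gamma>) s) (snd (z s))) has_vector_derivative
        frechet_derivative (\<lambda>q. ?D q ?a) (at ((snd c \<circ> \<gamma>) t)) ?a +
        ?D ((snd c \<circ> \<gamma>) t) (- chris (metric_coeff A g c) ?q ?a ?a)) (at t)"
      by (rule has_vector_derivative_frechet_derivative[OF f T _ vx[OF R(2)] z2]) (use R(4) in auto)
    then have "((\<lambda>s. vector_derivative (snd d \<circ> \<gamma>) (at s)) has_vector_derivative
        frechet_derivative (\<lambda>q. ?D q ?a) (at ((snd c \<circ> \<gamma>) t)) ?a +
        ?D ((snd c \<circ> \<gamma>) t) (- chris (metric_coeff A g c) ?q ?a ?a)) (at t)"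
      by (rule has_vector_derivative_transform_within_open[OF _ T]) (simp only: vy)
    then have acc: "vector_derivative (\<lambda>s. vector_derivative (snd d \<circ> \<gamma>) (at s)) (at t) =
        frechet_derivative (\<lambda>q. ?D q ?a) (at ?q) ?a - ?D ?q (chris (metric_coeff A g c) ?q ?a ?a)"
      using linear_neg[OF smooth_on_linear_derivative[OF f q]] by (simp add: vector_derivative_at)
    \<comment> \<open>The second derivative of the chart change occurs both in \<open>acc\<close>
      and in the transformation law, and cancels between them.\<close>
    have tr: "?D ?q (chris (metric_coeff A g c) ?q ?a ?a) = frechet_derivative (\<lambda>q. ?D q ?a) (at ?q) ?a +
        chris (metric_coeff A g d) (?f ?q) (?D ?q ?a) (?D ?q ?a)"
    proof (rule chris_transform[OF coords[OF c] coords[OF d] f _ _ _ q])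
      show "metric_coeff A g c q u v = metric_coeff A g d (?f q) (?D q u) (?D q v)"
        if "q \<in> snd c ` (fst c \<inter> fst d)" for q u v
        using that metric_coeff_transition[OF c d, of _ g u v] c by auto
      show "surj (?D ?q)" by (rule dtransition_surj[OF c d]) (use R(2,4) td in auto)
    qed (use c in auto)
    show "vector_derivative (\<lambda>s. vector_derivative (snd d \<circ> \<gamma>) (at s)) (at t) +
        christoffel A g d ((snd d \<circ> \<gamma>) t) (vector_derivative (snd d \<circ> \<gamma>) (at t)) (vector_derivative (snd d \<circ> \<gamma>) (at t)) = 0"
      unfolding acc tr vy[OF T(2)] christoffel_eq_chris using c R(2,4) by simp
  qed
qed

end

section \<open>Existence, uniqueness and continuous dependence of geodesics\<close>

text \<open>The continuity method: the points with \<open>P\<close> and the points without it form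
  two open sets. It serves uniqueness, continuous dependence and lifting alike.\<close>

lemma connected_induction_ball:
  fixes S :: "'a::metric_space set"
  assumes "connected S" "a \<in> S" "b \<in> S" "P a"
    and "\<And>x. x \<in> S \<Longrightarrow> \<exists>d>0. ball x d \<subseteq> S \<and> (\<forall>y\<in>ball x d. \<forall>z\<in>ball x d. P y \<longrightarrow> P z)"
  shows "P b"
proof (rule connected_induction_simple[where P = P, OF assms(1-4)])
  fix x assume "x \<in> S"
  then obtain d where d: "d > 0" "ball x d \<subseteq> S" "\<forall>y\<in>ball x d. \<forall>z\<in>ball x d. P y \<longrightarrow> P z"
    using assms(5) by blast
  have "openin (top_of_set S) (ball x d)" using d(2) open_ball openin_open by blast
  then show "\<exists>T. openin (top_of_set S) T \<and> x \<in> T \<and> (\<forall>y\<in>T. \<forall>z\<in>T. P y \<longrightarrow> P z)"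
    using d centre_in_ball by blast
qed

context lorentz_manifold
begin

lemma state_cong:
  assumes "open R" "t \<in> R" "\<And>s. s \<in> R \<Longrightarrow> \<gamma> s = \<sigma> s"
  shows "state c \<gamma> t = state c \<sigma> t"
proof -
  have "vector_derivative (snd c \<circ> \<gamma>) (at t) = vector_derivative (snd c \<circ> \<sigma>) (at t)"
    unfolding vector_derivative_def has_vector_derivative_def
    using has_derivative_cong_open[OF assms(1,2), of "snd c \<circ> \<gamma>" "snd c \<circ> \<sigma>"] assms(3) by simp
  then show ?thesis unfolding state_def using assms by simp
qed

lemma state_mem: "\<gamma> t \<in> fst c \<Longrightarrow> state c \<gamma> t \<in> snd c ` fst c \<times> UNIV"
  by (simp add: state_def)

lemma fst_state [simp]: "fst (state c \<gamma> t) = snd c (\<gamma> t)"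
  by (simp add: state_def)

lemma state_transition:
  assumes "geodesic A g J \<gamma>" "c \<in> A" "d \<in> A" "t \<in> J" "\<gamma> t \<in> fst c" "\<gamma> t \<in> fst d"
  shows "state d \<gamma> t = (transition c d (fst (state c \<gamma> t)),
    frechet_derivative (transition c d) (at (fst (state c \<gamma> t))) (snd (state c \<gamma> t)))"
  using smooth_curve_velocity_transition[OF geodesic_smooth[OF assms(1)] assms(2-6)] assms(2,5)
  by (simp add: state_def)

lemma geodesic_local:
  assumes J: "is_interval J" "J \<noteq> {}"
    and loc: "\<And>t. t \<in> J \<Longrightarrow> \<exists>K \<sigma> R. geodesic A g K \<sigma> \<and> open R \<and> t \<in> R \<and> R \<subseteq> K \<and> R \<subseteq> J \<and> (\<forall>s\<in>R. \<gamma> s = \<sigma> s)"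
  shows "geodesic A g J \<gamma>"
proof (rule geodesicI[OF J])
  fix t assume "t \<in> J"
  then obtain K \<sigma> R where K: "geodesic A g K \<sigma> \<and> open R \<and> t \<in> R \<and> R \<subseteq> K \<and> R \<subseteq> J \<and> (\<forall>s\<in>R. \<gamma> s = \<sigma> s)"
    using loc[of t] by (elim meta_impE exE)
  have geo: "geodesic A g K \<sigma>" and R: "open R" "t \<in> R" "R \<subseteq> K" "R \<subseteq> J" and eq: "\<And>s. s \<in> R \<Longrightarrow> \<gamma> s = \<sigma> s"
    using K by auto
  obtain c where c: "c \<in> A" "\<sigma> t \<in> fst c" by (rule chart_at)
  let ?R = "R \<inter> (K \<inter> \<sigma> -` fst c)"
  have "open ?R" using R(1) smooth_curve_chart(4)[OF geodesic_smooth[OF geo] c(1)] by blast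
  then show "\<exists>c\<in>A. \<exists>R z. open R \<and> t \<in> R \<and> R \<subseteq> J \<and>
      (\<forall>s\<in>R. \<gamma> s \<in> fst c \<and> fst (z s) = snd c (\<gamma> s) \<and> (z has_vector_derivative chart_spray c (z s)) (at s))"
    by (intro bexI[OF _ c(1)] exI[of _ ?R] exI[of _ "state c \<sigma>"])
       (use R c eq geodesic_state_derivative[OF geo c(1)] in auto)
qed

lemma geodesic_union:
  assumes 1: "geodesic A g J1 \<gamma>1" and 2: "geodesic A g J2 \<gamma>2" and ne: "J1 \<inter> J2 \<noteq> {}"
    and eq: "\<And>t. t \<in> J1 \<inter> J2 \<Longrightarrow> \<gamma>1 t = \<gamma>2 t"
  shows "geodesic A g (J1 \<union> J2) (\<lambda>t. if t \<in> J1 then \<gamma>1 t else \<gamma>2 t)"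
proof (rule geodesic_local)
  show "is_interval (J1 \<union> J2)"
    using geodesic_interval[OF 1] geodesic_interval[OF 2] ne
    by (simp add: is_interval_connected_1 connected_Un)
  show "J1 \<union> J2 \<noteq> {}" using ne by blast
  fix t assume t: "t \<in> J1 \<union> J2"
  let ?f = "\<lambda>t. if t \<in> J1 then \<gamma>1 t else \<gamma>2 t"
  let ?P = "\<lambda>K \<sigma> R. geodesic A g K \<sigma> \<and> open R \<and> t \<in> R \<and> R \<subseteq> K \<and> R \<subseteq> J1 \<union> J2 \<and> (\<forall>s\<in>R. ?f s = \<sigma> s)"
  have "?P J1 \<gamma>1 J1 \<or> ?P J2 \<gamma>2 J2" using t 1 2 eq geodesic_open by auto
  then show "\<exists>K \<sigma> R. ?P K \<sigma> R"
  proof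
    assume "?P J1 \<gamma>1 J1" then show ?thesis by (intro exI)
  next
    assume "?P J2 \<gamma>2 J2" then show ?thesis by (intro exI)
  qed
qed

text \<open>The Christoffel term is quadratic in the velocity, so scaling the parameter by
  \<open>m\<close> multiplies both terms of the geodesic equation by the square of \<open>m\<close>.
  Negative \<open>m\<close> reverses the curve.\<close>

lemma geodesic_affine:
  assumes geo: "geodesic A g J \<gamma>" and m: "m \<noteq> 0"
  shows "geodesic A g {t. m * t + a \<in> J} (\<lambda>t. \<gamma> (m * t + a))"
    and "c \<in> A \<Longrightarrow> m * t + a \<in> J \<Longrightarrow> \<gamma> (m * t + a) \<in> fst c \<Longrightarrow>
      state c (\<lambda>t. \<gamma> (m * t + a)) t = (snd c (\<gamma> (m * t + a)), m *\<^sub>R snd (state c \<gamma> (m * t + a)))"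
proof -
  let ?z = "\<lambda>c s. (snd c (\<gamma> (m * s + a)), m *\<^sub>R snd (state c \<gamma> (m * s + a)))"
  let ?R = "\<lambda>c. (\<lambda>s. m * s + a) -` (J \<inter> \<gamma> -` fst c)"
  have op: "open (?R c)" if "c \<in> A" for c
    by (intro open_vimage continuous_intros smooth_curve_chart(4)[OF geodesic_smooth[OF geo] that])
  have z: "(?z c has_vector_derivative chart_spray c (?z c s)) (at s)" if c: "c \<in> A" and s: "s \<in> ?R c" for c s
  proof -
    let ?q = "snd c (\<gamma> (m * s + a))" and ?u = "snd (state c \<gamma> (m * s + a))"
    have "((\<lambda>s. m * s + a) has_vector_derivative m) (at s)"
      by (auto intro!: derivative_eq_intros)
    from vector_diff_chain_at[OF this geodesic_state_derivative[OF geo c]]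
    have *: "((\<lambda>s. state c \<gamma> (m * s + a)) has_vector_derivative m *\<^sub>R chart_spray c (state c \<gamma> (m * s + a))) (at s)"
      using s by (simp add: o_def)
    have 1: "((\<lambda>s. snd c (\<gamma> (m * s + a))) has_vector_derivative m *\<^sub>R ?u) (at s)"
      using bounded_linear.has_vector_derivative[OF bounded_linear_fst *] by (simp add: chart_spray_eq[OF c])
    have "((\<lambda>s. snd (state c \<gamma> (m * s + a))) has_vector_derivative m *\<^sub>R (- chris (metric_coeff A g c) ?q ?u ?u)) (at s)"
      using bounded_linear.has_vector_derivative[OF bounded_linear_snd *] by (simp add: chart_spray_eq[OF c])
    from bounded_linear.has_vector_derivative[OF bounded_linear_scaleR_right[of m] this]
    have 2: "((\<lambda>s. m *\<^sub>R snd (state c \<gamma> (m * s + a))) has_vector_derivative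
        m *\<^sub>R m *\<^sub>R (- chris (metric_coeff A g c) ?q ?u ?u)) (at s)" .
    have "bilinear (chris (metric_coeff A g c) ?q)"
      by (rule lorentz_coords.chris_bilinear[OF coords[OF c]]) (use s in auto)
    then have "chart_spray c (?z c s) = (m *\<^sub>R ?u, m *\<^sub>R m *\<^sub>R (- chris (metric_coeff A g c) ?q ?u ?u))"
      by (simp add: chart_spray_eq[OF c] bilinear_lmul bilinear_rmul)
    then show ?thesis using has_vector_derivative_Pair[OF 1 2] by simp
  qed
  show "geodesic A g {t. m * t + a \<in> J} (\<lambda>t. \<gamma> (m * t + a))"
  proof (rule geodesicI)
    obtain s where "s \<in> J" using geodesic_nonempty[OF geo] by blast
    then have "(s - a) / m \<in> {t. m * t + a \<in> J}" using m by simp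
    then show "{t. m * t + a \<in> J} \<noteq> {}" by blast
    show "is_interval {t. m * t + a \<in> J}"
      unfolding is_interval_1
    proof (intro ballI allI impI)
      fix x y z assume x: "x \<in> {t. m * t + a \<in> J}" and y: "y \<in> {t. m * t + a \<in> J}" and "x \<le> z \<and> z \<le> y"
      then have "m * z + a \<in> closed_segment (m * x + a) (m * y + a)"
        unfolding closed_segment_eq_real_ivl by (simp add: mult_left_mono mult_left_mono_neg) (smt (verit) mult_left_mono mult_left_mono_neg)
      moreover have "convex J" using geodesic_interval[OF geo] by (simp add: is_interval_convex_1)
      ultimately show "z \<in> {t. m * t + a \<in> J}"
        using x y closed_segment_subset[of "m * x + a" J "m * y + a"] by auto
    qed
    fix t assume t: "t \<in> {t. m * t + a \<in> J}"
    obtain c where c: "c \<in> A" "\<gamma> (m * t + a) \<in> fst c" by (rule chart_at)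
    show "\<exists>c\<in>A. \<exists>R z. open R \<and> t \<in> R \<and> R \<subseteq> {t. m * t + a \<in> J} \<and>
      (\<forall>s\<in>R. \<gamma> (m * s + a) \<in> fst c \<and> fst (z s) = snd c (\<gamma> (m * s + a)) \<and>
        (z has_vector_derivative chart_spray c (z s)) (at s))"
      by (intro bexI[OF _ c(1)] exI[of _ "?R c"] exI[of _ "?z c"] conjI ballI op z c(1)) (use c t in auto)
  qed
  assume c: "c \<in> A" "m * t + a \<in> J" "\<gamma> (m * t + a) \<in> fst c"
  show "state c (\<lambda>t. \<gamma> (m * t + a)) t = (snd c (\<gamma> (m * t + a)), m *\<^sub>R snd (state c \<gamma> (m * t + a)))"
    by (rule chart_solution_velocity(2)[OF c(1) op[OF c(1)]]) (use c z[OF c(1)] in auto)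
qed

text \<open>The uniformity of \<open>e\<close> and \<open>K\<close> over a ball of initial states is
  the point: it allows a nearby geodesic to be continued when nothing is known of it except that its
  state at one parameter is close.\<close>

lemma local_family:
  assumes c: "c \<in> A" and z0: "z0 \<in> snd c ` fst c \<times> UNIV"
  obtains r e K \<Sigma> where "r > 0" "e > 0" "K > 0"
    "\<And>z. z \<in> cball z0 r \<Longrightarrow> geodesic A g {-e<..<e} (\<Sigma> z)"
    "\<And>z t. z \<in> cball z0 r \<Longrightarrow> \<bar>t\<bar> < e \<Longrightarrow> \<Sigma> z t \<in> fst c"
    "\<And>z. z \<in> cball z0 r \<Longrightarrow> state c (\<Sigma> z) 0 = z"
    "\<And>z w t. z \<in> cball z0 r \<Longrightarrow> w \<in> cball z0 r \<Longrightarrow> \<bar>t\<bar> < e \<Longrightarrow>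
       dist (state c (\<Sigma> z) t) (state c (\<Sigma> w) t) \<le> K * dist z w"
proof -
  let ?Q = "snd c ` fst c"
  obtain r e L where r: "r > 0" "e > 0" "L > 0" "cball z0 (2 * r) \<subseteq> ?Q \<times> UNIV"
    "\<And>x y. x \<in> cball z0 (2 * r) \<Longrightarrow> y \<in> cball z0 (2 * r) \<Longrightarrow> norm (chart_spray c x - chart_spray c y) \<le> L * norm (x - y)"
    and ex: "\<And>z1. z1 \<in> cball z0 r \<Longrightarrow> \<exists>z. z 0 = z1 \<and>
       (\<forall>t. \<bar>t\<bar> < e \<longrightarrow> z t \<in> cball z0 (2 * r) \<and> (z has_vector_derivative chart_spray c (z t)) (at t))"
    by (rule local_flow[OF lorentz_coords.smooth_on_spray[OF coords[OF c]] z0]) (rule that)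
  define Z where "Z z1 = (SOME z. z 0 = z1 \<and>
       (\<forall>t. \<bar>t\<bar> < e \<longrightarrow> z t \<in> cball z0 (2 * r) \<and> (z has_vector_derivative chart_spray c (z t)) (at t)))" for z1
  have Z: "Z z1 0 = z1" "\<And>t. \<bar>t\<bar> < e \<Longrightarrow> Z z1 t \<in> cball z0 (2 * r)"
      "\<And>t. \<bar>t\<bar> < e \<Longrightarrow> (Z z1 has_vector_derivative chart_spray c (Z z1 t)) (at t)" if "z1 \<in> cball z0 r" for z1
    using someI_ex[OF ex[OF that]] unfolding Z_def[symmetric] by simp_all
  define S where "S z t = chart_inv c (fst (Z z t))" for z t
  have ZQ: "fst (Z z t) \<in> ?Q" if "z \<in> cball z0 r" "\<bar>t\<bar> < e" for z t
    using Z(2)[OF that] r(4) by (auto simp: mem_Times_iff)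
  have S: "S z t \<in> fst c" "snd c (S z t) = fst (Z z t)" if "z \<in> cball z0 r" "\<bar>t\<bar> < e" for z t
    using ZQ[OF that] c by (simp_all add: S_def)
  have st: "state c (S z) t = Z z t" if "z \<in> cball z0 r" "\<bar>t\<bar> < e" for z t
  proof (rule chart_solution_velocity(2)[OF c, of "{-e<..<e}"])
    fix s assume "s \<in> {-e<..<e}"
    then have s: "\<bar>s\<bar> < e" by (simp add: abs_less_iff)
    show "fst (Z z s) = snd c (S z s)" by (rule S(2)[OF that(1) s, symmetric])
    show "(Z z has_vector_derivative chart_spray c (Z z s)) (at s)" by (rule Z(3)[OF that(1) s])
  qed (use that(2) in auto)
  show ?thesis
  proof (rule that[OF r(1,2), of "exp (L * e)" S])
    fix z assume z: "z \<in> cball z0 r"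
    show "geodesic A g {-e<..<e} (S z)"
    proof (rule geodesicI)
      fix t assume t: "t \<in> {-e<..<e}"
      show "\<exists>c\<in>A. \<exists>R w. open R \<and> t \<in> R \<and> R \<subseteq> {-e<..<e} \<and>
        (\<forall>s\<in>R. S z s \<in> fst c \<and> fst (w s) = snd c (S z s) \<and> (w has_vector_derivative chart_spray c (w s)) (at s))"
        by (intro bexI[OF _ c] exI[of _ "{-e<..<e}"] exI[of _ "Z z"])
           (use t S[OF z] Z(3)[OF z] in auto)
    qed (use r(2) in \<open>auto simp: is_interval_1\<close>)
    show "state c (S z) 0 = z" using st[OF z, of 0] Z(1)[OF z] r(2) by simp
    fix t assume t: "\<bar>t\<bar> < e"
    show "S z t \<in> fst c" by (rule S(1)[OF z t])
    fix w assume w: "w \<in> cball z0 r"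
    have "norm (Z z t - Z w t) \<le> norm (Z z 0 - Z w 0) * exp (L * \<bar>t - 0\<bar>)"
      by (rule ode_solutions_dist[where I = "{-e<..<e}" and B = "cball z0 (2 * r)", OF _ _ _ r(5)])
         (use t r(2) Z[OF z] Z[OF w] in \<open>auto simp: is_interval_1\<close>)
    also have "\<dots> \<le> norm (Z z 0 - Z w 0) * exp (L * e)"
      using t r(3) by (intro mult_left_mono) auto
    finally show "dist (state c (S z) t) (state c (S w) t) \<le> exp (L * e) * dist z w"
      using st[OF z t] st[OF w t] Z(1)[OF z] Z(1)[OF w] by (simp add: dist_norm mult.commute)
  qed simp
qed

section \<open>Initial value problems and uniqueness\<close>

definition initial :: "('a, 'e) chart \<Rightarrow> real \<Rightarrow> 'e \<times> 'e \<Rightarrow> real set \<Rightarrow> (real \<Rightarrow> 'a) \<Rightarrow> bool" where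
  "initial c t z J \<gamma> \<longleftrightarrow> geodesic A g J \<gamma> \<and> t \<in> J \<and> \<gamma> t \<in> fst c \<and> state c \<gamma> t = z"

lemma state_continuous:
  assumes "geodesic A g J \<gamma>" "c \<in> A" "t \<in> J" "\<gamma> t \<in> fst c"
  shows "isCont (state c \<gamma>) t"
  by (rule has_vector_derivative_continuous[OF geodesic_state_derivative[OF assms]])

lemma state_nhd:
  assumes geo: "geodesic A g J \<gamma>" and c: "c \<in> A" and t: "t \<in> J" "\<gamma> t \<in> fst c" and U: "open U" "state c \<gamma> t \<in> U"
  obtains d where "d > 0" "\<And>s. \<bar>s - t\<bar> < d \<Longrightarrow> s \<in> J \<and> \<gamma> s \<in> fst c \<and> state c \<gamma> s \<in> U"
proof -
  have "\<forall>\<^sub>F s in nhds t. s \<in> J \<inter> \<gamma> -` fst c"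
    using smooth_curve_chart(4)[OF geodesic_smooth[OF geo] c] t by (intro eventually_nhds_in_open) auto
  moreover have "\<forall>\<^sub>F s in nhds t. state c \<gamma> s \<in> U"
    using state_continuous[OF geo c t] U topological_tendstoD[of "state c \<gamma>" _ "nhds t" U]
    by (simp add: continuous_at tendsto_at_iff_tendsto_nhds)
  ultimately have "\<forall>\<^sub>F s in nhds t. s \<in> J \<and> \<gamma> s \<in> fst c \<and> state c \<gamma> s \<in> U"
    by eventually_elim simp
  then show ?thesis
    using that unfolding eventually_nhds_metric dist_real_def by blast
qed

text \<open>States that agree at one parameter agree nearby by the Gronwall estimate, and states
  that differ keep differing nearby by the Hausdorff property. So agreement spreads over the
  connected intersection of the domains.\<close>

lemma geodesic_unique:
  assumes 1: "initial c t0 z J1 \<gamma>1" and 2: "initial c t0 z J2 \<gamma>2" and c: "c \<in> A" and t: "t \<in> J1 \<inter> J2"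
  shows "\<gamma>1 t = \<gamma>2 t"
proof -
  have g1: "geodesic A g J1 \<gamma>1" and g2: "geodesic A g J2 \<gamma>2" using 1 2 by (simp_all add: initial_def)
  \<comment> \<open>Agreement is required in all charts so that the chart may change along the way;
    \<open>P1\<close> shows that it can be checked in a single one.\<close>
  define P where "P t \<longleftrightarrow> \<gamma>1 t = \<gamma>2 t \<and> (\<forall>c\<in>A. \<gamma>1 t \<in> fst c \<longrightarrow> state c \<gamma>1 t = state c \<gamma>2 t)" for t
  have P1: "P t" if "t \<in> J1 \<inter> J2" "\<gamma>1 t \<in> fst c" "\<gamma>2 t \<in> fst c" "c \<in> A" "state c \<gamma>1 t = state c \<gamma>2 t" for t c
  proof -
    have "\<gamma>1 t = \<gamma>2 t" using that(5) chart_inj[OF that(4,2,3)] by (simp add: state_def)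
    moreover have "state d \<gamma>1 t = state d \<gamma>2 t" if "d \<in> A" "\<gamma>1 t \<in> fst d" for d
      using state_transition[OF g1 \<open>c \<in> A\<close> that(1), of t] state_transition[OF g2 \<open>c \<in> A\<close> that(1), of t]
        \<open>t \<in> J1 \<inter> J2\<close> \<open>\<gamma>1 t \<in> fst c\<close> \<open>\<gamma>2 t \<in> fst c\<close> \<open>state c \<gamma>1 t = state c \<gamma>2 t\<close> that(2) calculation by simp
    ultimately show ?thesis by (simp add: P_def)
  qed
  have J: "connected (J1 \<inter> J2)" "open (J1 \<inter> J2)"
    using geodesic_interval[OF g1] geodesic_interval[OF g2] geodesic_open[OF g1] geodesic_open[OF g2]
    by (auto simp: is_interval_connected_1[symmetric] is_interval_Int)
  have "P t"
  proof (rule connected_induction_ball[where P = P, OF J(1) _ t])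
    show "t0 \<in> J1 \<inter> J2" using 1 2 by (simp add: initial_def)
    then show "P t0" by (rule P1[OF _ _ _ c]) (use 1 2 in \<open>simp_all add: initial_def\<close>)
    fix a assume a: "a \<in> J1 \<inter> J2"
    have ball: "\<exists>d>0. ball a d \<subseteq> J1 \<inter> J2 \<and> (\<forall>x\<in>ball a d. \<forall>y\<in>ball a d. P x \<longrightarrow> P y)"
      if "d > 0" "ball a d \<subseteq> J1 \<inter> J2" "\<And>x y. x \<in> ball a d \<Longrightarrow> y \<in> ball a d \<Longrightarrow> P x \<Longrightarrow> P y" for d
      by (intro exI[of _ d] conjI ballI impI) (rule that(1), rule that(2), rule that(3))
    show "\<exists>d>0. ball a d \<subseteq> J1 \<inter> J2 \<and> (\<forall>x\<in>ball a d. \<forall>y\<in>ball a d. P x \<longrightarrow> P y)"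
    \<comment> \<open>If the positions or the states differ at \<open>a\<close>, then
      \<open>P\<close> fails throughout a ball around \<open>a\<close> and the implication is
      vacuous.\<close>
    proof (cases "\<gamma>1 a = \<gamma>2 a")
      case False
      then obtain U V where UV: "open U" "open V" "\<gamma>1 a \<in> U" "\<gamma>2 a \<in> V" "U \<inter> V = {}"
        using hausdorff[OF False] by blast
      let ?T = "(J1 \<inter> \<gamma>1 -` U) \<inter> (J2 \<inter> \<gamma>2 -` V)"
      have "open ?T"
        by (intro open_Int continuous_open_preimage geodesic_continuous[OF g1] geodesic_continuous[OF g2]
            geodesic_open[OF g1] geodesic_open[OF g2] UV)
      moreover have "a \<in> ?T" using a UV by simp
      ultimately obtain d where d: "d > 0" "ball a d \<subseteq> ?T" using openE by blast
      show ?thesis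
      proof (rule ball[OF d(1)])
        fix x y assume "x \<in> ball a d" "P x"
        then have "x \<in> ?T" "\<gamma>1 x = \<gamma>2 x" using d(2) unfolding P_def by blast+
        then show "P y" using UV(5) by auto
      qed (use d(2) in blast)
    next
      case True
      obtain k where k: "k \<in> A" "\<gamma>1 a \<in> fst k" by (rule chart_at)
      have k2: "\<gamma>2 a \<in> fst k" using True k by simp
      have a12: "a \<in> J1" "a \<in> J2" using a by auto
      show ?thesis
      proof (cases "state k \<gamma>1 a = state k \<gamma>2 a")
        case False
        then obtain U V where UV: "open U" "open V" "state k \<gamma>1 a \<in> U" "state k \<gamma>2 a \<in> V" "U \<inter> V = {}"
          using hausdorff[OF False] by blast
        obtain d1 where d1: "d1 > 0" "\<And>s. \<bar>s - a\<bar> < d1 \<Longrightarrow> s \<in> J1 \<and> \<gamma>1 s \<in> fst k \<and> state k \<gamma>1 s \<in> U"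
          using state_nhd[OF g1 k(1) a12(1) k(2) UV(1,3)] by blast
        obtain d2 where d2: "d2 > 0" "\<And>s. \<bar>s - a\<bar> < d2 \<Longrightarrow> s \<in> J2 \<and> \<gamma>2 s \<in> fst k \<and> state k \<gamma>2 s \<in> V"
          using state_nhd[OF g2 k(1) a12(2) k2 UV(2,4)] by blast
        have *: "\<bar>s - a\<bar> < d1 \<and> \<bar>s - a\<bar> < d2" if "s \<in> ball a (min d1 d2)" for s
          using that by (auto simp: dist_real_def)
        show ?thesis
        proof (rule ball[of "min d1 d2"])
          show "ball a (min d1 d2) \<subseteq> J1 \<inter> J2" using * d1(2) d2(2) by blast
          fix x y assume "x \<in> ball a (min d1 d2)" "P x"
          then have "state k \<gamma>1 x \<in> U \<and> state k \<gamma>2 x \<in> V \<and> state k \<gamma>1 x = state k \<gamma>2 x"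
            using *[of x] d1(2)[of x] d2(2)[of x] k(1) unfolding P_def by blast
          then show "P y" using UV(5) by auto
        qed (use d1 d2 in simp)
      next
        case True
        let ?z = "state k \<gamma>1 a"
        obtain r where r: "r > 0" "cball ?z r \<subseteq> snd k ` fst k \<times> UNIV"
          using open_contains_cball[of "snd k ` fst k \<times> (UNIV :: 'e set)"] state_mem[of \<gamma>1 a k, OF k(2)] chart_continuous(4)[OF k(1)]
          by (metis open_Times open_UNIV)
        obtain L where "L > 0" and L: "\<And>x y. x \<in> cball ?z r \<Longrightarrow> y \<in> cball ?z r \<Longrightarrow>
            norm (chart_spray k x - chart_spray k y) \<le> L * norm (x - y)"
          by (rule smooth_on_lipschitz_cball[OF lorentz_coords.smooth_on_spray[OF coords[OF k(1)]] r(2)]) (rule that)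
        have B: "open (ball ?z r)" "?z \<in> ball ?z r" "state k \<gamma>2 a \<in> ball ?z r" using r(1) True by auto
        obtain d1 where d1: "d1 > 0" "\<And>s. \<bar>s - a\<bar> < d1 \<Longrightarrow> s \<in> J1 \<and> \<gamma>1 s \<in> fst k \<and> state k \<gamma>1 s \<in> ball ?z r"
          using state_nhd[OF g1 k(1) a12(1) k(2) B(1,2)] by blast
        obtain d2 where d2: "d2 > 0" "\<And>s. \<bar>s - a\<bar> < d2 \<Longrightarrow> s \<in> J2 \<and> \<gamma>2 s \<in> fst k \<and> state k \<gamma>2 s \<in> ball ?z r"
          using state_nhd[OF g2 k(1) a12(2) k2 B(1,3)] by blast
        let ?d = "min d1 d2"
        have *: "\<bar>s - a\<bar> < d1" "\<bar>s - a\<bar> < d2" if "s \<in> ball a ?d" for s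
          using that by (auto simp: dist_real_def)
        note D1 = d1(2)[OF *(1)] and D2 = d2(2)[OF *(2)]
        show ?thesis
        proof (rule ball[of ?d])
          show "ball a ?d \<subseteq> J1 \<inter> J2" using D1 D2 by blast
          fix x y assume x: "x \<in> ball a ?d" and y: "y \<in> ball a ?d" and Px: "P x"
          have "norm (state k \<gamma>1 y - state k \<gamma>2 y) \<le> norm (state k \<gamma>1 x - state k \<gamma>2 x) * exp (L * \<bar>y - x\<bar>)"
          proof (rule ode_solutions_dist[where I = "ball a ?d" and B = "cball ?z r", OF _ x y L])
            show "is_interval (ball a ?d)" by (simp add: is_interval_convex_1)
            show "(state k \<gamma>1 has_vector_derivative chart_spray k (state k \<gamma>1 t)) (at t)" if "t \<in> ball a ?d" for t
              by (rule geodesic_state_derivative[OF g1 k(1)]) (use D1[OF that] in auto)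
            show "(state k \<gamma>2 has_vector_derivative chart_spray k (state k \<gamma>2 t)) (at t)" if "t \<in> ball a ?d" for t
              by (rule geodesic_state_derivative[OF g2 k(1)]) (use D2[OF that] in auto)
            show "state k \<gamma>1 t \<in> cball ?z r" if "t \<in> ball a ?d" for t using D1[OF that] by simp
            show "state k \<gamma>2 t \<in> cball ?z r" if "t \<in> ball a ?d" for t using D2[OF that] by simp
          qed
          moreover have "state k \<gamma>1 x = state k \<gamma>2 x" using Px k(1) D1[OF x] unfolding P_def by blast
          ultimately have "state k \<gamma>1 y = state k \<gamma>2 y" by simp
          then show "P y" by (intro P1[of y k]) (use D1[OF y] D2[OF y] k(1) in auto)
        qed (use d1 d2 in simp)
      qed
    qed
  qed
  then show ?thesis by (simp add: P_def)
qed

section \<open>Maximal geodesics\<close>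

lemma initial_cong:
  assumes "initial c t z J \<gamma>" "geodesic A g K \<sigma>" "open R" "t \<in> R" "R \<subseteq> K" "\<And>s. s \<in> R \<Longrightarrow> \<sigma> s = \<gamma> s"
  shows "initial c t z K \<sigma>"
  using assms state_cong[OF assms(3,4), of \<sigma> \<gamma> c] unfolding initial_def by auto

definition inextendible :: "real set \<Rightarrow> (real \<Rightarrow> 'a) \<Rightarrow> bool" where
  "inextendible J \<gamma> \<longleftrightarrow> \<not> (\<exists>J' \<gamma>'. J \<subset> J' \<and> geodesic A g J' \<gamma>' \<and> (\<forall>t\<in>J. \<gamma>' t = \<gamma> t))"

text \<open>By uniqueness all geodesics with the given initial state agree on common parameters, so
  their union is again a geodesic. An extension of it would already belong to the family.\<close>

lemma maximal_geodesic:
  assumes ini: "initial c t0 z J \<gamma>" and c: "c \<in> A"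
  obtains M \<mu> where "initial c t0 z M \<mu>" "inextendible M \<mu>" "J \<subseteq> M" "\<And>t. t \<in> J \<Longrightarrow> \<mu> t = \<gamma> t"
proof -
  define F where "F = {(J, \<gamma>). initial c t0 z J \<gamma>}"
  define M where "M = \<Union>(fst ` F)"
  define \<mu> where "\<mu> t = (SOME p. \<exists>J \<gamma>. initial c t0 z J \<gamma> \<and> t \<in> J \<and> p = \<gamma> t)" for t
  have sub: "J \<subseteq> M" if "initial c t0 z J \<gamma>" for J \<gamma>
    using that unfolding M_def F_def by force
  have mem: "\<exists>J \<gamma>. initial c t0 z J \<gamma> \<and> t \<in> J" if "t \<in> M" for t
    using that unfolding M_def F_def by auto
  have \<mu>: "\<mu> t = \<gamma> t" if i: "initial c t0 z J \<gamma>" and t: "t \<in> J" for J \<gamma> t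
  proof -
    have "\<exists>p. \<exists>J \<gamma>. initial c t0 z J \<gamma> \<and> t \<in> J \<and> p = \<gamma> t" using i t by (intro exI conjI) auto
    from someI_ex[OF this] have "\<exists>J \<gamma>. initial c t0 z J \<gamma> \<and> t \<in> J \<and> \<mu> t = \<gamma> t" unfolding \<mu>_def .
    then obtain J' \<gamma>' where j: "initial c t0 z J' \<gamma>' \<and> t \<in> J' \<and> \<mu> t = \<gamma>' t" by (elim exE)
    then show ?thesis using geodesic_unique[OF _ i c, of J' \<gamma>' t] t by simp
  qed
  have geo: "geodesic A g M \<mu>"
  proof (rule geodesic_local)
    have "connected M"
      unfolding M_def
    proof (rule connected_Union)
      show "connected K" if "K \<in> fst ` F" for K
        using that geodesic_interval unfolding F_def initial_def by (auto simp: is_interval_connected_1)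
      have "t0 \<in> \<Inter> (fst ` F)" unfolding F_def initial_def by auto
      then show "\<Inter> (fst ` F) \<noteq> {}" by blast
    qed
    then show "is_interval M" by (simp add: is_interval_connected_1)
    show "M \<noteq> {}" using sub[OF ini] ini unfolding initial_def by blast
    fix t assume "t \<in> M"
    from mem[OF this] obtain J \<gamma> where j: "initial c t0 z J \<gamma> \<and> t \<in> J" by (elim exE)
    show "\<exists>K \<sigma> R. geodesic A g K \<sigma> \<and> open R \<and> t \<in> R \<and> R \<subseteq> K \<and> R \<subseteq> M \<and> (\<forall>s\<in>R. \<mu> s = \<sigma> s)"
      by (rule exI[of _ J], rule exI[of _ \<gamma>], rule exI[of _ J])
         (use j sub[of J \<gamma>] \<mu>[of J \<gamma>] geodesic_open[of J \<gamma>] in \<open>auto simp: initial_def\<close>)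
  qed
  have iniM: "initial c t0 z M \<mu>"
    by (rule initial_cong[OF ini geo geodesic_open[of J \<gamma>]])
       (use ini sub[OF ini] \<mu>[OF ini] in \<open>auto simp: initial_def\<close>)
  have "inextendible M \<mu>"
    unfolding inextendible_def
  proof (rule notI, elim exE conjE)
    fix J' \<gamma>' assume *: "M \<subset> J'" "geodesic A g J' \<gamma>'" "\<forall>t\<in>M. \<gamma>' t = \<mu> t"
    have "initial c t0 z J' \<gamma>'"
      by (rule initial_cong[OF iniM *(2) geodesic_open[OF geo]]) (use * iniM in \<open>auto simp: initial_def\<close>)
    then show False using sub[of J' \<gamma>'] *(1) by blast
  qed
  then show ?thesis using that[OF iniM _ sub[OF ini] \<mu>[OF ini]] by blast
qed

text \<open>Otherwise gluing the two curves would extend \<open>\<gamma>2\<close>.\<close>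

lemma inextendible_unique:
  assumes "initial c t0 z J1 \<gamma>1" "initial c t0 z J2 \<gamma>2" "c \<in> A" "inextendible J2 \<gamma>2"
  shows "J1 \<subseteq> J2" "t \<in> J1 \<Longrightarrow> \<gamma>1 t = \<gamma>2 t"
proof -
  let ?f = "\<lambda>t. if t \<in> J2 then \<gamma>2 t else \<gamma>1 t"
  have "geodesic A g (J2 \<union> J1) ?f"
    by (rule geodesic_union) (use assms geodesic_unique[OF assms(2,1,3)] in \<open>auto simp: initial_def\<close>)
  then have "J2 \<subset> J2 \<union> J1 \<Longrightarrow> \<exists>J' \<gamma>'. J2 \<subset> J' \<and> geodesic A g J' \<gamma>' \<and> (\<forall>t\<in>J2. \<gamma>' t = \<gamma>2 t)"
    by (intro exI[of _ "J2 \<union> J1"] exI[of _ ?f] conjI) simp_all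
  then have "\<not> J2 \<subset> J2 \<union> J1" by (rule contrapos_nn[OF assms(4)[unfolded inextendible_def]])
  then show sub: "J1 \<subseteq> J2" by blast
  show "\<gamma>1 t = \<gamma>2 t" if "t \<in> J1" using geodesic_unique[OF assms(1-3), of t] sub that by blast
qed

subsection \<open>Continuous dependence on the initial velocity\<close>

text \<open>Continuous dependence stated without a domain of the flow: for each nearby initial
  velocity some geodesic is asked to reach the parameter \<open>t\<close>. States are used instead
  of positions because propagation restarts from the state at an intermediate parameter.\<close>

definition depends_at :: "('a, 'e) chart \<Rightarrow> 'e \<Rightarrow> 'e \<Rightarrow> (real \<Rightarrow> 'a) \<Rightarrow> ('a, 'e) chart \<Rightarrow> real \<Rightarrow> bool" where
  "depends_at c q v \<gamma> d t \<longleftrightarrow> (\<forall>U. open U \<and> state d \<gamma> t \<in> U \<longrightarrow>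
     (\<exists>\<delta>>0. \<forall>w. dist w v < \<delta> \<longrightarrow>
       (\<exists>J' \<gamma>'. initial c 0 (q, w) J' \<gamma>' \<and> t \<in> J' \<and> \<gamma>' t \<in> fst d \<and> state d \<gamma>' t \<in> U)))"

text \<open>The coordinate change of the tangent bundle is continuous, so an open set of states in
  one chart pulls back to an open set in the other.\<close>

lemma depends_at_transfer:
  assumes geo: "geodesic A g J \<gamma>" and d: "d \<in> A" "d' \<in> A" "t \<in> J" "\<gamma> t \<in> fst d" "\<gamma> t \<in> fst d'"
    and dep: "depends_at c q v \<gamma> d t"
  shows "depends_at c q v \<gamma> d' t"
  unfolding depends_at_def
proof (intro allI impI, elim conjE)
  fix U :: "('e \<times> 'e) set" assume U: "open U" "state d' \<gamma> t \<in> U"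
  let ?S = "snd d ` (fst d \<inter> fst d') \<times> (UNIV :: 'e set)"
  let ?f = "\<lambda>z. (transition d d' (fst z), frechet_derivative (transition d d') (at (fst z)) (snd z))"
  note tr = transition_smooth[OF d(1,2)]
  have op: "open ?S" using smooth_on_open[OF tr] by (simp add: open_Times)
  have fs: "smooth_on ?S fst" "smooth_on ?S snd"
    using smooth_on_bounded_linear[OF bounded_linear_fst smooth_on_id[OF op]]
      smooth_on_bounded_linear[OF bounded_linear_snd smooth_on_id[OF op]] by simp_all
  have "smooth_on ?S ?f"
    by (intro smooth_on_Pair smooth_on_compose[OF tr fs(1)] smooth_on_frechet_derivative_apply[OF tr fs]) auto
  then have "continuous_on ?S ?f" by (rule smooth_on_imp_continuous_on)
  then have "open (?S \<inter> ?f -` U)" using op U(1) by (rule continuous_open_preimage)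
  moreover have "state d \<gamma> t \<in> ?S \<inter> ?f -` U"
    using state_transition[OF geo d] U(2) d by (auto simp: mem_Times_iff)
  ultimately obtain \<delta> where \<delta>: "\<delta> > 0" "\<forall>w. dist w v < \<delta> \<longrightarrow>
      (\<exists>J' \<gamma>'. initial c 0 (q, w) J' \<gamma>' \<and> t \<in> J' \<and> \<gamma>' t \<in> fst d \<and> state d \<gamma>' t \<in> ?S \<inter> ?f -` U)"
    using dep unfolding depends_at_def by (elim allE[of _ "?S \<inter> ?f -` U"]) auto
  have "\<exists>J' \<gamma>'. initial c 0 (q, w) J' \<gamma>' \<and> t \<in> J' \<and> \<gamma>' t \<in> fst d' \<and> state d' \<gamma>' t \<in> U" if w: "dist w v < \<delta>" for w
  proof -
    obtain J' \<gamma>' where *: "initial c 0 (q, w) J' \<gamma>' \<and> t \<in> J' \<and> \<gamma>' t \<in> fst d \<and> state d \<gamma>' t \<in> ?S \<inter> ?f -` U"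
      using \<delta>(2) w by (elim allE[of _ w] impE exE)
    have geo': "geodesic A g J' \<gamma>'" using * by (simp add: initial_def)
    have "snd d (\<gamma>' t) \<in> snd d ` (fst d \<inter> fst d')" using * by (auto simp: mem_Times_iff)
    then obtain p where "p \<in> fst d \<inter> fst d'" "snd d (\<gamma>' t) = snd d p" by blast
    then have "\<gamma>' t \<in> fst d'" using chart_inj[OF d(1), of "\<gamma>' t" p] * by auto
    moreover have "state d' \<gamma>' t \<in> U"
      using state_transition[OF geo' d(1,2), of t] * calculation by simp
    ultimately show ?thesis using * by blast
  qed
  then show "\<exists>\<delta>>0. \<forall>w. dist w v < \<delta> \<longrightarrow>
      (\<exists>J' \<gamma>'. initial c 0 (q, w) J' \<gamma>' \<and> t \<in> J' \<and> \<gamma>' t \<in> fst d' \<and> state d' \<gamma>' t \<in> U)"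
    using \<delta>(1) by blast
qed

text \<open>A geodesic whose state at \<open>x\<close> is close to that of \<open>\<gamma>\<close>
  is continued by the member of the local family with this state, shifted by \<open>x\<close>. The
  common Lipschitz constant then controls the state at \<open>y\<close>, on either side of
  \<open>x\<close>.\<close>

lemma depends_at_step:
  assumes geo: "geodesic A g J \<gamma>" and d: "d \<in> A" "a \<in> J" "\<gamma> a \<in> fst d" and c: "c \<in> A"
  obtains \<eta> where "\<eta> > 0"
    "\<And>x. x \<in> ball a \<eta> \<Longrightarrow> x \<in> J \<and> \<gamma> x \<in> fst d"
    "\<And>x y. x \<in> ball a \<eta> \<Longrightarrow> y \<in> ball a \<eta> \<Longrightarrow> depends_at c q v \<gamma> d x \<Longrightarrow> depends_at c q v \<gamma> d y"
proof -
  obtain r e K \<Sigma> where r: "r > 0" "e > 0" "K > 0"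
    and S: "\<And>z. z \<in> cball (state d \<gamma> a) r \<Longrightarrow> geodesic A g {-e<..<e} (\<Sigma> z)"
    "\<And>z t. z \<in> cball (state d \<gamma> a) r \<Longrightarrow> \<bar>t\<bar> < e \<Longrightarrow> \<Sigma> z t \<in> fst d"
    "\<And>z. z \<in> cball (state d \<gamma> a) r \<Longrightarrow> state d (\<Sigma> z) 0 = z"
    "\<And>z w t. z \<in> cball (state d \<gamma> a) r \<Longrightarrow> w \<in> cball (state d \<gamma> a) r \<Longrightarrow> \<bar>t\<bar> < e \<Longrightarrow>
       dist (state d (\<Sigma> z) t) (state d (\<Sigma> w) t) \<le> K * dist z w"
    by (rule local_family[OF d(1) state_mem[of \<gamma> a d, OF d(3)]]) (rule that)
  have "state d \<gamma> a \<in> ball (state d \<gamma> a) (r/2)" using r by simp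
  then obtain \<eta>0 where \<eta>0: "\<eta>0 > 0"
    "\<And>s. \<bar>s - a\<bar> < \<eta>0 \<Longrightarrow> s \<in> J \<and> \<gamma> s \<in> fst d \<and> state d \<gamma> s \<in> ball (state d \<gamma> a) (r/2)"
    using state_nhd[OF geo d open_ball] by blast
  \<comment> \<open>Two parameters of the ball then differ by less than \<open>e\<close>. The states
    of \<open>\<gamma>\<close> there use up \<open>r/2\<close> of the radius, which leaves
    \<open>r/2\<close> for the perturbation.\<close>
  define \<eta> where "\<eta> = min \<eta>0 (e/2)"
  have \<eta>: "\<eta> > 0" using \<eta>0 r by (simp add: \<eta>_def)
  have N: "s \<in> J \<and> \<gamma> s \<in> fst d \<and> state d \<gamma> s \<in> ball (state d \<gamma> a) (r/2)" if "s \<in> ball a \<eta>" for s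
    by (rule \<eta>0(2)) (use that in \<open>simp add: \<eta>_def dist_real_def abs_minus_commute\<close>)
  have close: "\<bar>y - x\<bar> < e" if "x \<in> ball a \<eta>" "y \<in> ball a \<eta>" for x y
  proof -
    have "\<bar>a - x\<bar> < e / 2" "\<bar>a - y\<bar> < e / 2" using that by (simp_all add: \<eta>_def dist_real_def)
    then show ?thesis using abs_triangle_ineq4[of "a - x" "a - y"] by simp
  qed
  have shifted: "initial d x z {t. 1 * t + (- x) \<in> {-e<..<e}} (\<lambda>t. \<Sigma> z (1 * t + (- x)))"
    "\<And>t. \<bar>t - x\<bar> < e \<Longrightarrow> state d (\<lambda>t. \<Sigma> z (1 * t + (- x))) t = state d (\<Sigma> z) (t - x)"
    if z: "z \<in> cball (state d \<gamma> a) r" for x z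
  proof -
    have one: "(1::real) \<noteq> 0" by simp
    show 2: "state d (\<lambda>t. \<Sigma> z (1 * t + (- x))) t = state d (\<Sigma> z) (t - x)" if "\<bar>t - x\<bar> < e" for t
      using geodesic_affine(2)[OF S(1)[OF z] one d(1), of t "- x"] S(2)[OF z, of "t - x"] that
      by (auto simp: prod_eq_iff abs_less_iff)
    show "initial d x z {t. 1 * t + (- x) \<in> {-e<..<e}} (\<lambda>t. \<Sigma> z (1 * t + (- x)))"
      unfolding initial_def
      using geodesic_affine(1)[OF S(1)[OF z] one, of "- x"] S(2)[OF z, of 0] r(2) 2[of x] S(3)[OF z] by simp
  qed
  have step: "depends_at c q v \<gamma> d y" if x: "x \<in> ball a \<eta>" and y: "y \<in> ball a \<eta>" and dep: "depends_at c q v \<gamma> d x" for x y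
    unfolding depends_at_def
  proof (intro allI impI, elim conjE)
    fix U :: "('e \<times> 'e) set" assume U: "open U" "state d \<gamma> y \<in> U"
    obtain \<epsilon> where \<epsilon>: "\<epsilon> > 0" "ball (state d \<gamma> y) \<epsilon> \<subseteq> U" using U openE by blast
    have x1: "x \<in> J" "\<gamma> x \<in> fst d" and zx: "state d \<gamma> x \<in> ball (state d \<gamma> a) (r/2)" using N[OF x] by auto
    have zxc: "state d \<gamma> x \<in> cball (state d \<gamma> a) r" using zx r by simp
    have yx: "\<bar>y - x\<bar> < e" by (rule close[OF x y])
    \<comment> \<open>\<open>r/2\<close> keeps the perturbed state in the ball of the family, and
      \<open>\<epsilon> / K\<close> absorbs the Lipschitz constant.\<close>
    define \<epsilon>' where "\<epsilon>' = min (r/2) (\<epsilon> / K)"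
    have \<epsilon>': "\<epsilon>' > 0" using r \<epsilon>(1) by (simp add: \<epsilon>'_def)
    have \<gamma>y: "state d \<gamma> y = state d (\<Sigma> (state d \<gamma> x)) (y - x)"
    proof -
      let ?K = "{t. 1 * t + (- x) \<in> {-e<..<e}}"
      let ?\<sigma> = "\<lambda>t. \<Sigma> (state d \<gamma> x) (1 * t + (- x))"
      have "initial d x (state d \<gamma> x) J \<gamma>" using geo x1 by (simp add: initial_def)
      note uniq = geodesic_unique[OF this shifted(1)[OF zxc] d(1)]
      have gK: "geodesic A g ?K ?\<sigma>" using shifted(1)[OF zxc] by (simp add: initial_def)
      have "state d \<gamma> y = state d ?\<sigma> y"
        by (rule state_cong[where R = "J \<inter> ?K"])
           (use geodesic_open[OF geo] geodesic_open[OF gK] N[OF y] yx uniq in \<open>auto simp: abs_less_iff\<close>)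
      then show ?thesis using shifted(2)[OF zxc yx] by simp
    qed
    obtain \<delta> where \<delta>: "\<delta> > 0" "\<forall>w. dist w v < \<delta> \<longrightarrow> (\<exists>J' \<gamma>'. initial c 0 (q, w) J' \<gamma>' \<and> x \<in> J' \<and> \<gamma>' x \<in> fst d \<and>
        state d \<gamma>' x \<in> ball (state d \<gamma> x) \<epsilon>')"
      using dep \<epsilon>' unfolding depends_at_def by (elim allE[of _ "ball (state d \<gamma> x) \<epsilon>'"]) auto
    have "\<exists>J' \<gamma>'. initial c 0 (q, w) J' \<gamma>' \<and> y \<in> J' \<and> \<gamma>' y \<in> fst d \<and> state d \<gamma>' y \<in> U" if w: "dist w v < \<delta>" for w
    proof -
      obtain J' \<gamma>' where *: "initial c 0 (q, w) J' \<gamma>' \<and> x \<in> J' \<and> \<gamma>' x \<in> fst d \<and> state d \<gamma>' x \<in> ball (state d \<gamma> x) \<epsilon>'"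
        using \<delta>(2) w by (elim allE[of _ w] impE exE)
      have geo': "geodesic A g J' \<gamma>'" using * by (simp add: initial_def)
      let ?z = "state d \<gamma>' x"
      have zz: "dist (state d \<gamma> x) ?z < \<epsilon>'" using * by simp
      have z: "?z \<in> cball (state d \<gamma> a) r"
        using zz zx dist_triangle[of "state d \<gamma> a" ?z "state d \<gamma> x"] by (simp add: \<epsilon>'_def)
      let ?K = "{t. 1 * t + (- x) \<in> {-e<..<e}}"
      let ?\<sigma> = "\<lambda>t. \<Sigma> ?z (1 * t + (- x))"
      have gK: "geodesic A g ?K ?\<sigma>" using shifted(1)[OF z] by (simp add: initial_def)
      have "initial d x ?z J' \<gamma>'" using geo' * by (simp add: initial_def)
      note uniq = geodesic_unique[OF this shifted(1)[OF z] d(1)]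
      \<comment> \<open>\<open>\<gamma>'\<close> need not be defined at \<open>y\<close>; the local
        geodesic supplies the missing part, and by uniqueness the two agree on the overlap.\<close>
      let ?f = "\<lambda>t. if t \<in> J' then \<gamma>' t else ?\<sigma> t"
      have gf: "geodesic A g (J' \<union> ?K) ?f"
      proof (rule geodesic_union[OF geo' gK _ uniq])
        have "x \<in> J' \<inter> ?K" using * r(2) by simp
        then show "J' \<inter> ?K \<noteq> {}" by blast
      qed
      have ini: "initial c 0 (q, w) (J' \<union> ?K) ?f"
        by (rule initial_cong[OF _ gf geodesic_open[OF geo']]) (use * in \<open>auto simp: initial_def\<close>)
      have yK: "y \<in> ?K" using yx by (simp add: abs_less_iff)
      have fK: "?f s = ?\<sigma> s" if "s \<in> ?K" for s using that uniq[of s] by simp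
      have sf: "state d ?f y = state d (\<Sigma> ?z) (y - x)"
        using state_cong[OF geodesic_open[OF gK] yK, of ?f ?\<sigma> d] fK shifted(2)[OF z yx] by simp
      have "?f y \<in> fst d" unfolding fK[OF yK] using S(2)[OF z, of "y - x"] yx by simp
      moreover have "state d ?f y \<in> U"
      proof -
        have "dist (state d \<gamma> y) (state d ?f y) \<le> K * dist (state d \<gamma> x) ?z"
          unfolding \<gamma>y sf by (rule S(4)[OF zxc z yx])
        also have "\<dots> < K * \<epsilon>'" using zz r(3) by simp
        also have "\<dots> \<le> K * (\<epsilon> / K)" using r(3) by (intro mult_left_mono) (simp_all add: \<epsilon>'_def)
        also have "\<dots> = \<epsilon>" using r(3) by simp
        finally show ?thesis using \<epsilon>(2) by auto
      qed
      ultimately show ?thesis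
        by (intro exI[of _ "J' \<union> ?K"] exI[of _ ?f]) (use ini yK in blast)
    qed
    then show "\<exists>\<delta>>0. \<forall>w. dist w v < \<delta> \<longrightarrow>
        (\<exists>J' \<gamma>'. initial c 0 (q, w) J' \<gamma>' \<and> y \<in> J' \<and> \<gamma>' y \<in> fst d \<and> state d \<gamma>' y \<in> U)"
      using \<delta>(1) by blast
  qed
  show ?thesis by (rule that[OF \<eta> _ step]) (use N in auto)
qed

lemma depends_at_initial:
  assumes c: "c \<in> A" and ini: "initial c 0 (q, v) J \<gamma>"
  shows "depends_at c q v \<gamma> c 0"
  unfolding depends_at_def
proof (intro allI impI, elim conjE)
  fix U :: "('e \<times> 'e) set" assume U: "open U" "state c \<gamma> 0 \<in> U"
  have \<gamma>: "\<gamma> 0 \<in> fst c" "state c \<gamma> 0 = (q, v)" using ini by (simp_all add: initial_def)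
  have qv: "(q, v) \<in> snd c ` fst c \<times> UNIV" using state_mem[of \<gamma> 0 c, OF \<gamma>(1)] \<gamma>(2) by simp
  obtain r e K \<Sigma> where r: "r > 0" "e > 0" "K > 0"
    and S: "\<And>z. z \<in> cball (q, v) r \<Longrightarrow> geodesic A g {-e<..<e} (\<Sigma> z)"
    "\<And>z t. z \<in> cball (q, v) r \<Longrightarrow> \<bar>t\<bar> < e \<Longrightarrow> \<Sigma> z t \<in> fst c"
    "\<And>z. z \<in> cball (q, v) r \<Longrightarrow> state c (\<Sigma> z) 0 = z"
    "\<And>z w t. z \<in> cball (q, v) r \<Longrightarrow> w \<in> cball (q, v) r \<Longrightarrow> \<bar>t\<bar> < e \<Longrightarrow>
       dist (state c (\<Sigma> z) t) (state c (\<Sigma> w) t) \<le> K * dist z w"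
    by (rule local_family[OF c qv]) (rule that)
  obtain \<epsilon> where \<epsilon>: "\<epsilon> > 0" "ball (q, v) \<epsilon> \<subseteq> U" using U \<gamma> openE by metis
  have dd: "dist (q, v) (q, w) = dist w v" for w by (simp add: dist_prod_def dist_commute)
  have "\<exists>J' \<gamma>'. initial c 0 (q, w) J' \<gamma>' \<and> 0 \<in> J' \<and> \<gamma>' 0 \<in> fst c \<and> state c \<gamma>' 0 \<in> U"
    if w: "dist w v < min r \<epsilon>" for w
  proof -
    have z: "(q, w) \<in> cball (q, v) r" "(q, w) \<in> U" using w dd[of w] \<epsilon>(2) by auto
    show ?thesis
      by (rule exI[of _ "{-e<..<e}"], rule exI[of _ "\<Sigma> (q, w)"])
         (use S[OF z(1)] S(2)[OF z(1), of 0] r z(2) in \<open>simp add: initial_def\<close>)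
  qed
  then show "\<exists>\<delta>>0. \<forall>w. dist w v < \<delta> \<longrightarrow>
      (\<exists>J' \<gamma>'. initial c 0 (q, w) J' \<gamma>' \<and> 0 \<in> J' \<and> \<gamma>' 0 \<in> fst c \<and> state c \<gamma>' 0 \<in> U)"
    using r \<epsilon> by (intro exI[of _ "min r \<epsilon>"]) auto
qed

text \<open>Dependence on the initial velocity holds at parameter 0 and spreads along the connected
  domain, changing charts where necessary. Only at the end is the velocity forgotten, by leaving the
  second factor of the open set unrestricted.\<close>

lemma geodesics_through_open_set:
  assumes c: "c \<in> A" and ini: "initial c 0 (q, v) J \<gamma>" and t: "t \<in> J" and W: "open W" "\<gamma> t \<in> W"
  obtains \<delta> where "\<delta> > 0"
    "\<And>w. dist w v < \<delta> \<Longrightarrow> \<exists>J' \<gamma>'. initial c 0 (q, w) J' \<gamma>' \<and> t \<in> J' \<and> \<gamma>' t \<in> W"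
proof -
  have geo: "geodesic A g J \<gamma>" and J0: "0 \<in> J" "\<gamma> 0 \<in> fst c" using ini by (simp_all add: initial_def)
  define P where "P t \<longleftrightarrow> (\<exists>d\<in>A. \<gamma> t \<in> fst d \<and> depends_at c q v \<gamma> d t)" for t
  have "connected J" using geodesic_interval[OF geo] by (simp add: is_interval_connected_1)
  then have "P t"
  proof (rule connected_induction_ball[where P = P, OF _ J0(1) t])
    show "P 0" unfolding P_def using depends_at_initial[OF c ini] c J0 by blast
    fix a assume a: "a \<in> J"
    obtain d where d: "d \<in> A" "\<gamma> a \<in> fst d" by (rule chart_at)
    obtain \<eta> where \<eta>: "\<eta> > 0" "\<And>x. x \<in> ball a \<eta> \<Longrightarrow> x \<in> J \<and> \<gamma> x \<in> fst d"
      "\<And>x y. x \<in> ball a \<eta> \<Longrightarrow> y \<in> ball a \<eta> \<Longrightarrow> depends_at c q v \<gamma> d x \<Longrightarrow> depends_at c q v \<gamma> d y"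
      by (rule depends_at_step[OF geo d(1) a d(2) c]) (rule that)
    have "P y" if x: "x \<in> ball a \<eta>" and y: "y \<in> ball a \<eta>" and "P x" for x y
    proof -
      obtain d' where d': "d' \<in> A" "\<gamma> x \<in> fst d'" "depends_at c q v \<gamma> d' x" using \<open>P x\<close> unfolding P_def by blast
      have "depends_at c q v \<gamma> d x"
        by (rule depends_at_transfer[OF geo d'(1) d(1) _ d'(2) _ d'(3)]) (use \<eta>(2)[OF x] in auto)
      then show "P y" unfolding P_def using \<eta>(3)[OF x y] \<eta>(2)[OF y] d(1) by blast
    qed
    moreover have "ball a \<eta> \<subseteq> J" using \<eta>(2) by blast
    ultimately show "\<exists>d>0. ball a d \<subseteq> J \<and> (\<forall>x\<in>ball a d. \<forall>y\<in>ball a d. P x \<longrightarrow> P y)"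
      using \<eta>(1) by blast
  qed
  then obtain d where d: "d \<in> A" "\<gamma> t \<in> fst d" "depends_at c q v \<gamma> d t" unfolding P_def by blast
  let ?U = "snd d ` (fst d \<inter> W) \<times> (UNIV :: 'e set)"
  have "open ?U" using chart_open_image[OF d(1) W(1)] by (simp add: open_Times)
  moreover have "state d \<gamma> t \<in> ?U" using d(2) W(2) by (simp add: mem_Times_iff)
  ultimately obtain \<delta> where \<delta>: "\<delta> > 0" "\<forall>w. dist w v < \<delta> \<longrightarrow>
      (\<exists>J' \<gamma>'. initial c 0 (q, w) J' \<gamma>' \<and> t \<in> J' \<and> \<gamma>' t \<in> fst d \<and> state d \<gamma>' t \<in> ?U)"
    using d(3) unfolding depends_at_def by (elim allE[of _ ?U]) auto
  show ?thesis
  proof (rule that[OF \<delta>(1)])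
    fix w assume "dist w v < \<delta>"
    then obtain J' \<gamma>' where *: "initial c 0 (q, w) J' \<gamma>' \<and> t \<in> J' \<and> \<gamma>' t \<in> fst d \<and> state d \<gamma>' t \<in> ?U"
      using \<delta>(2) by (elim allE[of _ w] impE exE)
    then have "snd d (\<gamma>' t) \<in> snd d ` (fst d \<inter> W)" by (auto simp: mem_Times_iff)
    then obtain p where "p \<in> fst d \<inter> W" "snd d (\<gamma>' t) = snd d p" by blast
    then have "\<gamma>' t \<in> W" using chart_inj[OF d(1), of "\<gamma>' t" p] * by auto
    then show "\<exists>J' \<gamma>'. initial c 0 (q, w) J' \<gamma>' \<and> t \<in> J' \<and> \<gamma>' t \<in> W" using * by blast
  qed
qed

subsection \<open>Null geodesics\<close>

lemma null_geodesic_eq: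
  "null_geodesic A g J \<gamma> \<longleftrightarrow> geodesic A g J \<gamma> \<and> inextendible J \<gamma> \<and> (\<forall>t\<in>J. null_vec g (\<gamma> t) (velocity A \<gamma> J t))"
  unfolding null_geodesic_def inextendible_def by blast

lemma null_vec_state:
  assumes geo: "geodesic A g J \<gamma>" and c: "c \<in> A" "t \<in> J" "\<gamma> t \<in> fst c"
  shows "null_vec g (\<gamma> t) (velocity A \<gamma> J t) \<longleftrightarrow> snd (state c \<gamma> t) \<noteq> 0 \<and>
    metric_coeff A g c (snd c (\<gamma> t)) (snd (state c \<gamma> t)) (snd (state c \<gamma> t)) = 0"
proof -
  let ?v = "velocity A \<gamma> UNIV t"
  have v: "?v \<in> tangent_space A (\<gamma> t)" by (rule smooth_curve_velocity[OF geodesic_smooth[OF geo] c(2)])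
  have "?v c = snd (state c \<gamma> t)" using c by (simp add: velocity_def state_def)
  then show ?thesis
    unfolding null_vec_def velocity_open[OF geodesic_open[OF geo] c(2)]
    using tangent_nonzero[OF v c(1,3)] metric_eq_coeff[OF c(1,3) v v] by simp
qed

text \<open>The competitor in the uniqueness argument that keeps the velocity of a null geodesic
  from vanishing.\<close>

lemma constant_geodesic: "geodesic A g UNIV (\<lambda>_. p)"
proof (rule geodesicI)
  fix t :: real
  obtain c where c: "c \<in> A" "p \<in> fst c" by (rule chart_at)
  have "bilinear (chris (metric_coeff A g c) (snd c p))"
    by (rule lorentz_coords.chris_bilinear[OF coords[OF c(1)]]) (use c in auto)
  then have "chart_spray c (snd c p, 0) = 0"
    by (simp add: chart_spray_eq[OF c(1)] bilinear_lzero zero_prod_def)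
  then show "\<exists>c\<in>A. \<exists>R z. open R \<and> t \<in> R \<and> R \<subseteq> UNIV \<and>
      (\<forall>s\<in>R. p \<in> fst c \<and> fst (z s) = snd c p \<and> (z has_vector_derivative chart_spray c (z s)) (at s))"
    by (intro bexI[OF _ c(1)] exI[of _ UNIV] exI[of _ "\<lambda>_. (snd c p, 0)"]) (use c in auto)
qed auto

text \<open>The derivative is that of the metric coefficients along the curve minus twice the
  Christoffel pairing; by \<open>chris_diag\<close> with all three vectors equal, the two
  cancel.\<close>

lemma geodesic_norm_derivative:
  assumes geo: "geodesic A g J \<gamma>" and t: "t \<in> J"
  shows "((\<lambda>t. g (\<gamma> t) (velocity A \<gamma> UNIV t) (velocity A \<gamma> UNIV t)) has_real_derivative 0) (at t)"
proof -
  obtain c where c: "c \<in> A" "\<gamma> t \<in> fst c" by (rule chart_at)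
  interpret lorentz_coords "snd c ` fst c" "metric_coeff A g c" by (rule coords[OF c(1)])
  let ?G = "metric_coeff A g c"
  let ?R = "J \<inter> \<gamma> -` fst c"
  let ?q = "snd c (\<gamma> t)" and ?u = "snd (state c \<gamma> t)"
  have R: "open ?R" "t \<in> ?R" using smooth_curve_chart(4)[OF geodesic_smooth[OF geo] c(1)] t c by auto
  have q: "?q \<in> snd c ` fst c" using c by blast
  note st = geodesic_state_derivative[OF geo c(1) t c(2), unfolded chart_spray_eq[OF c(1)]]
  have dq: "((\<lambda>s. snd c (\<gamma> s)) has_derivative (\<lambda>h. h *\<^sub>R ?u)) (at t)"
    using bounded_linear.has_vector_derivative[OF bounded_linear_fst st] by (simp add: has_vector_derivative_def)
  have du: "((\<lambda>s. snd (state c \<gamma> s)) has_derivative (\<lambda>h. h *\<^sub>R (- chris ?G ?q ?u ?u))) (at t)"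
    using bounded_linear.has_vector_derivative[OF bounded_linear_snd st] by (simp add: has_vector_derivative_def)
  have "((\<lambda>s. ?G (snd c (\<gamma> s)) (snd (state c \<gamma> s)) (snd (state c \<gamma> s))) has_derivative
      (\<lambda>h. metric_deriv ?G ?q (h *\<^sub>R ?u) ?u ?u + ?G ?q (h *\<^sub>R (- chris ?G ?q ?u ?u)) ?u +
        ?G ?q ?u (h *\<^sub>R (- chris ?G ?q ?u ?u)))) (at t)"
    by (rule has_derivative_coeff[OF dq du du q])
  moreover have "metric_deriv ?G ?q (h *\<^sub>R ?u) ?u ?u + ?G ?q (h *\<^sub>R (- chris ?G ?q ?u ?u)) ?u +
        ?G ?q ?u (h *\<^sub>R (- chris ?G ?q ?u ?u)) = 0" for h
    using form_sym[OF q, of ?u "chris ?G ?q ?u ?u"]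
    by (simp add: simps[OF q] chris_diag[OF q] linear_cmul[OF metric_deriv_linear[OF q]])
  ultimately have D: "((\<lambda>s. ?G (snd c (\<gamma> s)) (snd (state c \<gamma> s)) (snd (state c \<gamma> s))) has_derivative (\<lambda>h. 0)) (at t)"
    by simp
  have "((\<lambda>t. g (\<gamma> t) (velocity A \<gamma> UNIV t) (velocity A \<gamma> UNIV t)) has_derivative (\<lambda>h. 0)) (at t)"
  proof (rule has_derivative_transform_within_open[OF D R])
    fix s assume s: "s \<in> ?R"
    then have v: "velocity A \<gamma> UNIV s \<in> tangent_space A (\<gamma> s)"
      using smooth_curve_velocity[OF geodesic_smooth[OF geo]] by blast
    have "velocity A \<gamma> UNIV s c = snd (state c \<gamma> s)" using s c(1) by (simp add: velocity_def state_def)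
    then show "?G (snd c (\<gamma> s)) (snd (state c \<gamma> s)) (snd (state c \<gamma> s)) = g (\<gamma> s) (velocity A \<gamma> UNIV s) (velocity A \<gamma> UNIV s)"
      using metric_eq_coeff[OF c(1) _ v v] s by simp
  qed
  then show ?thesis by (simp add: has_field_derivative_def lambda_zero)
qed

lemma geodesic_null_everywhere:
  assumes geo: "geodesic A g J \<gamma>" and t: "t0 \<in> J" "t \<in> J"
    and null: "null_vec g (\<gamma> t0) (velocity A \<gamma> J t0)"
  shows "null_vec g (\<gamma> t) (velocity A \<gamma> J t)"
proof -
  let ?V = "velocity A \<gamma> UNIV"
  have V: "velocity A \<gamma> J s = ?V s" if "s \<in> J" for s by (rule velocity_open[OF geodesic_open[OF geo] that])
  have "convex J" using geodesic_interval[OF geo] by (simp add: is_interval_convex_1)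
  then have "\<exists>k. \<forall>t\<in>J. g (\<gamma> t) (?V t) (?V t) = k"
    by (rule has_field_derivative_zero_constant)
       (rule has_field_derivative_at_within[OF geodesic_norm_derivative[OF geo]])
  then have "g (\<gamma> t) (?V t) (?V t) = g (\<gamma> t0) (?V t0) (?V t0)" using t by metis
  then have 0: "g (\<gamma> t) (?V t) (?V t) = 0" using null V[OF t(1)] by (simp add: null_vec_def)
  \<comment> \<open>A velocity vanishing at \<open>t\<close> would make the curve constant by
    uniqueness, against the nonzero velocity at \<open>t0\<close>.\<close>
  have "?V t \<noteq> (\<lambda>_. 0)"
  proof
    assume Vt: "?V t = (\<lambda>_. 0)"
    obtain c where c: "c \<in> A" "\<gamma> t \<in> fst c" by (rule chart_at)
    have const: "state k (\<lambda>_. \<gamma> t) s = (snd k (\<gamma> t), 0)" for k s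
      by (simp add: state_def o_def)
    have "?V t c = 0" using Vt by simp
    then have "state c \<gamma> t = state c (\<lambda>_. \<gamma> t) t" unfolding const using c by (simp add: velocity_def state_def)
    then have "initial c t (state c (\<lambda>_. \<gamma> t) t) J \<gamma>" "initial c t (state c (\<lambda>_. \<gamma> t) t) UNIV (\<lambda>_. \<gamma> t)"
      unfolding initial_def using geo t(2) c constant_geodesic by auto
    then have eq: "\<gamma> s = \<gamma> t" if "s \<in> J" for s
      using geodesic_unique[OF _ _ c(1), of t _ J \<gamma> UNIV "\<lambda>_. \<gamma> t" s] that by blast
    obtain k where k: "k \<in> A" "\<gamma> t0 \<in> fst k" by (rule chart_at)
    have "state k \<gamma> t0 = state k (\<lambda>_. \<gamma> t) t0"
      by (rule state_cong[OF geodesic_open[OF geo] t(1)]) (rule eq)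
    then have "snd (state k \<gamma> t0) = 0" by (simp add: const)
    then show False using null null_vec_state[OF geo k(1) t(1) k(2)] by simp
  qed
  then show ?thesis unfolding null_vec_def V[OF t(2)] using 0 by simp
qed

text \<open>\<open>null_geodesic\<close> asks for a null velocity at every parameter;
  \<open>geodesic_null_everywhere\<close> reduces this to the initial one.\<close>

lemma null_geodesicI:
  assumes c: "c \<in> A" and ini: "initial c t0 (q, v) J \<gamma>" and "inextendible J \<gamma>"
    and "v \<noteq> 0" "metric_coeff A g c q v v = 0"
  shows "null_geodesic A g J \<gamma>"
proof -
  have geo: "geodesic A g J \<gamma>" and t0: "t0 \<in> J" "\<gamma> t0 \<in> fst c" and st: "state c \<gamma> t0 = (q, v)"
    using ini by (simp_all add: initial_def)
  have "snd c (\<gamma> t0) = q" using st by (simp add: state_def)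
  then have "null_vec g (\<gamma> t0) (velocity A \<gamma> J t0)"
    using null_vec_state[OF geo c t0] st assms(4,5) by simp
  then show ?thesis
    unfolding null_geodesic_eq using geo assms(3) geodesic_null_everywhere[OF geo t0(1)] by blast
qed

lemma null_geodesic_exists:
  assumes "c \<in> A" "p \<in> fst c" "v \<noteq> 0" "metric_coeff A g c (snd c p) v v = 0"
  obtains J \<gamma> where "null_geodesic A g J \<gamma>" "initial c 0 (snd c p, v) J \<gamma>"
proof -
  have "(snd c p, v) \<in> snd c ` fst c \<times> UNIV" using assms(2) by simp
  then obtain r e K \<Sigma> where r: "r > 0" "e > (0::real)"
    and S: "\<And>z. z \<in> cball (snd c p, v) r \<Longrightarrow> geodesic A g {-e<..<e} (\<Sigma> z)"
      "\<And>z t. z \<in> cball (snd c p, v) r \<Longrightarrow> \<bar>t\<bar> < e \<Longrightarrow> \<Sigma> z t \<in> fst c"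
      "\<And>z. z \<in> cball (snd c p, v) r \<Longrightarrow> state c (\<Sigma> z) 0 = z"
    by (rule local_family[OF assms(1)]) (rule that)
  have "initial c 0 (snd c p, v) {-e<..<e} (\<Sigma> (snd c p, v))"
    unfolding initial_def using S[of "(snd c p, v)"] S(2)[of "(snd c p, v)" 0] r by simp
  then obtain M \<mu> where "initial c 0 (snd c p, v) M \<mu>" "inextendible M \<mu>"
    by (rule maximal_geodesic[OF _ assms(1)])
  then show ?thesis using null_geodesicI[OF assms(1) _ _ assms(3,4)] that by blast
qed

lemma inextendible_affine:
  assumes geo: "geodesic A g J \<gamma>" and ext: "inextendible J \<gamma>" and m: "m \<noteq> 0"
  shows "inextendible {t. m * t + a \<in> J} (\<lambda>t. \<gamma> (m * t + a))"
  unfolding inextendible_def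
proof (rule notI, elim exE conjE)
  fix J' \<gamma>' assume *: "{t. m * t + a \<in> J} \<subset> J'" "geodesic A g J' \<gamma>'" "\<forall>t\<in>{t. m * t + a \<in> J}. \<gamma>' t = \<gamma> (m * t + a)"
  let ?J = "{t. (1/m) * t + (- a/m) \<in> J'}"
  have inv: "m * ((1/m) * t + (- a/m)) + a = t" for t using m by (simp add: field_simps)
  have inv': "(1/m) * (m * t + a) + (- a/m) = t" for t using m by (simp add: field_simps)
  have "geodesic A g ?J (\<lambda>t. \<gamma>' ((1/m) * t + (- a/m)))"
    by (rule geodesic_affine(1)[OF *(2)]) (use m in simp)
  moreover have "J \<subset> ?J"
  proof -
    obtain s where s: "s \<in> J'" "m * s + a \<notin> J" using *(1) by blast
    then have "m * s + a \<in> ?J" by (simp only: mem_Collect_eq inv')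
    moreover have "t \<in> ?J" if "t \<in> J" for t
    proof -
      have "(1/m) * t + (- a/m) \<in> {t. m * t + a \<in> J}" using that by (simp only: mem_Collect_eq inv)
      then show ?thesis using *(1) by blast
    qed
    ultimately show ?thesis using s(2) by blast
  qed
  moreover have "\<forall>t\<in>J. \<gamma>' ((1/m) * t + (- a/m)) = \<gamma> t"
  proof
    fix t assume "t \<in> J"
    then have "(1/m) * t + (- a/m) \<in> {t. m * t + a \<in> J}" by (simp only: mem_Collect_eq inv)
    then show "\<gamma>' ((1/m) * t + (- a/m)) = \<gamma> t" using *(3) by (simp only: inv)
  qed
  ultimately show False using ext unfolding inextendible_def by blast
qed

text \<open>Shifts the chosen parameter to 0 and rescales the velocity. With \<open>m = -1\<close>
  it exchanges the two half-cones without changing the image of the geodesic.\<close>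

lemma null_geodesic_reparametrize:
  assumes null: "null_geodesic A g J \<gamma>" and t: "t \<in> J" and c: "c \<in> A" "\<gamma> t \<in> fst c" and m: "m \<noteq> 0"
  obtains J' \<gamma>' where "null_geodesic A g J' \<gamma>'" "\<gamma>' ` J' = \<gamma> ` J"
    "initial c 0 (snd c (\<gamma> t), m *\<^sub>R snd (state c \<gamma> t)) J' \<gamma>'"
proof -
  have geo: "geodesic A g J \<gamma>" and ext: "inextendible J \<gamma>" and nv: "null_vec g (\<gamma> t) (velocity A \<gamma> J t)"
    using null t by (simp_all add: null_geodesic_eq)
  let ?J = "{s. m * s + t \<in> J}" and ?\<gamma> = "\<lambda>s. \<gamma> (m * s + t)"
  have ini: "initial c 0 (snd c (\<gamma> t), m *\<^sub>R snd (state c \<gamma> t)) ?J ?\<gamma>"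
    unfolding initial_def
    using geodesic_affine(1)[OF geo m, of t] geodesic_affine(2)[OF geo m c(1), of 0 t] t c by simp
  have q: "snd c (\<gamma> t) \<in> snd c ` fst c" using c(2) by blast
  have "null_geodesic A g ?J ?\<gamma>"
    by (rule null_geodesicI[OF c(1) ini inextendible_affine[OF geo ext m]])
       (use null_vec_state[OF geo c(1) t c(2)] nv m lorentz_coords.simps[OF coords[OF c(1)] q] in simp_all)
  moreover have "?\<gamma> ` ?J = \<gamma> ` J"
  proof
    show "\<gamma> ` J \<subseteq> ?\<gamma> ` ?J"
    proof
      fix p assume "p \<in> \<gamma> ` J"
      then obtain s where s: "s \<in> J" "p = \<gamma> s" by blast
      then show "p \<in> ?\<gamma> ` ?J" by (intro image_eqI[of _ _ "(s - t) / m"]) (use m in simp_all)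
    qed
  qed auto
  ultimately show ?thesis using that ini by blast
qed

end

section \<open>Lifting curves to a covering space\<close>

text \<open>The topological part of \<open>smooth_covering_map\<close>. The family of sheets is an
  argument because the proof compares the sheets entered by different curves.\<close>

definition evenly_covered :: "('b::topological_space \<Rightarrow> 'a::topological_space) \<Rightarrow> 'a set \<Rightarrow> 'b set set \<Rightarrow> bool" where
  "evenly_covered \<rho> U \<V> \<longleftrightarrow> open U \<and> \<Union>\<V> = \<rho> -` U \<and> (\<forall>V\<in>\<V>. open V) \<and> pairwise disjnt \<V> \<and>
     (\<forall>V\<in>\<V>. \<exists>q. homeomorphism V U \<rho> q)"

lemma sheet_unique:
  assumes "evenly_covered \<rho> U \<V>" "V \<in> \<V>" "W \<in> \<V>" "p \<in> V" "p \<in> W"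
  shows "V = W"
proof (rule ccontr)
  assume "V \<noteq> W"
  have "pairwise disjnt \<V>" using assms(1) by (simp add: evenly_covered_def)
  from pairwiseD[OF this assms(2,3) \<open>V \<noteq> W\<close>] show False using assms(4,5) by (auto simp: disjnt_iff)
qed

lemma sheet_at: "evenly_covered \<rho> U \<V> \<Longrightarrow> \<rho> p \<in> U \<Longrightarrow> \<exists>V\<in>\<V>. p \<in> V"
  by (simp add: evenly_covered_def Union_iff[symmetric] del: Union_iff)

lemma sheet_inj: "evenly_covered \<rho> U \<V> \<Longrightarrow> V \<in> \<V> \<Longrightarrow> p \<in> V \<Longrightarrow> p' \<in> V \<Longrightarrow> \<rho> p = \<rho> p' \<Longrightarrow> p = p'"
  unfolding evenly_covered_def homeomorphism_def by metis

lemma sheet_homeomorphism: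
  assumes "evenly_covered \<rho> U \<V>" "V \<in> \<V>"
  obtains q where "homeomorphism V U \<rho> q"
  using assms unfolding evenly_covered_def by blast

lemma sheet_open: "evenly_covered \<rho> U \<V> \<Longrightarrow> V \<in> \<V> \<Longrightarrow> open V"
  unfolding evenly_covered_def by blast

lemma sheet_image_open:
  assumes ev: "evenly_covered \<rho> U \<V>" and V: "V \<in> \<V>" and W: "open W" "W \<subseteq> V"
  shows "open (\<rho> ` W)"
proof -
  obtain q where q: "homeomorphism V U \<rho> q" by (rule sheet_homeomorphism[OF ev V])
  have "\<rho> ` W = U \<inter> q -` W"
  proof
    show "\<rho> ` W \<subseteq> U \<inter> q -` W" using q W(2) unfolding homeomorphism_def by auto
    show "U \<inter> q -` W \<subseteq> \<rho> ` W"
    proof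
      fix u assume "u \<in> U \<inter> q -` W"
      then show "u \<in> \<rho> ` W" using q unfolding homeomorphism_def by (intro image_eqI[of _ _ "q u"]) auto
    qed
  qed
  moreover have "open (U \<inter> q -` W)"
    by (rule continuous_open_preimage[OF _ _ W(1)]) (use q ev in \<open>auto simp: homeomorphism_def evenly_covered_def\<close>)
  ultimately show ?thesis by simp
qed

text \<open>\<open>V\<close> and the union of the other sheets are disjoint open sets that cover
  \<open>C\<close>.\<close>

lemma sheet_contains_connected:
  assumes ev: "evenly_covered \<rho> U \<V>" and V: "V \<in> \<V>" and C: "connected C" "C \<subseteq> \<rho> -` U" "C \<inter> V \<noteq> {}"
  shows "C \<subseteq> V"
proof (rule ccontr)
  assume "\<not> C \<subseteq> V"
  let ?W = "\<Union>(\<V> - {V})"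
  have un: "\<Union>\<V> = \<rho> -` U" using ev by (simp add: evenly_covered_def)
  have "open V" "open ?W" using ev V unfolding evenly_covered_def by auto
  moreover have sub: "C \<subseteq> V \<union> ?W" using C(2) un by blast
  moreover have "V \<inter> ?W \<inter> C = {}" using sheet_unique[OF ev V] by blast
  moreover have "?W \<inter> C \<noteq> {}" using sub \<open>\<not> C \<subseteq> V\<close> by blast
  ultimately show False using C(1,3) connectedD[of C V ?W] by blast
qed

text \<open>Needed to shrink an evenly covered neighbourhood to a causally convex one.\<close>

lemma evenly_covered_restrict:
  assumes ev: "evenly_covered \<rho> U \<V>" and U': "open U'" "U' \<subseteq> U" "open (\<rho> -` U')"
  shows "evenly_covered \<rho> U' ((\<lambda>V. V \<inter> \<rho> -` U') ` \<V>)"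
  unfolding evenly_covered_def
proof (intro conjI ballI)
  have un: "\<Union>\<V> = \<rho> -` U" using ev by (simp add: evenly_covered_def)
  have "\<Union> ((\<lambda>V. V \<inter> \<rho> -` U') ` \<V>) = \<Union>\<V> \<inter> \<rho> -` U'" by blast
  also have "\<dots> = \<rho> -` U'" unfolding un using U'(2) by blast
  finally show "\<Union> ((\<lambda>V. V \<inter> \<rho> -` U') ` \<V>) = \<rho> -` U'" .
  have disj: "pairwise disjnt \<V>" using ev by (simp add: evenly_covered_def)
  show "pairwise disjnt ((\<lambda>V. V \<inter> \<rho> -` U') ` \<V>)"
  proof (rule pairwiseI)
    fix X Y assume "X \<in> (\<lambda>V. V \<inter> \<rho> -` U') ` \<V>" "Y \<in> (\<lambda>V. V \<inter> \<rho> -` U') ` \<V>" "X \<noteq> Y"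
    then obtain V W where VW: "V \<in> \<V>" "W \<in> \<V>" "X = V \<inter> \<rho> -` U'" "Y = W \<inter> \<rho> -` U'" "V \<noteq> W" by blast
    then show "disjnt X Y" using pairwiseD[OF disj VW(1,2,5)] by (auto simp: disjnt_iff)
  qed
  fix X assume "X \<in> (\<lambda>V. V \<inter> \<rho> -` U') ` \<V>"
  then obtain V where V: "V \<in> \<V>" "X = V \<inter> \<rho> -` U'" by blast
  show "open X" unfolding V(2) using sheet_open[OF ev V(1)] U'(3) by (rule open_Int)
  obtain q where q: "homeomorphism V U \<rho> q" by (rule sheet_homeomorphism[OF ev V(1)])
  have "\<rho> ` X = U'"
  proof
    show "U' \<subseteq> \<rho> ` X"
    proof
      fix u assume u: "u \<in> U'"
      then have "u \<in> U" using U'(2) by blast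
      then have "q u \<in> V" "\<rho> (q u) = u" using q unfolding homeomorphism_def by blast+
      then show "u \<in> \<rho> ` X" unfolding V(2) using u by (intro image_eqI[of _ _ "q u"]) auto
    qed
  qed (auto simp: V(2))
  then have "homeomorphism X U' \<rho> q"
    by (rule homeomorphism_of_subsets[OF q _ U'(2), rotated]) (auto simp: V(2))
  then show "\<exists>q. homeomorphism X U' \<rho> q" by blast
qed (fact U'(1))

section \<open>Uniqueness and existence of lifts\<close>

lemma lift_unique:
  assumes cov: "\<And>x. \<exists>U \<V>. x \<in> U \<and> evenly_covered \<rho> U \<V>"
    and S: "connected S" "continuous_on S \<alpha>" "continuous_on S \<beta>"
    and eq: "\<And>t. t \<in> S \<Longrightarrow> \<rho> (\<alpha> t) = \<rho> (\<beta> t)" and s: "s \<in> S" "\<alpha> s = \<beta> s" and t: "t \<in> S"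
  shows "\<alpha> t = \<beta> t"
proof (rule connected_induction_simple[where P = "\<lambda>t. \<alpha> t = \<beta> t", OF S(1) s(1) t s(2)])
  fix a assume a: "a \<in> S"
  obtain U \<V> where U: "\<rho> (\<alpha> a) \<in> U" "evenly_covered \<rho> U \<V>" using cov by blast
  obtain V where V: "V \<in> \<V>" "\<alpha> a \<in> V" using sheet_at[OF U(2,1)] by blast
  have "\<rho> (\<beta> a) \<in> U" using U(1) eq[OF a] by simp
  then obtain W where W: "W \<in> \<V>" "\<beta> a \<in> W" using sheet_at[OF U(2)] by blast
  let ?T = "(S \<inter> \<alpha> -` V) \<inter> (S \<inter> \<beta> -` W)"
  have "openin (top_of_set S) ?T"
    by (intro openin_Int continuous_openin_preimage_gen S(2,3) sheet_open[OF U(2)] V(1) W(1))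
  moreover have "a \<in> ?T" using a V W by simp
  moreover have "\<alpha> y = \<beta> y" if x: "x \<in> ?T" and y: "y \<in> ?T" and "\<alpha> x = \<beta> x" for x y
  proof -
    have "V = W" using sheet_unique[OF U(2) V(1) W(1), of "\<alpha> x"] x \<open>\<alpha> x = \<beta> x\<close> by simp
    then show ?thesis using sheet_inj[OF U(2) V(1), of "\<alpha> y" "\<beta> y"] y eq[of y] by simp
  qed
  ultimately show "\<exists>T. openin (top_of_set S) T \<and> a \<in> T \<and> (\<forall>x\<in>T. \<forall>y\<in>T. \<alpha> x = \<beta> x \<longrightarrow> \<alpha> y = \<beta> y)"
    by blast
qed

text \<open>The domain is an open interval, so no finite subdivision is available. Instead, being
  reached by a partial lift is propagated along \<open>J\<close>; by uniqueness all partial lifts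
  through \<open>p\<close> agree on common parameters, and \<open>G\<close> is their union.\<close>

lemma lift_exists:
  fixes \<sigma> :: "real \<Rightarrow> 'a::topological_space" and \<rho> :: "'b::topological_space \<Rightarrow> 'a"
  assumes cov: "\<And>x. \<exists>U \<V>. x \<in> U \<and> evenly_covered \<rho> U \<V>"
    and J: "is_interval J" "open J" "continuous_on J \<sigma>" and t0: "t0 \<in> J" "\<rho> p = \<sigma> t0"
  obtains \<gamma> where "continuous_on J \<gamma>" "\<And>t. t \<in> J \<Longrightarrow> \<rho> (\<gamma> t) = \<sigma> t" "\<gamma> t0 = p"
proof -
  define L where "L K \<gamma> \<longleftrightarrow> is_interval K \<and> open K \<and> K \<subseteq> J \<and> t0 \<in> K \<and> continuous_on K \<gamma> \<and>
    (\<forall>t\<in>K. \<rho> (\<gamma> t) = \<sigma> t) \<and> \<gamma> t0 = p" for K \<gamma>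
  define P where "P t \<longleftrightarrow> (\<exists>K \<gamma>. L K \<gamma> \<and> t \<in> K)" for t
  \<comment> \<open>A partial lift that reaches \<open>x\<close> in the ball is continued by the
    inverse of \<open>\<rho>\<close> on the sheet containing its value at \<open>x\<close>;
    uniqueness makes the two agree on the overlap.\<close>
  have step: "P y" if U: "evenly_covered \<rho> U \<V>" and d: "ball a d \<subseteq> J" "\<sigma> ` ball a d \<subseteq> U"
    and x: "x \<in> ball a d" "x \<in> K" and K: "L K \<gamma>" and y: "y \<in> ball a d" for U \<V> a d x y K \<gamma>
  proof -
    have K': "is_interval K" "open K" "K \<subseteq> J" "t0 \<in> K" "continuous_on K \<gamma>" "\<gamma> t0 = p"
      and lift: "\<And>t. t \<in> K \<Longrightarrow> \<rho> (\<gamma> t) = \<sigma> t"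
      using K by (auto simp: L_def)
    have "\<rho> (\<gamma> x) \<in> U" using lift[OF x(2)] x(1) d(2) by auto
    then obtain V where V: "V \<in> \<V>" "\<gamma> x \<in> V" using sheet_at[OF U] by blast
    obtain q where q: "homeomorphism V U \<rho> q" by (rule sheet_homeomorphism[OF U V(1)])
    have q1: "\<rho> (q z) = z" "q z \<in> V" if "z \<in> U" for z using q that unfolding homeomorphism_def by blast+
    have q2: "q (\<rho> (\<gamma> x)) = \<gamma> x" using q V(2) unfolding homeomorphism_def by blast
    have contq: "continuous_on (ball a d) (\<lambda>t. q (\<sigma> t))"
      by (rule continuous_on_compose2[of U q]) (use q d continuous_on_subset[OF J(3)] in \<open>auto simp: homeomorphism_def\<close>)
    have agree: "\<gamma> t = q (\<sigma> t)" if t: "t \<in> K \<inter> ball a d" for t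
    proof (rule lift_unique[where S = "K \<inter> ball a d" and \<rho> = \<rho> and s = x, OF cov _ _ _ _ _ _ t])
      show "connected (K \<inter> ball a d)"
        using K'(1) by (auto simp: is_interval_connected_1[symmetric] is_interval_convex_1 convex_Int)
      show "continuous_on (K \<inter> ball a d) \<gamma>" by (rule continuous_on_subset[OF K'(5)]) blast
      show "continuous_on (K \<inter> ball a d) (\<lambda>t. q (\<sigma> t))" by (rule continuous_on_subset[OF contq]) blast
      show "\<rho> (\<gamma> t) = \<rho> (q (\<sigma> t))" if "t \<in> K \<inter> ball a d" for t
      proof -
        have "\<sigma> t \<in> U" using d(2) that by blast
        then show ?thesis using lift[of t] q1(1)[of "\<sigma> t"] that by simp
      qed
      show "\<gamma> x = q (\<sigma> x)" using q2 lift[OF x(2)] by simp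
    qed (use x in blast)
    let ?f = "\<lambda>t. if t \<in> K then \<gamma> t else q (\<sigma> t)"
    have "L (K \<union> ball a d) ?f"
      unfolding L_def
    proof (intro conjI ballI)
      have "connected (K \<union> ball a d)"
        by (rule connected_Un) (use K'(1) x in \<open>auto simp: is_interval_connected_1[symmetric] is_interval_convex_1\<close>)
      then show "is_interval (K \<union> ball a d)" by (simp add: is_interval_connected_1)
      have "continuous_on K ?f" using K'(5) by (simp cong: continuous_on_cong)
      moreover have "continuous_on (ball a d) ?f"
        using contq agree by (subst continuous_on_cong[OF refl, of _ _ "\<lambda>t. q (\<sigma> t)"]) auto
      ultimately show "continuous_on (K \<union> ball a d) ?f" by (rule continuous_on_open_Un[OF K'(2) open_ball])
      show "\<rho> (?f t) = \<sigma> t" if "t \<in> K \<union> ball a d" for t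
      proof (cases "t \<in> K")
        case False
        then have "\<sigma> t \<in> U" using that d(2) by blast
        then show ?thesis using False q1(1)[of "\<sigma> t"] by simp
      qed (use lift in simp)
    qed (use K' d in auto)
    then show "P y" unfolding P_def using y by blast
  qed
  have near: "\<exists>d>0. ball a d \<subseteq> J \<and> (\<exists>U \<V>. evenly_covered \<rho> U \<V> \<and> \<sigma> ` ball a d \<subseteq> U)" if a: "a \<in> J" for a
  proof -
    obtain U \<V> where U: "\<sigma> a \<in> U" "evenly_covered \<rho> U \<V>" using cov by blast
    have "open (J \<inter> \<sigma> -` U)"
      by (rule continuous_open_preimage[OF J(3,2)]) (use U(2) in \<open>simp add: evenly_covered_def\<close>)
    then obtain d where "d > 0" "ball a d \<subseteq> J \<inter> \<sigma> -` U" using a U(1) openE by blast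
    then show ?thesis using U(2) by blast
  qed
  have "P t" if t: "t \<in> J" for t
  proof (rule connected_induction_ball[where P = P, OF _ t0(1) t])
    show "connected J" using J(1) by (simp add: is_interval_connected_1)
    obtain d U \<V> where d: "d > 0" "ball t0 d \<subseteq> J" "evenly_covered \<rho> U \<V>" "\<sigma> ` ball t0 d \<subseteq> U"
      using near[OF t0(1)] by blast
    have "\<rho> p \<in> U" using d(1,4) t0(2) by auto
    then obtain V where V: "V \<in> \<V>" "p \<in> V" using sheet_at[OF d(3)] by blast
    obtain q where q: "homeomorphism V U \<rho> q" by (rule sheet_homeomorphism[OF d(3) V(1)])
    have "continuous_on (ball t0 d) (\<lambda>t. q (\<sigma> t))"
      by (rule continuous_on_compose2[of U q]) (use q d continuous_on_subset[OF J(3)] in \<open>auto simp: homeomorphism_def\<close>)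
    moreover have "\<rho> (q (\<sigma> t)) = \<sigma> t" if "t \<in> ball t0 d" for t
    proof -
      have "\<sigma> t \<in> U" using d(4) that by blast
      then show ?thesis using q unfolding homeomorphism_def by blast
    qed
    moreover have "q (\<sigma> t0) = p" using q V(2) t0(2) unfolding homeomorphism_def by metis
    ultimately have "L (ball t0 d) (\<lambda>t. q (\<sigma> t))"
      unfolding L_def using d by (auto simp: is_interval_convex_1)
    then show "P t0" unfolding P_def using d(1) by (intro exI conjI) auto
    fix a assume a: "a \<in> J"
    obtain d U \<V> where d: "d > 0" "ball a d \<subseteq> J" "evenly_covered \<rho> U \<V>" "\<sigma> ` ball a d \<subseteq> U"
      using near[OF a] by blast
    have PP: "P y" if x: "x \<in> ball a d" and y: "y \<in> ball a d" and "P x" for x y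
    proof -
      obtain K \<gamma> where K: "L K \<gamma>" "x \<in> K" using \<open>P x\<close> unfolding P_def by (elim exE conjE)
      show "P y" by (rule step[OF d(3,2,4) x K(2,1) y])
    qed
    show "\<exists>d>0. ball a d \<subseteq> J \<and> (\<forall>x\<in>ball a d. \<forall>y\<in>ball a d. P x \<longrightarrow> P y)"
      by (intro exI[of _ d] conjI ballI impI d(1,2)) (rule PP)
  qed
  note P = this
  define G where "G t = (SOME r. \<exists>K \<gamma>. L K \<gamma> \<and> t \<in> K \<and> r = \<gamma> t)" for t
  have G: "G t = \<gamma> t" if K: "L K \<gamma>" and t: "t \<in> K" for K \<gamma> t
  proof -
    have "\<exists>r. \<exists>K \<gamma>. L K \<gamma> \<and> t \<in> K \<and> r = \<gamma> t" using K t by (intro exI conjI) auto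
    from someI_ex[OF this] have "\<exists>K \<gamma>. L K \<gamma> \<and> t \<in> K \<and> G t = \<gamma> t" unfolding G_def .
    then obtain K' \<gamma>' where K': "L K' \<gamma>'" "t \<in> K'" "G t = \<gamma>' t" by (elim exE conjE)
    have "\<gamma>' t = \<gamma> t"
    proof (rule lift_unique[where S = "K' \<inter> K" and \<rho> = \<rho> and s = t0, OF cov])
      show "connected (K' \<inter> K)"
        using K K'(1) by (auto simp: L_def is_interval_connected_1[symmetric] is_interval_Int)
      show "continuous_on (K' \<inter> K) \<gamma>'" "continuous_on (K' \<inter> K) \<gamma>"
        using K K'(1) continuous_on_subset unfolding L_def by blast+
    qed (use K K' t in \<open>auto simp: L_def\<close>)
    then show ?thesis using K'(3) by simp
  qed
  show ?thesis
  proof (rule that)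
    show "continuous_on J G"
    proof (rule continuous_at_imp_continuous_on, intro ballI)
      fix t assume "t \<in> J"
      then obtain K \<gamma> where K: "L K \<gamma>" "t \<in> K" using P unfolding P_def by blast
      have "continuous_on K G" using G[OF K(1)] K(1) by (simp add: L_def cong: continuous_on_cong)
      then show "isCont G t" using K by (simp add: L_def continuous_on_eq_continuous_at)
    qed
    show "\<rho> (G t) = \<sigma> t" if t: "t \<in> J" for t
    proof -
      obtain K \<gamma> where K: "L K \<gamma>" "t \<in> K" using P[OF t] unfolding P_def by blast
      then show ?thesis using G[OF K] by (simp add: L_def)
    qed
    obtain K \<gamma> where K: "L K \<gamma>" "t0 \<in> K" using P[OF t0(1)] unfolding P_def by blast
    then show "G t0 = p" using G[OF K] by (simp add: L_def)
  qed
qed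

section \<open>Lorentz coverings\<close>

text \<open>The diagonalizing basis is carried over by the inverse \<open>M\<close>.\<close>

lemma lorentz_form_linear_image:
  fixes G :: "'e::euclidean_space \<Rightarrow> 'e \<Rightarrow> real"
  assumes G: "lorentz_form G" and L: "linear L" and inv: "\<And>u. M (L u) = u" "\<And>u. L (M u) = u"
  shows "lorentz_form (\<lambda>u v. G (L u) (L v))"
proof -
  have M: "linear M"
  proof (rule linearI)
    show "M (u + v) = M u + M v" for u v
      using inv by (metis linear_add[OF L])
    show "M (k *\<^sub>R u) = k *\<^sub>R M u" for k u
      using inv by (metis linear_cmul[OF L])
  qed
  have injM: "inj M" using inv(2) by (rule inj_on_inverseI)
  have surjM: "surj M" using inv(1) by (rule surjI)
  have bil: "bilinear (\<lambda>u v. G (L u) (L v))"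
    unfolding bilinear_def
    by (intro conjI allI linearI)
       (simp_all add: linear_add[OF L] linear_cmul[OF L] lorentz_form_simps[OF G])
  obtain b0 B where bB: "b0 \<notin> B \<and> independent (insert b0 B) \<and> span (insert b0 B) = UNIV \<and>
      G b0 b0 < 0 \<and> (\<forall>b\<in>B. G b b > 0) \<and> (\<forall>b\<in>B. G b0 b = 0) \<and>
      (\<forall>b\<in>B. \<forall>b'\<in>B. b \<noteq> b' \<longrightarrow> G b b' = 0)"
    using conjunct2[OF conjunct2[OF G[unfolded lorentz_form_def]]] by (elim exE)
  have img: "insert (M b0) (M ` B) = M ` insert b0 B" by simp
  have "M b0 \<notin> M ` B" using bB injM by (auto dest: injD)
  moreover have "independent (insert (M b0) (M ` B))"
    unfolding img using bB by (intro linear_independent_injective_image M inj_on_subset[OF injM subset_UNIV]) simp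
  moreover have "span (insert (M b0) (M ` B)) = UNIV"
    unfolding img linear_span_image[OF M] using bB surjM by simp
  ultimately show ?thesis
    unfolding lorentz_form_def
    using bil lorentz_form_sym[OF G] bB
    by (intro conjI exI[of _ "M b0"] exI[of _ "M ` B"]) (auto simp: inv)
qed

lemma chris_cong_open:
  assumes "open S" "q \<in> S" "\<And>q u v. q \<in> S \<Longrightarrow> G1 q u v = G2 q u v"
  shows "chris G1 q = chris G2 q"
proof -
  have "metric_deriv G1 q a u v = metric_deriv G2 q a u v" for a u v
    unfolding metric_deriv_def using frechet_derivative_cong_open[OF assms(1,2), of "\<lambda>q. G1 q u v" "\<lambda>q. G2 q u v"] assms(3) by simp
  then show ?thesis unfolding chris_def using assms(2,3) by simp
qed

locale lorentz_cover = down: lorentz_manifold A g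
  for A :: "('a::{t2_space, second_countable_topology}, 'e::euclidean_space) chart set" and g +
  fixes T :: "'a \<Rightarrow> ('a, 'e) tvec"
    and A' :: "('b::{t2_space, second_countable_topology}, 'e) chart set"
    and g' :: "('b, 'e) metric" and T' :: "'b \<Rightarrow> ('b, 'e) tvec" and \<rho> :: "'b \<Rightarrow> 'a"
  assumes field: "smooth_vector_field A T" and timelike: "\<And>p. g p (T p) (T p) < 0"
    and cover: "lorentz_covering A' g' T' A g T \<rho>"
begin

sublocale top: manifold A'
  by unfold_locales (use cover in \<open>simp add: lorentz_covering_def\<close>)

lemma covering: "smooth_covering_map A' A \<rho>"
  using cover unfolding lorentz_covering_def by blast

lemma continuous_covering: "continuous_on S \<rho>"
  using covering continuous_on_subset[of UNIV \<rho> S] unfolding smooth_covering_map_def smooth_map_on_def by blast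

lemma open_preimage: "open U \<Longrightarrow> open (\<rho> -` U)"
  using continuous_open_preimage[OF continuous_covering open_UNIV, of U] by simp

lemma surj_covering: "surj \<rho>"
  using covering unfolding smooth_covering_map_def by blast

lemma smooth_sheets_at:
  obtains U \<V> where "open U" "x \<in> U" "\<Union>\<V> = \<rho> -` U" "\<forall>V\<in>\<V>. open V" "pairwise disjnt \<V>"
    "\<And>V. V \<in> \<V> \<Longrightarrow> \<exists>q. homeomorphism V U \<rho> q \<and> smooth_map_on A' A V \<rho> \<and> smooth_map_on A A' U q"
proof -
  obtain U \<V> where *: "open U \<and> x \<in> U \<and> \<Union>\<V> = \<rho> -` U \<and> (\<forall>V\<in>\<V>. open V) \<and> pairwise disjnt \<V> \<and>
        (\<forall>V\<in>\<V>. \<exists>q. homeomorphism V U \<rho> q \<and> smooth_map_on A' A V \<rho> \<and> smooth_map_on A A' U q)"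
    using covering unfolding smooth_covering_map_def by metis
  note 2 = conjunct2[OF *] note 3 = conjunct2[OF 2] note 4 = conjunct2[OF 3] note 5 = conjunct2[OF 4]
  show ?thesis
    by (rule that[OF conjunct1[OF *] conjunct1[OF 2] conjunct1[OF 3] conjunct1[OF 4] conjunct1[OF 5]
          bspec[OF conjunct2[OF 5]]])
qed

lemma evenly_covered_at: "\<exists>U \<V>. x \<in> U \<and> evenly_covered \<rho> U \<V>"
proof -
  obtain U \<V> where U: "open U" "x \<in> U" "\<Union>\<V> = \<rho> -` U" "\<forall>V\<in>\<V>. open V" "pairwise disjnt \<V>"
    and h: "\<And>V. V \<in> \<V> \<Longrightarrow> \<exists>q. homeomorphism V U \<rho> q \<and> smooth_map_on A' A V \<rho> \<and> smooth_map_on A A' U q"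
    by (rule smooth_sheets_at[of x]) (rule that)
  have "\<exists>q. homeomorphism V U \<rho> q" if "V \<in> \<V>" for V
    using h[OF that] by (elim exE conjE) (rule exI)
  then show ?thesis
    unfolding evenly_covered_def using U by (intro exI[of _ U] exI[of _ \<V>] conjI ballI) simp_all
qed

text \<open>In an adapted chart upstairs, \<open>\<rho>\<close> is the identity in coordinates.\<close>

definition adapted :: "('b, 'e) chart \<Rightarrow> ('a, 'e) chart \<Rightarrow> bool" where
  "adapted c d \<longleftrightarrow> c \<in> A' \<and> d \<in> A \<and> (\<forall>p\<in>fst c. \<rho> p \<in> fst d) \<and> snd c = snd d \<circ> \<rho>"

text \<open>The chart \<open>d\<close> is read through \<open>\<rho>\<close> on one sheet. The
  result is compatible with \<open>A'\<close> because both \<open>\<rho>\<close> and the local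
  section \<open>q\<close> are smooth, and it belongs to \<open>A'\<close> by maximality of the
  atlas.\<close>

lemma adapted_chart:
  assumes d: "d \<in> A" "\<rho> p \<in> fst d"
  obtains c where "adapted c d" "p \<in> fst c"
proof -
  obtain U \<V> where oU: "open U" "\<rho> p \<in> U" "\<Union>\<V> = \<rho> -` U" "\<forall>V\<in>\<V>. open V" "pairwise disjnt \<V>"
    and h: "\<And>V. V \<in> \<V> \<Longrightarrow> \<exists>q. homeomorphism V U \<rho> q \<and> smooth_map_on A' A V \<rho> \<and> smooth_map_on A A' U q"
    by (rule smooth_sheets_at[of "\<rho> p"]) (rule that)
  have "p \<in> \<Union>\<V>" unfolding oU(3) using oU(2) by simp
  then obtain V where V: "V \<in> \<V>" "p \<in> V" by (rule UnionE) (rule that)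
  obtain q where q: "homeomorphism V U \<rho> q" "smooth_map_on A' A V \<rho>" "smooth_map_on A A' U q"
    using h[OF V(1)] by (elim exE conjE)
  have oV: "open V" "open U" using oU(1) bspec[OF oU(4) V(1)] by simp_all
  have qr: "\<And>x. x \<in> V \<Longrightarrow> q (\<rho> x) = x \<and> \<rho> x \<in> U" "\<And>y. y \<in> U \<Longrightarrow> \<rho> (q y) = y \<and> q y \<in> V" "continuous_on U q"
    using q(1) unfolding homeomorphism_def by blast+
  let ?D = "V \<inter> \<rho> -` fst d"
  let ?c = "(?D, snd d \<circ> \<rho>)"
  have oD: "open ?D" using oV(1) open_preimage[OF down.chart_continuous(3)[OF d(1)]] by blast
  have img: "(snd d \<circ> \<rho>) ` (?D \<inter> S) = snd d ` (fst d \<inter> (U \<inter> q -` S))" for S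
  proof
    show "(snd d \<circ> \<rho>) ` (?D \<inter> S) \<subseteq> snd d ` (fst d \<inter> (U \<inter> q -` S))" using qr(1) by fastforce
    show "snd d ` (fst d \<inter> (U \<inter> q -` S)) \<subseteq> (snd d \<circ> \<rho>) ` (?D \<inter> S)"
    proof
      fix y assume "y \<in> snd d ` (fst d \<inter> (U \<inter> q -` S))"
      then obtain r where r: "r \<in> fst d" "r \<in> U" "q r \<in> S" "y = snd d r" by blast
      then show "y \<in> (snd d \<circ> \<rho>) ` (?D \<inter> S)" using qr(2)[of r] by (intro image_eqI[of _ _ "q r"]) auto
    qed
  qed
  have img': "(snd d \<circ> \<rho>) ` ?D = snd d ` (fst d \<inter> U)" using img[of UNIV] by simp
  have inj: "inj_on (snd d \<circ> \<rho>) ?D"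
  proof (rule inj_onI)
    fix x y assume "x \<in> ?D" "y \<in> ?D" "(snd d \<circ> \<rho>) x = (snd d \<circ> \<rho>) y"
    then have "\<rho> x = \<rho> y" using down.chart_inj[OF d(1), of "\<rho> x" "\<rho> y"] by simp
    then show "x = y" using qr(1) \<open>x \<in> ?D\<close> \<open>y \<in> ?D\<close> by (metis IntD1)
  qed
  have inv: "chart_inv ?c y = q (chart_inv d y)" if y: "y \<in> snd d ` (fst d \<inter> U)" for y
  proof -
    obtain r where r: "r \<in> fst d" "r \<in> U" "y = snd d r" using y by blast
    have "(snd d \<circ> \<rho>) (q r) = y" "q r \<in> ?D" using qr(2)[OF r(2)] r by auto
    then have "chart_inv ?c y = q r" using inv_into_f_eq[OF inj, of "q r" y] by simp
    then show ?thesis using r d by simp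
  qed
  have "is_chart ?c"
    unfolding is_chart_def fst_conv snd_conv
  proof (intro conjI)
    show "open ?D" by (rule oD)
    show "open ((snd d \<circ> \<rho>) ` ?D)" unfolding img' by (rule down.chart_open_image[OF d(1) oV(2)])
    have "continuous_on (snd d ` (fst d \<inter> U)) (\<lambda>y. q (chart_inv d y))"
      by (rule continuous_on_compose2[OF qr(3) continuous_on_subset[OF down.chart_continuous(2)[OF d(1)]]])
         (use d in auto)
    then have c2: "continuous_on ((snd d \<circ> \<rho>) ` ?D) (inv_into ?D (snd d \<circ> \<rho>))"
      unfolding img' using inv by (simp cong: continuous_on_cong)
    have c1: "continuous_on ?D (snd d \<circ> \<rho>)"
      by (rule continuous_on_compose[OF continuous_covering continuous_on_subset[OF down.chart_continuous(1)[OF d(1)]]]) auto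
    show "homeomorphism ?D ((snd d \<circ> \<rho>) ` ?D) (snd d \<circ> \<rho>) (inv_into ?D (snd d \<circ> \<rho>))"
      unfolding homeomorphism_def using c1 c2 inj by (auto simp del: o_apply simp: inv_into_image_cancel[OF inj subset_refl] f_inv_into_f)
  qed
  moreover have "smoothly_compatible ?c e" if e: "e \<in> A'" for e
    unfolding smoothly_compatible_def
  proof
    have 1: "smooth_on (snd d ` (fst d \<inter> U \<inter> q -` fst e)) (snd e \<circ> q \<circ> chart_inv d)"
      using q(3) d(1) e unfolding smooth_map_on_def by blast
    have "(snd e \<circ> chart_inv ?c) y = (snd e \<circ> q \<circ> chart_inv d) y" if "y \<in> snd d ` (fst d \<inter> U \<inter> q -` fst e)" for y
      using inv[of y] that by auto
    then have "smooth_on (snd d ` (fst d \<inter> U \<inter> q -` fst e)) (snd e \<circ> chart_inv ?c)"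
      using 1 by (subst smooth_on_cong)
    moreover have "snd ?c ` (fst ?c \<inter> fst e) = snd d ` (fst d \<inter> U \<inter> q -` fst e)"
      unfolding fst_conv snd_conv img by (simp only: Int_assoc)
    ultimately show "smooth_on (snd ?c ` (fst ?c \<inter> fst e)) (snd e \<circ> chart_inv ?c)" by (simp only:)
    have "smooth_on (snd e ` (fst e \<inter> V \<inter> \<rho> -` fst d)) (snd d \<circ> \<rho> \<circ> chart_inv e)"
      using q(2) d(1) e unfolding smooth_map_on_def by blast
    moreover have "?D \<inter> fst e = fst e \<inter> V \<inter> \<rho> -` fst d" by blast
    ultimately show "smooth_on (snd e ` (fst ?c \<inter> fst e)) (snd ?c \<circ> chart_inv e)" by simp
  qed
  ultimately have "?c \<in> A'" using top.atlas unfolding smooth_structure_def by blast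
  then have "adapted ?c d" using d(1) by (auto simp: adapted_def)
  then show ?thesis using that[of ?c] V(2) d(2) by simp
qed

lemma adapted_at:
  obtains c d where "adapted c d" "p \<in> fst c" "\<rho> p \<in> fst d" "c \<in> A'" "d \<in> A"
proof -
  obtain d where d: "d \<in> A" "\<rho> p \<in> fst d" by (rule down.chart_at)
  obtain c where c: "adapted c d" "p \<in> fst c" by (rule adapted_chart[OF d])
  then show ?thesis by (intro that[OF c d(2) _ d(1)]) (simp add: adapted_def)
qed

lemma adaptedD:
  assumes "adapted c d"
  shows "c \<in> A'" "d \<in> A" "p \<in> fst c \<Longrightarrow> \<rho> p \<in> fst d" "snd c p = snd d (\<rho> p)" "snd d \<circ> (\<rho> \<circ> \<gamma>) = snd c \<circ> \<gamma>"
  using assms by (auto simp: adapted_def o_assoc)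

text \<open>\<open>differential\<close> is computed in an arbitrarily chosen chart \<open>k\<close>;
  the chain rule through \<open>c\<close> removes this choice.\<close>

lemma differential_adapted:
  assumes ad: "adapted c d" and p: "p \<in> fst c" and v: "v \<in> tangent_space A' p"
  shows "differential A' A \<rho> p v = coord_vec A d (\<rho> p) (v c)"
proof -
  note c = adaptedD(1)[OF ad] and d = adaptedD(2)[OF ad]
  define k where "k = (SOME k. k \<in> A' \<and> p \<in> fst k)"
  have "k \<in> A' \<and> p \<in> fst k" unfolding k_def by (rule someI[of _ c]) (use c p in simp)
  then have k: "k \<in> A'" "p \<in> fst k" by auto
  have pd: "\<rho> p \<in> fst d" using adaptedD(3)[OF ad p] .
  have "frechet_derivative (snd e \<circ> \<rho> \<circ> chart_inv k) (at (snd k p)) (v k) = dtransition d e (\<rho> p) (v c)"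
    if e: "e \<in> A" "\<rho> p \<in> fst e" for e
  proof -
    let ?S = "snd k ` (fst k \<inter> (fst c \<inter> \<rho> -` fst e))"
    have S: "open ?S" "snd k p \<in> ?S"
      using top.chart_open_image[OF k(1), of "fst c \<inter> \<rho> -` fst e"] top.chart_continuous(3)[OF c]
        open_preimage[OF down.chart_continuous(3)[OF e(1)]] k p e by auto
    have "((\<lambda>q. transition d e (transition k c q)) has_derivative
        (\<lambda>u. dtransition d e (\<rho> p) (dtransition k c p u))) (at (snd k p))"
    proof (rule has_derivative_compose[OF top.transition_has_derivative[OF k(1) c k(2) p]])
      have "transition k c (snd k p) = snd d (\<rho> p)" using k adaptedD(4)[OF ad] by simp
      then show "(transition d e has_derivative dtransition d e (\<rho> p)) (at (transition k c (snd k p)))"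
        using down.transition_has_derivative[OF d e(1) pd e(2)] by simp
    qed
    then have "((snd e \<circ> \<rho> \<circ> chart_inv k) has_derivative
        (\<lambda>u. dtransition d e (\<rho> p) (dtransition k c p u))) (at (snd k p))"
    proof (rule has_derivative_transform_within_open[OF _ S])
      fix y assume "y \<in> ?S"
      then obtain r where r: "r \<in> fst k" "r \<in> fst c" "\<rho> r \<in> fst e" "y = snd k r" by blast
      have "transition k c y = snd d (\<rho> r)" using r k(1) adaptedD(4)[OF ad] by simp
      then show "transition d e (transition k c y) = (snd e \<circ> \<rho> \<circ> chart_inv k) y"
        using r k(1) d adaptedD(3)[OF ad r(2)] by simp
    qed
    then have "frechet_derivative (snd e \<circ> \<rho> \<circ> chart_inv k) (at (snd k p)) =
        (\<lambda>u. dtransition d e (\<rho> p) (dtransition k c p u))"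
      by (rule frechet_derivative_at[symmetric])
    then show ?thesis using top.tangent_transition[OF v k(1) c k(2) p] by simp
  qed
  then show ?thesis
    unfolding differential_def k_def[symmetric] Let_def down.coord_vec_eq by (intro ext) simp
qed

section \<open>The pulled-back space-time structure\<close>

lemma metric_pullback:
  assumes "v \<in> tangent_space A' p" "w \<in> tangent_space A' p"
  shows "g' p v w = g (\<rho> p) (differential A' A \<rho> p v) (differential A' A \<rho> p w)"
  using cover assms unfolding lorentz_covering_def by blast

lemma metric_coeff_adapted:
  assumes ad: "adapted c d" and q: "q \<in> snd c ` fst c"
  shows "metric_coeff A' g' c q u v = metric_coeff A g d q u v"
proof -
  obtain p where p: "p \<in> fst c" "q = snd c p" using q by blast
  note c = adaptedD(1)[OF ad] and d = adaptedD(2)[OF ad] and pd = adaptedD(3)[OF ad p(1)]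
  have "metric_coeff A' g' c q u v = g' p (coord_vec A' c p u) (coord_vec A' c p v)"
    unfolding p(2) by (rule top.metric_coeff_eq[OF c p(1)])
  also have "\<dots> = g (\<rho> p) (coord_vec A d (\<rho> p) u) (coord_vec A d (\<rho> p) v)"
    using c p(1) by (simp add: metric_pullback top.coord_vec_tangent differential_adapted[OF ad p(1)])
  also have "\<dots> = metric_coeff A g d q u v"
    unfolding p(2) adaptedD(4)[OF ad] by (rule down.metric_coeff_eq[OF d pd, symmetric])
  finally show ?thesis .
qed

lemma adapted_image: "adapted c d \<Longrightarrow> snd c ` fst c \<subseteq> snd d ` fst d"
  unfolding adapted_def by auto

text \<open>The condition concerns all charts of \<open>A'\<close>, not only adapted ones. Near each
  point the coefficients are those of an adapted chart, hence of a chart below, transformed by a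
  chart change.\<close>

lemma lorentz_metric_cover: "lorentz_metric A' g'"
  unfolding lorentz_metric_def
proof (intro ballI conjI allI)
  fix c q assume c: "c \<in> A'" and "q \<in> snd c ` fst c"
  then obtain p where p: "p \<in> fst c" "q = snd c p" by blast
  obtain k d where k: "adapted k d" "p \<in> fst k" "\<rho> p \<in> fst d" "k \<in> A'" "d \<in> A" by (rule adapted_at)
  have q: "snd k p \<in> snd k ` fst k" using k(2) by blast
  have "lorentz_form (metric_coeff A g d (snd k p))"
    by (rule lorentz_coords.form[OF down.coords[OF k(5)]]) (use q adapted_image[OF k(1)] in blast)
  then have "lorentz_form (\<lambda>u v. metric_coeff A g d (snd k p) (dtransition c k p u) (dtransition c k p v))"
    by (rule lorentz_form_linear_image[OF _ top.dtransition_linear[OF c k(4) p(1) k(2)]])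
       (rule top.dtransition_inverse[OF c k(4) p(1) k(2)] top.dtransition_inverse[OF k(4) c k(2) p(1)])+
  moreover have "metric_coeff A' g' c q =
      (\<lambda>u v. metric_coeff A g d (snd k p) (dtransition c k p u) (dtransition c k p v))"
    unfolding p(2) using metric_coeff_adapted[OF k(1) q] top.metric_coeff_transition[OF c k(4) p(1) k(2)]
    by (intro ext) simp
  ultimately show "lorentz_form (metric_coeff A' g' c q)" by simp
next
  fix c u v assume c: "c \<in> A'"
  show "smooth_on (snd c ` fst c) (\<lambda>q. metric_coeff A' g' c q u v)"
  proof (rule smooth_on_local)
    fix q assume "q \<in> snd c ` fst c"
    then obtain p where p: "p \<in> fst c" "q = snd c p" by blast
    obtain k d where k: "adapted k d" "p \<in> fst k" "\<rho> p \<in> fst d" "k \<in> A'" "d \<in> A" by (rule adapted_at)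
    let ?R = "snd c ` (fst c \<inter> fst k)"
    note tr = top.transition_smooth[OF c k(4)]
    have "smooth_on ?R (\<lambda>q. metric_coeff A g d (transition c k q)
        (frechet_derivative (transition c k) (at q) u) (frechet_derivative (transition c k) (at q) v))"
      by (rule lorentz_coords.smooth_on_coeff[OF down.coords[OF k(5)] tr
            smooth_on_frechet_derivative[OF tr] smooth_on_frechet_derivative[OF tr]])
         (use c adapted_image[OF k(1)] in auto)
    moreover have "metric_coeff A' g' c q u v = metric_coeff A g d (transition c k q)
        (frechet_derivative (transition c k) (at q) u) (frechet_derivative (transition c k) (at q) v)"
      if qR: "q \<in> ?R" for q
    proof -
      obtain r where r: "r \<in> fst c" "r \<in> fst k" "q = snd c r" using qR by blast
      show ?thesis
        unfolding r(3) using metric_coeff_adapted[OF k(1), of "snd k r"]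
          top.metric_coeff_transition[OF c k(4) r(1,2)] r c by simp
    qed
    ultimately have "smooth_on ?R (\<lambda>q. metric_coeff A' g' c q u v)" by (subst smooth_on_cong)
    then show "\<exists>R. q \<in> R \<and> R \<subseteq> snd c ` fst c \<and> smooth_on R (\<lambda>q. metric_coeff A' g' c q u v)"
      using p k(2) by (intro exI[of _ ?R]) auto
  qed
qed

sublocale up: lorentz_manifold A' g'
  by unfold_locales (rule lorentz_metric_cover)

lemma orientation_lift: "T' p \<in> tangent_space A' p" "differential A' A \<rho> p (T' p) = T (\<rho> p)"
  using cover unfolding lorentz_covering_def by blast+

lemma orientation_adapted:
  assumes "adapted c d" "p \<in> fst c"
  shows "T' p c = T (\<rho> p) d"
proof -
  have "T (\<rho> p) d = coord_vec A d (\<rho> p) (T' p c) d"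
    using differential_adapted[OF assms orientation_lift(1)] orientation_lift(2) by simp
  also have "\<dots> = T' p c" using adaptedD(2,3)[OF assms(1)] assms(2) by simp
  finally show ?thesis by simp
qed

lemma smooth_vector_field_cover: "smooth_vector_field A' T'"
  unfolding smooth_vector_field_def
proof (intro conjI allI ballI orientation_lift(1))
  fix c assume c: "c \<in> A'"
  show "smooth_on (snd c ` fst c) (\<lambda>q. T' (chart_inv c q) c)"
  proof (rule smooth_on_local)
    fix q assume "q \<in> snd c ` fst c"
    then obtain p where p: "p \<in> fst c" "q = snd c p" by blast
    obtain k d where k: "adapted k d" "p \<in> fst k" "\<rho> p \<in> fst d" "k \<in> A'" "d \<in> A" by (rule adapted_at)
    let ?R = "snd c ` (fst c \<inter> fst k)"
    note tr = top.transition_smooth[OF c k(4)] and rt = top.transition_smooth[OF k(4) c]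
    have mem: "transition c k q \<in> snd k ` (fst k \<inter> fst c)" if "q \<in> ?R" for q
      using that c by auto
    have "smooth_on (snd d ` fst d) (\<lambda>q. T (chart_inv d q) d)"
      using field k(5) unfolding smooth_vector_field_def by blast
    then have "smooth_on ?R (\<lambda>q. T (chart_inv d (transition c k q)) d)"
      by (rule smooth_on_compose[OF _ tr]) (use mem adapted_image[OF k(1)] in blast)
    then have "smooth_on ?R (\<lambda>q. frechet_derivative (transition k c) (at (transition c k q)) (T (chart_inv d (transition c k q)) d))"
      by (rule smooth_on_frechet_derivative_apply[OF rt tr _ mem])
    moreover have "T' (chart_inv c q) c =
        frechet_derivative (transition k c) (at (transition c k q)) (T (chart_inv d (transition c k q)) d)"
      if qR: "q \<in> ?R" for q
    proof -
      obtain r where r: "r \<in> fst c" "r \<in> fst k" "q = snd c r" using qR by blast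
      have "chart_inv d (transition c k q) = \<rho> r"
        using r c k(5) adaptedD(3,4)[OF k(1)] by simp
      then show ?thesis
        using r c top.tangent_transition[OF orientation_lift(1) k(4) c r(2,1)] orientation_adapted[OF k(1) r(2)]
        by simp
    qed
    ultimately have "smooth_on ?R (\<lambda>q. T' (chart_inv c q) c)" by (subst smooth_on_cong)
    then show "\<exists>R. q \<in> R \<and> R \<subseteq> snd c ` fst c \<and> smooth_on R (\<lambda>q. T' (chart_inv c q) c)"
      using p k(2) by (intro exI[of _ ?R]) auto
  qed
qed

lemma timelike_cover: "g' p (T' p) (T' p) < 0"
  using metric_pullback[OF orientation_lift(1) orientation_lift(1)] orientation_lift(2) timelike by simp

lemma space_time_cover: "space_time A' g' T'"
  using cover top.atlas lorentz_metric_cover smooth_vector_field_cover timelike_cover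
  unfolding space_time_def lorentz_covering_def by blast

subsection \<open>Projections and lifts of curves\<close>

lemma continuous_projection: "continuous_on J \<gamma> \<Longrightarrow> continuous_on J (\<rho> \<circ> \<gamma>)"
  by (rule continuous_on_compose[OF _ continuous_covering])

lemma smooth_curve_projection:
  assumes "smooth_curve_on A' J \<gamma>"
  shows "smooth_curve_on A J (\<rho> \<circ> \<gamma>)"
proof (rule down.smooth_curve_onI)
  show "open J" "continuous_on J (\<rho> \<circ> \<gamma>)"
    using assms continuous_projection unfolding smooth_curve_on_def by blast+
  fix t assume "t \<in> J"
  obtain c d where cd: "adapted c d" "\<gamma> t \<in> fst c" "\<rho> (\<gamma> t) \<in> fst d" "c \<in> A'" "d \<in> A" by (rule adapted_at)
  have "smooth_on (J \<inter> \<gamma> -` fst c) (snd d \<circ> (\<rho> \<circ> \<gamma>))"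
    unfolding adaptedD(5)[OF cd(1)] by (rule top.smooth_curve_chart(1)[OF assms cd(4)])
  then show "\<exists>d\<in>A. \<exists>R. t \<in> R \<and> R \<subseteq> J \<and> (\<rho> \<circ> \<gamma>) ` R \<subseteq> fst d \<and> smooth_on R (snd d \<circ> (\<rho> \<circ> \<gamma>))"
    using \<open>t \<in> J\<close> cd(2) adaptedD(3)[OF cd(1)]
    by (intro bexI[OF _ cd(5)] exI[of _ "J \<inter> \<gamma> -` fst c"]) (simp add: image_subset_iff)
qed

lemma smooth_curve_lift:
  assumes "continuous_on J \<gamma>" and sm: "smooth_curve_on A J (\<rho> \<circ> \<gamma>)"
  shows "smooth_curve_on A' J \<gamma>"
proof (rule top.smooth_curve_onI[OF _ assms(1)])
  show "open J" using sm unfolding smooth_curve_on_def by blast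
  fix t assume t: "t \<in> J"
  obtain c d where cd: "adapted c d" "\<gamma> t \<in> fst c" "\<rho> (\<gamma> t) \<in> fst d" "c \<in> A'" "d \<in> A" by (rule adapted_at)
  let ?R = "J \<inter> \<gamma> -` fst c"
  have "open ?R" by (rule continuous_open_preimage[OF assms(1) \<open>open J\<close> top.chart_continuous(3)[OF cd(4)]])
  then have "smooth_on ?R (snd d \<circ> (\<rho> \<circ> \<gamma>))"
    by (rule smooth_on_subset[OF down.smooth_curve_chart(1)[OF sm cd(5)]]) (use adaptedD(3)[OF cd(1)] in auto)
  then have "smooth_on ?R (snd c \<circ> \<gamma>)" unfolding adaptedD(5)[OF cd(1)] .
  then show "\<exists>c\<in>A'. \<exists>R. t \<in> R \<and> R \<subseteq> J \<and> \<gamma> ` R \<subseteq> fst c \<and> smooth_on R (snd c \<circ> \<gamma>)"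
    using t cd(2,4) by (intro bexI[OF _ cd(4)] exI[of _ ?R]) auto
qed

lemma state_adapted: "adapted c d \<Longrightarrow> down.state d (\<rho> \<circ> \<gamma>) t = up.state c \<gamma> t"
  unfolding down.state_def up.state_def by (simp only: adaptedD(5)) (simp add: adaptedD(4))

lemma chart_spray_adapted:
  assumes "adapted c d" "fst z \<in> snd c ` fst c"
  shows "up.chart_spray c z = down.chart_spray d z"
  using chris_cong_open[OF top.chart_continuous(4)[OF adaptedD(1)[OF assms(1)]] assms(2) metric_coeff_adapted[OF assms(1)]]
  by (simp add: up.chart_spray_eq[OF adaptedD(1)[OF assms(1)]] down.chart_spray_eq[OF adaptedD(2)[OF assms(1)]])

lemma geodesic_projection:
  assumes geo: "geodesic A' g' J \<gamma>"
  shows "geodesic A g J (\<rho> \<circ> \<gamma>)"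
proof (rule down.geodesicI[OF up.geodesic_interval[OF geo] up.geodesic_nonempty[OF geo]])
  fix t assume t: "t \<in> J"
  obtain c d where cd: "adapted c d" "\<gamma> t \<in> fst c" "\<rho> (\<gamma> t) \<in> fst d" "c \<in> A'" "d \<in> A" by (rule adapted_at)
  let ?R = "J \<inter> \<gamma> -` fst c"
  have "open ?R" by (rule top.smooth_curve_chart(4)[OF up.geodesic_smooth[OF geo] cd(4)])
  moreover have "(up.state c \<gamma> has_vector_derivative down.chart_spray d (up.state c \<gamma> s)) (at s)" if "s \<in> ?R" for s
    using up.geodesic_state_derivative[OF geo cd(4), of s] chart_spray_adapted[OF cd(1), of "up.state c \<gamma> s"] that by simp
  ultimately show "\<exists>c\<in>A. \<exists>R z. open R \<and> t \<in> R \<and> R \<subseteq> J \<and> (\<forall>s\<in>R. (\<rho> \<circ> \<gamma>) s \<in> fst c \<and>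
      fst (z s) = snd c ((\<rho> \<circ> \<gamma>) s) \<and> (z has_vector_derivative down.chart_spray c (z s)) (at s))"
    using t cd(2) adaptedD(3,4)[OF cd(1)]
    by (intro bexI[OF _ cd(5)] exI[of _ ?R] exI[of _ "up.state c \<gamma>"]) auto
qed

lemma geodesic_lift:
  assumes cont: "continuous_on J \<gamma>" and geo: "geodesic A g J (\<rho> \<circ> \<gamma>)"
  shows "geodesic A' g' J \<gamma>"
proof (rule up.geodesicI[OF down.geodesic_interval[OF geo] down.geodesic_nonempty[OF geo]])
  fix t assume t: "t \<in> J"
  obtain c d where cd: "adapted c d" "\<gamma> t \<in> fst c" "\<rho> (\<gamma> t) \<in> fst d" "c \<in> A'" "d \<in> A" by (rule adapted_at)
  let ?R = "J \<inter> \<gamma> -` fst c"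
  let ?z = "down.state d (\<rho> \<circ> \<gamma>)"
  have "open ?R" by (rule continuous_open_preimage[OF cont down.geodesic_open[OF geo] top.chart_continuous(3)[OF cd(4)]])
  moreover have "(?z has_vector_derivative up.chart_spray c (?z s)) (at s)" if "s \<in> ?R" for s
  proof -
    have "fst (?z s) \<in> snd c ` fst c" unfolding state_adapted[OF cd(1)] using that by simp
    then show ?thesis
      using down.geodesic_state_derivative[OF geo cd(5), of s] chart_spray_adapted[OF cd(1), of "?z s"] that
        adaptedD(3)[OF cd(1), of "\<gamma> s"] by simp
  qed
  ultimately show "\<exists>c\<in>A'. \<exists>R z. open R \<and> t \<in> R \<and> R \<subseteq> J \<and> (\<forall>s\<in>R. \<gamma> s \<in> fst c \<and>
      fst (z s) = snd c (\<gamma> s) \<and> (z has_vector_derivative up.chart_spray c (z s)) (at s))"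
    using t cd(2) adaptedD(3,4)[OF cd(1)]
    by (intro bexI[OF _ cd(4)] exI[of _ ?R] exI[of _ ?z]) auto
qed

lemma null_vec_projection:
  assumes geo: "geodesic A' g' J \<gamma>" and t: "t \<in> J"
  shows "null_vec g ((\<rho> \<circ> \<gamma>) t) (velocity A (\<rho> \<circ> \<gamma>) J t) \<longleftrightarrow> null_vec g' (\<gamma> t) (velocity A' \<gamma> J t)"
proof -
  obtain c d where cd: "adapted c d" "\<gamma> t \<in> fst c" "\<rho> (\<gamma> t) \<in> fst d" "c \<in> A'" "d \<in> A" by (rule adapted_at)
  have "snd c (\<gamma> t) \<in> snd c ` fst c" using cd(2) by blast
  then show ?thesis
    using down.null_vec_state[OF geodesic_projection[OF geo] cd(5) t] up.null_vec_state[OF geo cd(4) t cd(2)] cd(3)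
    by (simp add: state_adapted[OF cd(1)] metric_coeff_adapted[OF cd(1)] adaptedD(4)[OF cd(1), symmetric])
qed

text \<open>Inextendibility is the delicate part: an extension of
  \<open>\<rho> \<circ> \<gamma>\<close> can be lifted, and by unique lifting its lift would extend
  \<open>\<gamma>\<close>.\<close>

lemma null_geodesic_projection:
  assumes null: "null_geodesic A' g' J \<gamma>"
  shows "null_geodesic A g J (\<rho> \<circ> \<gamma>)"
proof -
  have geo: "geodesic A' g' J \<gamma>" and ext: "up.inextendible J \<gamma>" using null by (simp_all add: up.null_geodesic_eq)
  have "down.inextendible J (\<rho> \<circ> \<gamma>)"
    unfolding down.inextendible_def
  proof (rule notI, elim exE conjE)
    fix J' \<sigma> assume *: "J \<subset> J'" "geodesic A g J' \<sigma>" "\<forall>t\<in>J. \<sigma> t = (\<rho> \<circ> \<gamma>) t"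
    obtain t0 where t0: "t0 \<in> J" using up.geodesic_nonempty[OF geo] by blast
    obtain \<gamma>' where \<gamma>': "continuous_on J' \<gamma>'" "\<And>t. t \<in> J' \<Longrightarrow> \<rho> (\<gamma>' t) = \<sigma> t" "\<gamma>' t0 = \<gamma> t0"
      by (rule lift_exists[OF evenly_covered_at down.geodesic_interval[OF *(2)] down.geodesic_open[OF *(2)]
            down.geodesic_continuous[OF *(2)], of t0 "\<gamma> t0"]) (use * t0 that in auto)
    have "geodesic A g J' (\<rho> \<circ> \<gamma>')"
      by (rule down.geodesic_local[OF down.geodesic_interval[OF *(2)] down.geodesic_nonempty[OF *(2)]],
          rule exI[of _ J'], rule exI[of _ \<sigma>], rule exI[of _ J'])
         (use * \<gamma>'(2) down.geodesic_open[OF *(2)] in auto)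
    then have "geodesic A' g' J' \<gamma>'" by (rule geodesic_lift[OF \<gamma>'(1)])
    moreover have "\<gamma>' t = \<gamma> t" if "t \<in> J" for t
    proof (rule lift_unique[where S = J and s = t0 and \<alpha> = \<gamma>' and \<beta> = \<gamma> and \<rho> = \<rho>, OF evenly_covered_at _ _ _ _ t0 \<gamma>'(3) that])
      show "connected J" using up.geodesic_interval[OF geo] by (simp add: is_interval_connected_1)
      show "continuous_on J \<gamma>'" by (rule continuous_on_subset[OF \<gamma>'(1)]) (use * in blast)
      show "continuous_on J \<gamma>" by (rule up.geodesic_continuous[OF geo])
    qed (use * \<gamma>'(2) in auto)
    ultimately have "\<exists>J' \<gamma>'. J \<subset> J' \<and> geodesic A' g' J' \<gamma>' \<and> (\<forall>t\<in>J. \<gamma>' t = \<gamma> t)"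
      using *(1) by (intro exI[of _ J'] exI[of _ \<gamma>']) simp
    then show False using ext unfolding up.inextendible_def by (rule notE[rotated])
  qed
  then show ?thesis
    using null geodesic_projection[OF geo] null_vec_projection[OF geo]
    by (simp add: up.null_geodesic_eq down.null_geodesic_eq)
qed

text \<open>The lift is inextendible because the projection of an extension would extend
  \<open>\<sigma>\<close>.\<close>

lemma null_geodesic_lift:
  assumes null: "null_geodesic A g J \<sigma>" and t0: "t0 \<in> J" "\<rho> p = \<sigma> t0"
  obtains \<gamma> where "null_geodesic A' g' J \<gamma>" "\<gamma> t0 = p" "\<And>t. t \<in> J \<Longrightarrow> \<rho> (\<gamma> t) = \<sigma> t"
proof -
  have geo: "geodesic A g J \<sigma>" and ext: "down.inextendible J \<sigma>" using null by (simp_all add: down.null_geodesic_eq)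
  obtain \<gamma> where \<gamma>: "continuous_on J \<gamma>" "\<And>t. t \<in> J \<Longrightarrow> \<rho> (\<gamma> t) = \<sigma> t" "\<gamma> t0 = p"
    by (rule lift_exists[OF evenly_covered_at down.geodesic_interval[OF geo] down.geodesic_open[OF geo]
          down.geodesic_continuous[OF geo] t0]) (rule that)
  \<comment> \<open>\<open>\<rho> \<circ> \<gamma>\<close> and \<open>\<sigma>\<close> are known to
    agree on \<open>J\<close> only, so the property is transferred locally.\<close>
  have geoR: "geodesic A g J (\<rho> \<circ> \<gamma>)"
    by (rule down.geodesic_local[OF down.geodesic_interval[OF geo] down.geodesic_nonempty[OF geo]],
        rule exI[of _ J], rule exI[of _ \<sigma>], rule exI[of _ J])
       (use geo \<gamma>(2) down.geodesic_open[OF geo] in auto)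
  then have geo': "geodesic A' g' J \<gamma>" by (rule geodesic_lift[OF \<gamma>(1)])
  have "up.inextendible J \<gamma>"
    unfolding up.inextendible_def
  proof (rule notI, elim exE conjE)
    fix J' \<gamma>' assume *: "J \<subset> J'" "geodesic A' g' J' \<gamma>'" "\<forall>t\<in>J. \<gamma>' t = \<gamma> t"
    have "\<exists>J' \<sigma>'. J \<subset> J' \<and> geodesic A g J' \<sigma>' \<and> (\<forall>t\<in>J. \<sigma>' t = \<sigma> t)"
      by (intro exI[of _ J'] exI[of _ "\<rho> \<circ> \<gamma>'"] conjI *(1) geodesic_projection[OF *(2)])
         (use *(3) \<gamma>(2) in auto)
    then show False using ext unfolding down.inextendible_def by (rule notE[rotated])
  qed
  moreover have "null_vec g' (\<gamma> t) (velocity A' \<gamma> J t)" if t: "t \<in> J" for t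
  proof -
    obtain d where d: "d \<in> A" "\<sigma> t \<in> fst d" by (rule down.chart_at)
    have "null_vec g (\<sigma> t) (velocity A \<sigma> J t)" using null t by (simp add: down.null_geodesic_eq)
    moreover have "down.state d (\<rho> \<circ> \<gamma>) t = down.state d \<sigma> t"
      by (rule down.state_cong[OF down.geodesic_open[OF geo] t]) (simp add: \<gamma>(2))
    ultimately have "null_vec g ((\<rho> \<circ> \<gamma>) t) (velocity A (\<rho> \<circ> \<gamma>) J t)"
      using down.null_vec_state[OF geo d(1) t d(2)] down.null_vec_state[OF geoR d(1) t] d(2) \<gamma>(2)[OF t] by simp
    then show ?thesis using null_vec_projection[OF geo' t] by simp
  qed
  ultimately have "null_geodesic A' g' J \<gamma>" using geo' by (simp add: up.null_geodesic_eq)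
  then show ?thesis using that \<gamma> by blast
qed

end

section \<open>Nonspacelike curves in strongly causal space-times\<close>

text \<open>Translates connectedness of the trace into connectedness of the set of parameters: an
  injective curve on a compact interval is a homeomorphism onto its image.\<close>

lemma inj_curve_connected_trace:
  fixes \<gamma> :: "real \<Rightarrow> 'a::t2_space"
  assumes cont: "continuous_on {a..b} \<gamma>" and inj: "inj_on \<gamma> {a..b}" and conn: "connected (\<gamma> ` {a..b} \<inter> U)"
    and ends: "\<gamma> a \<in> U" "\<gamma> b \<in> U" and r: "r \<in> {a..b}"
  shows "\<gamma> r \<in> U"
proof -
  let ?h = "the_inv_into {a..b} \<gamma>"
  have h: "?h (\<gamma> t) = t" if "t \<in> {a..b}" for t by (rule the_inv_into_f_f[OF inj that])
  have "continuous_on (\<gamma> ` {a..b} \<inter> U) ?h"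
    by (rule continuous_on_subset[OF continuous_on_inv_into[OF cont compact_Icc inj]]) blast
  then have "connected (?h ` (\<gamma> ` {a..b} \<inter> U))" using conn by (rule connected_continuous_image)
  moreover have "?h ` (\<gamma> ` {a..b} \<inter> U) = {t\<in>{a..b}. \<gamma> t \<in> U}"
  proof
    show "{t\<in>{a..b}. \<gamma> t \<in> U} \<subseteq> ?h ` (\<gamma> ` {a..b} \<inter> U)"
    proof
      fix t assume "t \<in> {t\<in>{a..b}. \<gamma> t \<in> U}"
      then show "t \<in> ?h ` (\<gamma> ` {a..b} \<inter> U)" using h[of t] by (intro image_eqI[of _ _ "\<gamma> t"]) auto
    qed
  qed (use h in auto)
  ultimately have c: "connected {t\<in>{a..b}. \<gamma> t \<in> U}" by simp
  have "a \<in> {t\<in>{a..b}. \<gamma> t \<in> U}" "b \<in> {t\<in>{a..b}. \<gamma> t \<in> U}" using ends r by auto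
  from connected_contains_Icc[OF c this] have "r \<in> {t\<in>{a..b}. \<gamma> t \<in> U}" using r by (rule subsetD)
  then show ?thesis by simp
qed

text \<open>Take a pair of parameters with the same value and minimal distance.\<close>

lemma minimal_loop:
  fixes \<gamma> :: "real \<Rightarrow> 'a::t2_space"
  assumes cont: "continuous_on {a..b} \<gamma>"
    and loc: "\<And>r. r \<in> {a..b} \<Longrightarrow> \<exists>d>0. inj_on \<gamma> ({a..b} \<inter> ball r d)"
    and ninj: "\<not> inj_on \<gamma> {a..b}"
  obtains s t where "a \<le> s" "s < t" "t \<le> b" "\<gamma> s = \<gamma> t"
    "\<And>r r'. s \<le> r \<Longrightarrow> r < r' \<Longrightarrow> r' \<le> t \<Longrightarrow> \<gamma> r = \<gamma> r' \<Longrightarrow> r = s \<and> r' = t"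
proof -
  let ?\<G> = "{ball r d |r d. d > 0 \<and> inj_on \<gamma> ({a..b} \<inter> ball r d)}"
  have "{a..b} \<subseteq> \<Union>?\<G>"
  proof
    fix r assume "r \<in> {a..b}"
    then obtain d where "d > 0" "inj_on \<gamma> ({a..b} \<inter> ball r d)" using loc by blast
    then show "r \<in> \<Union>?\<G>" by (intro UnionI[of "ball r d"]) auto
  qed
  then obtain \<epsilon> where \<epsilon>: "0 < \<epsilon>" "\<And>x. x \<in> {a..b} \<Longrightarrow> \<exists>G\<in>?\<G>. ball x \<epsilon> \<subseteq> G"
    by (rule Heine_Borel_lemma[OF compact_Icc]) auto
  \<comment> \<open>\<open>\<epsilon>\<close> is a Lebesgue number for the cover by intervals of
    injectivity. Since coincident parameters are at least \<open>\<epsilon>\<close> apart, the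
    diagonal can be cut away by a closed condition, and the set \<open>?S\<close> of coincident
    pairs is compact.\<close>
  have far: "\<epsilon> \<le> r' - r" if rr: "a \<le> r" "r < r'" "r' \<le> b" "\<gamma> r = \<gamma> r'" for r r'
  proof (rule ccontr)
    assume "\<not> \<epsilon> \<le> r' - r"
    then have "r' \<in> ball r \<epsilon>" "r \<in> ball r \<epsilon>" using rr \<epsilon>(1) by (auto simp: dist_real_def)
    moreover obtain G where G: "G \<in> ?\<G>" "ball r \<epsilon> \<subseteq> G" using \<epsilon>(2)[of r] rr by auto
    ultimately have "r \<in> {a..b} \<inter> G" "r' \<in> {a..b} \<inter> G" using rr by auto
    moreover have "inj_on \<gamma> ({a..b} \<inter> G)" using G(1) by blast
    ultimately show False using rr(2,4) by (metis inj_onD less_irrefl)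
  qed
  let ?C = "({a..b} \<times> {a..b}) \<inter> {z. \<epsilon> \<le> snd z - fst z}"
  let ?S = "?C \<inter> (\<lambda>z. (\<gamma> (fst z), \<gamma> (snd z))) -` {y. \<exists>x. y = (x, x)}"
  have cC: "compact ?C"
    by (intro compact_Int_closed compact_Times compact_Icc closed_Collect_le continuous_intros)
  have "continuous_on ?C (\<lambda>z. (\<gamma> (fst z), \<gamma> (snd z)))"
    by (intro continuous_on_Pair continuous_on_compose2[OF cont] continuous_intros) auto
  then have "closed ?S"
    by (rule continuous_closed_preimage[OF _ compact_imp_closed[OF cC] closed_diagonal])
  then have "compact (?C \<inter> ?S)" by (rule compact_Int_closed[OF cC])
  moreover have "?C \<inter> ?S = ?S" by blast
  ultimately have cS: "compact ?S" by simp
  have mem: "(r, r') \<in> ?S" if "a \<le> r" "r < r'" "r' \<le> b" "\<gamma> r = \<gamma> r'" for r r'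
    using far[OF that] that by auto
  obtain x y where "x \<in> {a..b}" "y \<in> {a..b}" "\<gamma> x = \<gamma> y" "x \<noteq> y" using ninj unfolding inj_on_def by blast
  then have "(min x y, max x y) \<in> ?S" by (intro mem) (auto simp: min_def max_def)
  then have ne: "?S \<noteq> {}" by blast
  have "continuous_on ?S (\<lambda>z. snd z - fst z)" by (intro continuous_intros)
  from continuous_attains_inf[OF cS ne this]
  obtain z where z: "z \<in> ?S" "\<forall>w\<in>?S. snd z - fst z \<le> snd w - fst w" by (rule bexE)
  obtain s t where st: "z = (s, t)" by (cases z)
  have 1: "a \<le> s" "s < t" "t \<le> b" "\<gamma> s = \<gamma> t" using z(1) \<epsilon>(1) unfolding st by auto
  have "r = s \<and> r' = t" if r: "s \<le> r" "r < r'" "r' \<le> t" "\<gamma> r = \<gamma> r'" for r r'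
  proof -
    have "(r, r') \<in> ?S" by (rule mem) (use r 1 in auto)
    from bspec[OF z(2) this] show ?thesis using r unfolding st by simp
  qed
  then show ?thesis by (rule that[OF 1])
qed

section \<open>Injectivity of nonspacelike curves\<close>

lemma nonspacelike_curve_interval: "nonspacelike_curve A g T I \<gamma> \<Longrightarrow> is_interval I"
  and nonspacelike_curve_continuous: "nonspacelike_curve A g T I \<gamma> \<Longrightarrow> continuous_on I \<gamma>"
  unfolding nonspacelike_curve_def piecewise_smooth_curve_def by blast+

lemma causally_convex_connected:
  "causally_convex A g T U \<Longrightarrow> nonspacelike_curve A g T I \<gamma> \<Longrightarrow> connected (\<gamma> ` I \<inter> U)"
  by (simp add: causally_convex_def)

lemma causally_convex_open: "causally_convex A g T U \<Longrightarrow> open U"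
  by (simp add: causally_convex_def)

locale oriented = lorentz_manifold A g for A :: "('a::t2_space, 'e::euclidean_space) chart set" and g +
  fixes T :: "'a \<Rightarrow> ('a, 'e) tvec"
  assumes orientation: "smooth_vector_field A T" and timelike_orientation: "\<And>p. g p (T p) (T p) < 0"
begin

lemma orientation_tangent: "T p \<in> tangent_space A p"
  using orientation unfolding smooth_vector_field_def by blast

text \<open>A smooth arc is the restriction of a curve on an open set, so its one-sided velocities
  at the end points are ordinary velocities of that curve.\<close>

lemma arc_velocity:
  assumes st: "s < t" and \<sigma>: "smooth_curve_on A K \<sigma>" "{s..t} \<subseteq> K" "\<And>r. r \<in> {s..t} \<Longrightarrow> \<sigma> r = \<gamma> r" and r: "r \<in> {s..t}"
  shows "velocity A \<gamma> {s..t} r = velocity A \<sigma> UNIV r"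
proof
  fix c
  have "vector_derivative (snd c \<circ> \<gamma>) (at r within {s..t}) = vector_derivative (snd c \<circ> \<sigma>) (at r)"
    if c: "c \<in> A" "\<gamma> r \<in> fst c"
  proof -
    have rK: "r \<in> K" "\<sigma> r \<in> fst c" using \<sigma>(2,3) r c by auto
    have "((snd c \<circ> \<sigma>) has_derivative (\<lambda>h. h *\<^sub>R vector_derivative (snd c \<circ> \<sigma>) (at r))) (at r within {s..t})"
      using smooth_curve_has_velocity[OF \<sigma>(1) c(1) rK] unfolding has_vector_derivative_def
      by (rule has_derivative_at_withinI)
    then have "((snd c \<circ> \<gamma>) has_derivative (\<lambda>h. h *\<^sub>R vector_derivative (snd c \<circ> \<sigma>) (at r))) (at r within {s..t})"
      by (rule has_derivative_transform[OF r, rotated]) (simp add: \<sigma>(3))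
    then have "((snd c \<circ> \<gamma>) has_vector_derivative vector_derivative (snd c \<circ> \<sigma>) (at r)) (at r within cbox s t)"
      by (simp add: has_vector_derivative_def)
    from vector_derivative_within_cbox[OF st _ this] show ?thesis using r by simp
  qed
  then show "velocity A \<gamma> {s..t} r c = velocity A \<sigma> UNIV r c"
    unfolding velocity_def using \<sigma>(3)[OF r] by simp
qed

lemma arc_velocity_tangent:
  assumes "s < t" "smooth_arc A \<gamma> s t" "r \<in> {s..t}"
  shows "velocity A \<gamma> {s..t} r \<in> tangent_space A (\<gamma> r)"
proof -
  obtain K \<sigma> where \<sigma>: "smooth_curve_on A K \<sigma>" "{s..t} \<subseteq> K" "\<And>r. r \<in> {s..t} \<Longrightarrow> \<sigma> r = \<gamma> r"
    using assms(2) unfolding smooth_arc_def by blast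
  have "velocity A \<gamma> {s..t} r = velocity A \<sigma> UNIV r" by (rule arc_velocity[OF assms(1) \<sigma> assms(3)])
  moreover have "velocity A \<sigma> UNIV r \<in> tangent_space A (\<sigma> r)"
    by (rule smooth_curve_velocity[OF \<sigma>(1)]) (use \<sigma>(2) assms(3) in blast)
  ultimately show ?thesis using \<sigma>(3)[OF assms(3)] by simp
qed

lemma nonspacelike_curve_subinterval:
  assumes "nonspacelike_curve A g T I \<gamma>" "is_interval K" "interior K \<noteq> {}" "K \<subseteq> I"
  shows "nonspacelike_curve A g T K \<gamma>"
proof -
  have I: "continuous_on I \<gamma>"
    "\<And>a b. a < b \<Longrightarrow> {a..b} \<subseteq> I \<Longrightarrow> \<exists>D. finite D \<and>
          (\<forall>s t. a \<le> s \<and> s < t \<and> t \<le> b \<and> {s<..<t} \<inter> D = {} \<longrightarrow> smooth_arc A \<gamma> s t)"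
    using assms(1) unfolding nonspacelike_curve_def piecewise_smooth_curve_def by blast+
  have "piecewise_smooth_curve A K \<gamma>"
    unfolding piecewise_smooth_curve_def
    using assms(2,3) continuous_on_subset[OF I(1) assms(4)] I(2) assms(4) by (meson order_trans)
  moreover have "velocity_vectors A K \<gamma> \<subseteq> velocity_vectors A I \<gamma>"
    using assms(4) unfolding velocity_vectors_def by fastforce
  ultimately show ?thesis using assms(1) unfolding nonspacelike_curve_def by blast
qed

lemma smooth_curve_increasing:
  fixes l :: "'e \<Rightarrow> real"
  assumes \<sigma>: "smooth_curve_on A K \<sigma>" and c: "c \<in> A" and r0: "r0 \<in> K" "\<sigma> r0 \<in> fst c" and l: "linear l"
    and pos: "l (vector_derivative (snd c \<circ> \<sigma>) (at r0)) > 0"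
  shows "\<exists>d>0. \<forall>r r'. \<bar>r - r0\<bar> < d \<longrightarrow> \<bar>r' - r0\<bar> < d \<longrightarrow> r < r' \<longrightarrow> l (snd c (\<sigma> r)) < l (snd c (\<sigma> r'))"
proof -
  let ?R = "K \<inter> \<sigma> -` fst c" and ?x = "snd c \<circ> \<sigma>"
  have bl: "bounded_linear l" using l by (simp add: linear_conv_bounded_linear)
  have x: "smooth_on ?R ?x" by (rule smooth_curve_chart(1)[OF \<sigma> c])
  let ?D = "\<lambda>r. l (vector_derivative ?x (at r))"
  have "continuous_on ?R ?D"
    by (rule bounded_linear.continuous_on[OF bl smooth_on_imp_continuous_on[OF smooth_on_vector_derivative[OF x]]])
  then have "open (?R \<inter> ?D -` {0<..})"
    by (rule continuous_open_preimage[OF _ smooth_on_open[OF x] open_greaterThan])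
  moreover have "r0 \<in> ?R \<inter> ?D -` {0<..}" using r0 pos by simp
  ultimately obtain d where d: "d > 0" "ball r0 d \<subseteq> ?R \<inter> ?D -` {0<..}" using openE by blast
  have "l (?x r) < l (?x r')" if "\<bar>r - r0\<bar> < d" "\<bar>r' - r0\<bar> < d" "r < r'" for r r'
  proof (rule DERIV_pos_imp_increasing[OF that(3)])
    fix y assume "r \<le> y" "y \<le> r'"
    then have "y \<in> ball r0 d" using that by (simp add: dist_real_def)
    then have y: "y \<in> ?R" "?D y > 0" using d(2) by auto
    have "((\<lambda>r. l (?x r)) has_vector_derivative ?D y) (at y)"
      by (rule bounded_linear.has_vector_derivative[OF bl smooth_on_has_vector_derivative(1)[OF x y(1)]])
    then have "((\<lambda>r. l (?x r)) has_real_derivative ?D y) (at y)"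
      by (simp add: has_real_derivative_iff_has_vector_derivative)
    then show "\<exists>D. ((\<lambda>r. l (?x r)) has_real_derivative D) (at y) \<and> D > 0" using y(2) by blast
  qed
  then show ?thesis using d(1) by (intro exI[of _ d]) simp
qed

text \<open>Pairing with the value of \<open>T\<close> at one event gives a coordinate function that increases
  strictly along nonspacelike curves near this event, also through break points.\<close>

lemma nonspacelike_curve_locally_injective:
  assumes ns: "nonspacelike_curve A g T I \<gamma>" and r0: "r0 \<in> I"
  shows "\<exists>d>0. inj_on \<gamma> (I \<inter> ball r0 d)"
proof -
  have I: "is_interval I"
    and pw: "\<And>a b. a < b \<Longrightarrow> {a..b} \<subseteq> I \<Longrightarrow> \<exists>D. finite D \<and>
          (\<forall>s t. a \<le> s \<and> s < t \<and> t \<le> b \<and> {s<..<t} \<inter> D = {} \<longrightarrow> smooth_arc A \<gamma> s t)"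
    and sgn: "(\<forall>(p, v) \<in> velocity_vectors A I \<gamma>. g p v (T p) < 0) \<or>
      (\<forall>(p, v) \<in> velocity_vectors A I \<gamma>. g p v (T p) > 0)"
    using ns unfolding nonspacelike_curve_def piecewise_smooth_curve_def by blast+
  \<comment> \<open>\<open>k\<close> is -1 or 1 according to the time-direction of the curve, so
    that both cases become one inequality.\<close>
  obtain k :: real where k: "\<And>p v. (p, v) \<in> velocity_vectors A I \<gamma> \<Longrightarrow> k * g p v (T p) > 0"
  proof (cases "\<forall>(p, v) \<in> velocity_vectors A I \<gamma>. g p v (T p) < 0")
    case True
    then show ?thesis by (intro that[of "-1"]) auto
  next
    case False
    then have "\<forall>(p, v) \<in> velocity_vectors A I \<gamma>. g p v (T p) > 0" using sgn by blast
    then show ?thesis by (intro that[of 1]) auto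
  qed
  obtain c where c: "c \<in> A" "\<gamma> r0 \<in> fst c" by (rule chart_at)
  \<comment> \<open>The metric and \<open>T\<close> are frozen at \<open>\<gamma> r0\<close>, which
    makes \<open>?l\<close> linear on coordinates. Its derivative along the curve is positive at
    \<open>r0\<close>, and by continuity nearby on each of the two adjacent arcs.\<close>
  let ?l = "\<lambda>u. k * metric_coeff A g c (snd c (\<gamma> r0)) u (T (\<gamma> r0) c)"
  let ?f = "\<lambda>r. ?l (snd c (\<gamma> r))"
  have q: "snd c (\<gamma> r0) \<in> snd c ` fst c" using c by blast
  have l: "linear ?l"
    by (rule linearI) (simp_all add: lorentz_coords.simps[OF coords[OF c(1)] q] algebra_simps)
  have arc: "\<exists>d>0. \<forall>r\<in>{s..t}. \<forall>r'\<in>{s..t}. \<bar>r - r0\<bar> < d \<longrightarrow> \<bar>r' - r0\<bar> < d \<longrightarrow> r < r' \<longrightarrow> ?f r < ?f r'"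
    if st: "s < t" "{s..t} \<subseteq> I" "smooth_arc A \<gamma> s t" "r0 \<in> {s..t}" for s t
  proof -
    obtain K \<sigma> where \<sigma>: "smooth_curve_on A K \<sigma>" "{s..t} \<subseteq> K" "\<And>r. r \<in> {s..t} \<Longrightarrow> \<sigma> r = \<gamma> r"
      using st(3) unfolding smooth_arc_def by blast
    let ?v = "velocity A \<gamma> {s..t} r0"
    have "(\<gamma> r0, ?v) \<in> velocity_vectors A I \<gamma>" using st unfolding velocity_vectors_def by blast
    then have "k * g (\<gamma> r0) ?v (T (\<gamma> r0)) > 0" by (rule k)
    moreover have "g (\<gamma> r0) ?v (T (\<gamma> r0)) = metric_coeff A g c (snd c (\<gamma> r0)) (?v c) (T (\<gamma> r0) c)"
      by (rule metric_eq_coeff[OF c arc_velocity_tangent[OF st(1,3,4)] orientation_tangent])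
    moreover have "?v c = vector_derivative (snd c \<circ> \<sigma>) (at r0)"
    proof -
      have "?v c = velocity A \<sigma> UNIV r0 c" using arc_velocity[OF st(1) \<sigma> st(4)] by simp
      then show ?thesis using c \<sigma>(3)[OF st(4)] by (simp add: velocity_def)
    qed
    ultimately have "?l (vector_derivative (snd c \<circ> \<sigma>) (at r0)) > 0" by simp
    then obtain d where "d > 0" and d: "\<And>r r'. \<bar>r - r0\<bar> < d \<Longrightarrow> \<bar>r' - r0\<bar> < d \<Longrightarrow> r < r' \<Longrightarrow> ?l (snd c (\<sigma> r)) < ?l (snd c (\<sigma> r'))"
      using smooth_curve_increasing[OF \<sigma>(1) c(1) _ _ l, of r0] \<sigma>(2,3) st(4) c(2) by fastforce
    show ?thesis
      by (intro exI[of _ d] conjI ballI impI \<open>d > 0\<close>) (use d \<sigma>(3) in metis)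
  qed
  have right: "\<exists>d>0. \<forall>r\<in>I. \<forall>r'\<in>I. r0 \<le> r \<longrightarrow> r' < r0 + d \<longrightarrow> r < r' \<longrightarrow> ?f r < ?f r'"
  proof (cases "\<exists>b\<in>I. r0 < b")
    case True
    then obtain b where b: "b \<in> I" "r0 < b" by blast
    have sub: "{r0..b} \<subseteq> I" using I r0 b(1) connected_contains_Icc is_interval_connected_1 by blast
    obtain D where D: "finite D" "\<And>s t. r0 \<le> s \<Longrightarrow> s < t \<Longrightarrow> t \<le> b \<Longrightarrow> {s<..<t} \<inter> D = {} \<Longrightarrow> smooth_arc A \<gamma> s t"
      using pw[OF b(2) sub] by blast
    \<comment> \<open>The first break point after \<open>r0\<close>, or \<open>b\<close> if that
      comes earlier: up to \<open>t\<close> the curve is a single smooth arc.\<close>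
    define t where "t = Min (insert b {x\<in>D. r0 < x})"
    have fin: "finite (insert b {x\<in>D. r0 < x})" using D(1) by simp
    have t: "r0 < t" "t \<le> b" unfolding t_def using fin b(2) by (auto simp: Min_gr_iff)
    have "{r0<..<t} \<inter> D = {}"
    proof -
      have "t \<le> x" if "x \<in> D" "r0 < x" for x unfolding t_def using fin that by (intro Min_le) auto
      then show ?thesis by force
    qed
    then have "smooth_arc A \<gamma> r0 t" using D(2) t by simp
    then obtain d where d: "d > 0" "\<forall>r\<in>{r0..t}. \<forall>r'\<in>{r0..t}. \<bar>r - r0\<bar> < d \<longrightarrow> \<bar>r' - r0\<bar> < d \<longrightarrow> r < r' \<longrightarrow> ?f r < ?f r'"
      using arc[of r0 t] t sub by fastforce
    have "?f r < ?f r'" if "r0 \<le> r" "r' < r0 + min d (t - r0)" "r < r'" for r r'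
      using d(2)[rule_format, of r r'] that by simp
    then show ?thesis using d(1) t(1) by (intro exI[of _ "min d (t - r0)"]) simp
  next
    case False
    then show ?thesis by (intro exI[of _ 1]) force
  qed
  have left: "\<exists>d>0. \<forall>r\<in>I. \<forall>r'\<in>I. r' \<le> r0 \<longrightarrow> r0 - d < r \<longrightarrow> r < r' \<longrightarrow> ?f r < ?f r'"
  proof (cases "\<exists>a\<in>I. a < r0")
    case True
    then obtain a where a: "a \<in> I" "a < r0" by blast
    have sub: "{a..r0} \<subseteq> I" using I r0 a(1) connected_contains_Icc is_interval_connected_1 by blast
    obtain D where D: "finite D" "\<And>s t. a \<le> s \<Longrightarrow> s < t \<Longrightarrow> t \<le> r0 \<Longrightarrow> {s<..<t} \<inter> D = {} \<Longrightarrow> smooth_arc A \<gamma> s t"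
      using pw[OF a(2) sub] by blast
    define s where "s = Max (insert a {x\<in>D. x < r0})"
    have fin: "finite (insert a {x\<in>D. x < r0})" using D(1) by simp
    have s: "s < r0" "a \<le> s" unfolding s_def using fin a(2) by (auto simp: Max_less_iff)
    have "{s<..<r0} \<inter> D = {}"
    proof -
      have "x \<le> s" if "x \<in> D" "x < r0" for x unfolding s_def using fin that by (intro Max_ge) auto
      then show ?thesis by force
    qed
    then have "smooth_arc A \<gamma> s r0" using D(2) s by simp
    then obtain d where d: "d > 0" "\<forall>r\<in>{s..r0}. \<forall>r'\<in>{s..r0}. \<bar>r - r0\<bar> < d \<longrightarrow> \<bar>r' - r0\<bar> < d \<longrightarrow> r < r' \<longrightarrow> ?f r < ?f r'"
      using arc[of s r0] s sub by fastforce
    have "?f r < ?f r'" if "r' \<le> r0" "r0 - min d (r0 - s) < r" "r < r'" for r r'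
      using d(2)[rule_format, of r r'] that by simp
    then show ?thesis using d(1) s(1) by (intro exI[of _ "min d (r0 - s)"]) simp
  next
    case False
    then show ?thesis by (intro exI[of _ 1]) force
  qed
  obtain d1 where d1: "d1 > 0" "\<And>r r'. r \<in> I \<Longrightarrow> r' \<in> I \<Longrightarrow> r0 \<le> r \<Longrightarrow> r' < r0 + d1 \<Longrightarrow> r < r' \<Longrightarrow> ?f r < ?f r'"
    using right by blast
  obtain d2 where d2: "d2 > 0" "\<And>r r'. r \<in> I \<Longrightarrow> r' \<in> I \<Longrightarrow> r' \<le> r0 \<Longrightarrow> r0 - d2 < r \<Longrightarrow> r < r' \<Longrightarrow> ?f r < ?f r'"
    using left by blast
  have less: "?f r < ?f r'" if r: "r \<in> I" "r' \<in> I" "\<bar>r - r0\<bar> < min d1 d2" "\<bar>r' - r0\<bar> < min d1 d2" "r < r'" for r r'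
  proof -
    consider "r0 \<le> r" | "r' \<le> r0" | "r < r0" "r0 < r'" using r(5) by linarith
    then show ?thesis
    proof cases
      case 1 then show ?thesis by (intro d1(2)) (use r in auto)
    next
      case 2 then show ?thesis by (intro d2(2)) (use r in auto)
    next
      case 3
      have "?f r < ?f r0" by (intro d2(2)) (use r 3 r0 in auto)
      also have "?f r0 < ?f r'" by (intro d1(2)) (use r 3 r0 in auto)
      finally show ?thesis .
    qed
  qed
  have "inj_on \<gamma> (I \<inter> ball r0 (min d1 d2))"
  proof (rule inj_onI, rule ccontr)
    fix r r' assume r: "r \<in> I \<inter> ball r0 (min d1 d2)" "r' \<in> I \<inter> ball r0 (min d1 d2)" "\<gamma> r = \<gamma> r'" "r \<noteq> r'"
    then have *: "\<bar>r - r0\<bar> < min d1 d2" "\<bar>r' - r0\<bar> < min d1 d2" by (auto simp: dist_real_def abs_minus_commute)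
    show False using less[of r r'] less[of r' r] r * by (cases "r < r'") auto
  qed
  then show ?thesis using d1(1) d2(1) by (intro exI[of _ "min d1 d2"]) simp
qed

text \<open>Cutting a simple loop open near its base point gives a nonspacelike curve whose two ends lie
  in a causally convex neighbourhood of that point, but which leaves it in between.\<close>

lemma nonspacelike_curve_injective:
  assumes sc: "\<And>p. strongly_causal_at A g T p" and ns: "nonspacelike_curve A g T I \<gamma>"
  shows "inj_on \<gamma> I"
proof (rule inj_onI)
  fix x y assume xy: "x \<in> I" "y \<in> I" "\<gamma> x = \<gamma> y"
  define a b where "a = min x y" and "b = max x y"
  note I = nonspacelike_curve_interval[OF ns] nonspacelike_curve_continuous[OF ns]
  have ab: "a \<in> I" "b \<in> I" using xy by (auto simp: a_def b_def min_def max_def)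
  then have sub: "{a..b} \<subseteq> I" using I(1) connected_contains_Icc is_interval_connected_1 by blast
  have cont: "continuous_on {a..b} \<gamma>" by (rule continuous_on_subset[OF I(2) sub])
  have loc: "\<exists>d>0. inj_on \<gamma> ({a..b} \<inter> ball r d)" if r: "r \<in> {a..b}" for r
  proof -
    obtain d where "d > 0" "inj_on \<gamma> (I \<inter> ball r d)"
      using nonspacelike_curve_locally_injective[OF ns, of r] sub r by blast
    then show ?thesis using inj_on_subset[of \<gamma> "I \<inter> ball r d" "{a..b} \<inter> ball r d"] sub by blast
  qed
  show "x = y"
  proof (rule ccontr)
    assume "x \<noteq> y"
    then have ninj: "\<not> inj_on \<gamma> {a..b}" using xy(3) unfolding inj_on_def a_def b_def by fastforce
    obtain s t where st: "a \<le> s" "s < t" "t \<le> b" "\<gamma> s = \<gamma> t"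
      and simple: "\<And>r r'. s \<le> r \<Longrightarrow> r < r' \<Longrightarrow> r' \<le> t \<Longrightarrow> \<gamma> r = \<gamma> r' \<Longrightarrow> r = s \<and> r' = t"
      by (rule minimal_loop[OF cont loc ninj]) (assumption, rule that)
    \<comment> \<open>A parameter at which the loop is away from its base point; \<open>U\<close> is
      chosen to miss its image.\<close>
    define m where "m = (s + t) / 2"
    have m: "s < m" "m < t" using st(2) by (simp_all add: m_def)
    have "\<gamma> s \<noteq> \<gamma> m" using simple[of s m] m by auto
    then have "open (- {\<gamma> m}) \<and> \<gamma> s \<in> - {\<gamma> m}" by auto
    then obtain U where U: "causally_convex A g T U" "\<gamma> s \<in> U" "U \<subseteq> - {\<gamma> m}"
      using sc[of "\<gamma> s"] unfolding strongly_causal_at_def by blast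
    have oU: "open U" by (rule causally_convex_open[OF U(1)])
    have cst: "continuous_on {s..t} \<gamma>" by (rule continuous_on_subset[OF cont]) (use st in auto)
    have "openin (top_of_set {s..t}) ({s..t} \<inter> \<gamma> -` U)"
      by (rule continuous_openin_preimage_gen[OF cst oU])
    moreover have "s \<in> {s..t} \<inter> \<gamma> -` U" "t \<in> {s..t} \<inter> \<gamma> -` U" using st U(2) by auto
    ultimately obtain e1 e2 where e: "e1 > 0" "ball s e1 \<inter> {s..t} \<subseteq> \<gamma> -` U" "e2 > 0" "ball t e2 \<inter> {s..t} \<subseteq> \<gamma> -` U"
      unfolding openin_contains_ball by (meson le_inf_iff)
    \<comment> \<open>The loop is cut strictly after \<open>s\<close> and strictly before
      \<open>t\<close>. Without the repeated base point the remaining curve is injective, while both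
      its ends still lie in \<open>U\<close>.\<close>
    obtain d1 where d1: "d1 > 0" "d1 < e1" "d1 < m - s"
      using field_lbound_gt_zero[of e1 "m - s"] e(1) m(1) by auto
    obtain d2 where d2: "d2 > 0" "d2 < e2" "d2 < t - m"
      using field_lbound_gt_zero[of e2 "t - m"] e(3) m(2) by auto
    define s' t' where "s' = s + d1" and "t' = t - d2"
    have s': "s < s'" "s' < m" "s' - s < e1" and t': "m < t'" "t' < t" "t - t' < e2"
      using d1 d2 by (simp_all add: s'_def t'_def)
    then have "s' \<in> ball s e1 \<inter> {s..t}" "t' \<in> ball t e2 \<inter> {s..t}"
      using m by (auto simp: dist_real_def)
    then have ends: "\<gamma> s' \<in> U" "\<gamma> t' \<in> U" using e by auto
    have "inj_on \<gamma> {s'..t'}"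
    proof (rule inj_onI, rule ccontr)
      fix r r' assume "r \<in> {s'..t'}" "r' \<in> {s'..t'}" "\<gamma> r = \<gamma> r'" "r \<noteq> r'"
      then show False using simple[of r r'] simple[of r' r] s' t' by (cases "r < r'") auto
    qed
    moreover have "nonspacelike_curve A g T {s'..t'} \<gamma>"
    proof (rule nonspacelike_curve_subinterval[OF ns])
      show "{s'..t'} \<subseteq> I" using sub st s' t' by auto
      show "interior {s'..t'} \<noteq> {}" using s' t' by (simp add: interior_atLeastAtMost_real)
    qed (simp add: is_interval_cc)
    then have "connected (\<gamma> ` {s'..t'} \<inter> U)" by (rule causally_convex_connected[OF U(1)])
    moreover have "continuous_on {s'..t'} \<gamma>" by (rule continuous_on_subset[OF cst]) (use s' t' in auto)
    ultimately have "\<gamma> m \<in> U"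
      by (intro inj_curve_connected_trace[of s' t' \<gamma> U m] ends) (use s' t' in auto)
    then show False using U(3) by blast
  qed
qed

text \<open>The form of causal convexity that combines with lifting, since it concerns the
  parameters between two visits rather than the trace.\<close>

lemma causally_convex_parameters:
  assumes sc: "\<And>p. strongly_causal_at A g T p" and ns: "nonspacelike_curve A g T I \<gamma>"
    and U: "causally_convex A g T U" and st: "s \<in> I" "t \<in> I" "\<gamma> s \<in> U" "\<gamma> t \<in> U" and r: "s \<le> r" "r \<le> t"
  shows "\<gamma> r \<in> U"
proof (cases "s < t")
  case True
  note I = nonspacelike_curve_interval[OF ns] nonspacelike_curve_continuous[OF ns]
  then have sub: "{s..t} \<subseteq> I" using st connected_contains_Icc is_interval_connected_1 by blast
  have ns': "nonspacelike_curve A g T {s..t} \<gamma>"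
    by (rule nonspacelike_curve_subinterval[OF ns _ _ sub])
       (use True in \<open>simp_all add: is_interval_cc interior_atLeastAtMost_real\<close>)
  show ?thesis
    by (rule inj_curve_connected_trace[OF continuous_on_subset[OF I(2) sub]
          nonspacelike_curve_injective[OF sc ns'] causally_convex_connected[OF U ns'] st(3,4)])
       (use r in auto)
next
  case False
  then have "r = s" using r by simp
  then show ?thesis using st by simp
qed

section \<open>Null geodesics as nonspacelike curves\<close>

lemma geodesic_orientation_continuous:
  assumes geo: "geodesic A g J \<gamma>"
  shows "continuous_on J (\<lambda>t. g (\<gamma> t) (velocity A \<gamma> UNIV t) (T (\<gamma> t)))"
proof (rule continuous_at_imp_continuous_on, intro ballI)
  fix t assume t: "t \<in> J"
  obtain c where c: "c \<in> A" "\<gamma> t \<in> fst c" by (rule chart_at)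
  let ?R = "J \<inter> \<gamma> -` fst c" and ?x = "snd c \<circ> \<gamma>"
  have x: "smooth_on ?R ?x" by (rule smooth_curve_chart(1)[OF geodesic_smooth[OF geo] c(1)])
  have "smooth_on (snd c ` fst c) (\<lambda>q. T (chart_inv c q) c)"
    using orientation c(1) unfolding smooth_vector_field_def by blast
  then have tau: "smooth_on ?R (\<lambda>s. T (chart_inv c (?x s)) c)"
    by (rule smooth_on_compose[OF _ x]) auto
  have "smooth_on ?R (\<lambda>s. metric_coeff A g c (?x s) (vector_derivative ?x (at s)) (T (chart_inv c (?x s)) c))"
    by (rule lorentz_coords.smooth_on_coeff[OF coords[OF c(1)] x smooth_on_vector_derivative[OF x] tau]) auto
  then have "continuous_on ?R (\<lambda>s. metric_coeff A g c (?x s) (vector_derivative ?x (at s)) (T (chart_inv c (?x s)) c))"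
    by (rule smooth_on_imp_continuous_on)
  moreover have "metric_coeff A g c (?x s) (vector_derivative ?x (at s)) (T (chart_inv c (?x s)) c) =
      g (\<gamma> s) (velocity A \<gamma> UNIV s) (T (\<gamma> s))" if s: "s \<in> ?R" for s
  proof -
    have "g (\<gamma> s) (velocity A \<gamma> UNIV s) (T (\<gamma> s)) =
        metric_coeff A g c (snd c (\<gamma> s)) (velocity A \<gamma> UNIV s c) (T (\<gamma> s) c)"
      by (rule metric_eq_coeff[OF c(1) _ smooth_curve_velocity[OF geodesic_smooth[OF geo]] orientation_tangent])
         (use s in auto)
    then show ?thesis using s c(1) by (simp add: velocity_def)
  qed
  ultimately have "continuous_on ?R (\<lambda>t. g (\<gamma> t) (velocity A \<gamma> UNIV t) (T (\<gamma> t)))"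
    by (rule continuous_on_eq)
  then show "isCont (\<lambda>t. g (\<gamma> t) (velocity A \<gamma> UNIV t) (T (\<gamma> t))) t"
    using smooth_on_open[OF x] t c(2) by (simp add: continuous_on_eq_continuous_at)
qed

text \<open>The pairing of the velocity with \<open>T\<close> is continuous, and nonzero because a
  null vector is never orthogonal to a timelike one. So it has a single sign on the connected
  domain.\<close>

lemma null_geodesic_nonspacelike:
  assumes null: "null_geodesic A g J \<gamma>"
  shows "nonspacelike_curve A g T J \<gamma>"
proof -
  have geo: "geodesic A g J \<gamma>" and nv: "\<And>t. t \<in> J \<Longrightarrow> null_vec g (\<gamma> t) (velocity A \<gamma> J t)"
    using null by (simp_all add: null_geodesic_eq)
  let ?V = "velocity A \<gamma> UNIV"
  note sm = geodesic_smooth[OF geo]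
  have V: "velocity A \<gamma> J t = ?V t" if "t \<in> J" for t by (rule velocity_open[OF geodesic_open[OF geo] that])
  have arc: "smooth_arc A \<gamma> s t" if "{s..t} \<subseteq> J" for s t
    unfolding smooth_arc_def using sm that by blast
  have pw: "piecewise_smooth_curve A J \<gamma>"
    unfolding piecewise_smooth_curve_def
  proof (intro conjI allI impI)
    show "interior J \<noteq> {}" using geodesic_open[OF geo] geodesic_nonempty[OF geo] by (simp add: interior_open)
    fix a b assume "a < b \<and> {a..b} \<subseteq> J"
    then show "\<exists>D. finite D \<and> (\<forall>s t. a \<le> s \<and> s < t \<and> t \<le> b \<and> {s<..<t} \<inter> D = {} \<longrightarrow> smooth_arc A \<gamma> s t)"
      by (intro exI[of _ "{}"] conjI allI impI arc) auto
  qed (use geodesic_interval[OF geo] geodesic_continuous[OF geo] in auto)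
  have vv: "\<exists>r\<in>J. p = \<gamma> r \<and> v = ?V r" if "(p, v) \<in> velocity_vectors A J \<gamma>" for p v
  proof -
    have "\<exists>r s t. (p, v) = (\<gamma> r, velocity A \<gamma> {s..t} r) \<and> s < t \<and> {s..t} \<subseteq> J \<and> smooth_arc A \<gamma> s t \<and> r \<in> {s..t}"
      using that unfolding velocity_vectors_def by (rule CollectD)
    then obtain r s t where "(p, v) = (\<gamma> r, velocity A \<gamma> {s..t} r) \<and> s < t \<and> {s..t} \<subseteq> J \<and> smooth_arc A \<gamma> s t \<and> r \<in> {s..t}"
      by (elim exE)
    then have r: "p = \<gamma> r" "v = velocity A \<gamma> {s..t} r" "s < t" "{s..t} \<subseteq> J" "r \<in> {s..t}" by simp_all
    have "r \<in> J" using r(4,5) by blast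
    then show ?thesis using arc_velocity[OF r(3) sm r(4) refl r(5)] r(1,2) by (intro bexI[of _ r]) simp_all
  qed
  have nonzero: "g (\<gamma> r) (?V r) (T (\<gamma> r)) \<noteq> 0" if r: "r \<in> J" for r
  proof
    assume 0: "g (\<gamma> r) (?V r) (T (\<gamma> r)) = 0"
    obtain c where c: "c \<in> A" "\<gamma> r \<in> fst c" by (rule chart_at)
    have q: "snd c (\<gamma> r) \<in> snd c ` fst c" using c by blast
    have v: "?V r \<in> tangent_space A (\<gamma> r)" by (rule smooth_curve_velocity[OF sm r])
    have "?V r c = 0"
      by (rule lorentz_form_timelike_orthogonal[OF lorentz_coords.form[OF coords[OF c(1)] q], of "T (\<gamma> r) c"])
         (use 0 timelike_orientation[of "\<gamma> r"] nv[OF r] V[OF r] metric_eq_coeff[OF c v orientation_tangent]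
            metric_eq_coeff[OF c v v] metric_eq_coeff[OF c orientation_tangent orientation_tangent]
          in \<open>simp_all add: null_vec_def\<close>)
    then show False using nv[OF r] V[OF r] tangent_nonzero[OF v c] by (simp add: null_vec_def)
  qed
  let ?h = "\<lambda>t. g (\<gamma> t) (?V t) (T (\<gamma> t))"
  have "connected (?h ` J)"
    by (rule connected_continuous_image[OF geodesic_orientation_continuous[OF geo]])
       (use geodesic_interval[OF geo] in \<open>simp add: is_interval_connected_1\<close>)
  note conn = this
  have sgn: "(\<forall>r\<in>J. ?h r < 0) \<or> (\<forall>r\<in>J. ?h r > 0)"
  proof (rule ccontr)
    assume "\<not> ((\<forall>r\<in>J. ?h r < 0) \<or> (\<forall>r\<in>J. ?h r > 0))"
    then obtain r1 r2 where r: "r1 \<in> J" "\<not> ?h r1 < 0" "r2 \<in> J" "\<not> ?h r2 > 0" by blast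
    have "{?h r2..?h r1} \<subseteq> ?h ` J" by (rule connected_contains_Icc[OF conn]) (use r in auto)
    then have "0 \<in> ?h ` J" using r(2,4) by (auto dest!: subsetD[where c = 0])
    then show False using nonzero by auto
  qed
  show ?thesis
    unfolding nonspacelike_curve_def
  proof (intro conjI pw)
    show "\<forall>(p, v)\<in>velocity_vectors A J \<gamma>. nonspacelike g p v"
      using vv nv V by (fastforce simp: nonspacelike_def null_vec_def)
    show "(\<forall>(p, v)\<in>velocity_vectors A J \<gamma>. g p v (T p) < 0) \<or> (\<forall>(p, v)\<in>velocity_vectors A J \<gamma>. g p v (T p) > 0)"
      using sgn vv by fast
  qed
qed

lemma null_geodesic_parameters:
  assumes "\<And>p. strongly_causal_at A g T p" "null_geodesic A g J \<gamma>" "causally_convex A g T U"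
    "s \<in> J" "t \<in> J" "\<gamma> s \<in> U" "\<gamma> t \<in> U" "s \<le> r" "r \<le> t"
  shows "\<gamma> r \<in> U"
  by (rule causally_convex_parameters[OF assms(1) null_geodesic_nonspacelike[OF assms(2)] assms(3-9)])

end

section \<open>Strong causality of the covering space-time\<close>

context lorentz_cover
begin

sublocale down: oriented A g T
  by unfold_locales (fact field, fact timelike)

sublocale up: oriented A' g' T'
  by unfold_locales (fact smooth_vector_field_cover, fact timelike_cover)

lemma smooth_arc_projection: "smooth_arc A' \<gamma> s t \<Longrightarrow> smooth_arc A (\<rho> \<circ> \<gamma>) s t"
  unfolding smooth_arc_def
proof (elim exE conjE)
  fix J \<sigma> assume "{s..t} \<subseteq> J" "smooth_curve_on A' J \<sigma>" "\<forall>r\<in>{s..t}. \<sigma> r = \<gamma> r"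
  then show "\<exists>J \<sigma>. {s..t} \<subseteq> J \<and> smooth_curve_on A J \<sigma> \<and> (\<forall>r\<in>{s..t}. \<sigma> r = (\<rho> \<circ> \<gamma>) r)"
    by (intro exI[of _ J] exI[of _ "\<rho> \<circ> \<sigma>"]) (simp add: smooth_curve_projection)
qed

text \<open>\<open>smooth_arc\<close> requires a smooth curve on an open set around the interval.
  Such an extension \<open>\<sigma>\<close> exists below; it is lifted itself, and by unique lifting
  the lift agrees with \<open>\<gamma>\<close> on the interval.\<close>

lemma smooth_arc_lift:
  assumes cont: "continuous_on {s..t} \<gamma>" and st: "s < t" and arc: "smooth_arc A (\<rho> \<circ> \<gamma>) s t"
  shows "smooth_arc A' \<gamma> s t"
proof -
  obtain J \<sigma> where \<sigma>: "{s..t} \<subseteq> J" "smooth_curve_on A J \<sigma>" "\<And>r. r \<in> {s..t} \<Longrightarrow> \<sigma> r = \<rho> (\<gamma> r)"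
    using arc unfolding smooth_arc_def by auto
  have oJ: "open J" and cJ: "continuous_on J \<sigma>" using \<sigma>(2) unfolding smooth_curve_on_def by blast+
  have "s \<in> J" "t \<in> J" using \<sigma>(1) st by auto
  obtain d1 where d1: "d1 > 0" "ball s d1 \<subseteq> J" using oJ \<open>s \<in> J\<close> openE by blast
  obtain d2 where d2: "d2 > 0" "ball t d2 \<subseteq> J" using oJ \<open>t \<in> J\<close> openE by blast
  \<comment> \<open>\<open>J\<close> may be disconnected, whereas lifting needs an open interval
    around \<open>{s..t}\<close>.\<close>
  let ?K = "{s - d1<..<t + d2}"
  have KJ: "?K \<subseteq> J"
  proof
    fix r assume r: "r \<in> ?K"
    consider "r < s" | "r \<in> {s..t}" | "t < r" by fastforce
    then show "r \<in> J"
    proof cases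
      case 1
      then have "r \<in> ball s d1" using r by (simp add: dist_real_def)
      then show ?thesis using d1(2) by blast
    next
      case 2
      then show ?thesis using \<sigma>(1) by blast
    next
      case 3
      then have "r \<in> ball t d2" using r by (simp add: dist_real_def)
      then show ?thesis using d2(2) by blast
    qed
  qed
  have stK: "{s..t} \<subseteq> ?K" using d1(1) d2(1) by auto
  have sm: "smooth_curve_on A ?K \<sigma>" by (rule down.smooth_curve_on_subset[OF \<sigma>(2) _ KJ]) simp
  have cK: "continuous_on ?K \<sigma>" by (rule continuous_on_subset[OF cJ KJ])
  have iK: "is_interval ?K" by (auto simp: is_interval_1)
  have sK: "s \<in> ?K" using d1(1) d2(1) st by simp
  have start: "\<rho> (\<gamma> s) = \<sigma> s" using \<sigma>(3)[of s] st by simp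
  obtain \<tau> where \<tau>: "continuous_on ?K \<tau>" "\<And>r. r \<in> ?K \<Longrightarrow> \<rho> (\<tau> r) = \<sigma> r" "\<tau> s = \<gamma> s"
    by (rule lift_exists[OF evenly_covered_at iK open_greaterThanLessThan cK sK start]) (rule that)
  have "smooth_curve_on A ?K (\<rho> \<circ> \<tau>)"
  proof (rule down.smooth_curve_onI)
    show "continuous_on ?K (\<rho> \<circ> \<tau>)" by (rule continuous_projection[OF \<tau>(1)])
    fix r assume r: "r \<in> ?K"
    obtain c where c: "c \<in> A" "\<sigma> r \<in> fst c" by (rule down.chart_at)
    let ?R = "?K \<inter> \<sigma> -` fst c"
    have "smooth_on ?R (snd c \<circ> \<sigma>)" by (rule down.smooth_curve_chart(1)[OF sm c(1)])
    moreover have "(snd c \<circ> (\<rho> \<circ> \<tau>)) x = (snd c \<circ> \<sigma>) x" if "x \<in> ?R" for x using \<tau>(2) that by simp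
    ultimately have "smooth_on ?R (snd c \<circ> (\<rho> \<circ> \<tau>))" by (subst smooth_on_cong)
    then show "\<exists>c\<in>A. \<exists>R. r \<in> R \<and> R \<subseteq> ?K \<and> (\<rho> \<circ> \<tau>) ` R \<subseteq> fst c \<and> smooth_on R (snd c \<circ> (\<rho> \<circ> \<tau>))"
      by (intro bexI[OF _ c(1)] exI[of _ ?R]) (use r c(2) \<tau>(2) in auto)
  qed simp
  then have smt: "smooth_curve_on A' ?K \<tau>" by (rule smooth_curve_lift[OF \<tau>(1)])
  have "\<tau> r = \<gamma> r" if r: "r \<in> {s..t}" for r
  proof (rule lift_unique[where S = "{s..t}" and s = s and \<alpha> = \<tau> and \<beta> = \<gamma> and \<rho> = \<rho>, OF evenly_covered_at _ _ cont _ _ \<tau>(3) r])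
    show "continuous_on {s..t} \<tau>" by (rule continuous_on_subset[OF \<tau>(1) stK])
    show "\<rho> (\<tau> r) = \<rho> (\<gamma> r)" if "r \<in> {s..t}" for r
      using \<tau>(2)[of r] \<sigma>(3)[OF that] stK that by auto
  qed (use st in auto)
  then show ?thesis
    unfolding smooth_arc_def by (intro exI[of _ ?K] exI[of _ \<tau>] conjI stK smt ballI)
qed

lemma velocity_projection:
  assumes st: "s < t" and arc: "smooth_arc A' \<gamma> s t" and r: "r \<in> {s..t}"
  shows "differential A' A \<rho> (\<gamma> r) (velocity A' \<gamma> {s..t} r) = velocity A (\<rho> \<circ> \<gamma>) {s..t} r"
    and "velocity A' \<gamma> {s..t} r = (\<lambda>_. 0) \<longleftrightarrow> velocity A (\<rho> \<circ> \<gamma>) {s..t} r = (\<lambda>_. 0)"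
proof -
  obtain c d where cd: "adapted c d" "\<gamma> r \<in> fst c" "\<rho> (\<gamma> r) \<in> fst d" "c \<in> A'" "d \<in> A" by (rule adapted_at)
  have v': "velocity A' \<gamma> {s..t} r \<in> tangent_space A' (\<gamma> r)" by (rule up.arc_velocity_tangent[OF st arc r])
  have "velocity A (\<rho> \<circ> \<gamma>) {s..t} r \<in> tangent_space A ((\<rho> \<circ> \<gamma>) r)"
    by (rule down.arc_velocity_tangent[OF st smooth_arc_projection[OF arc] r])
  then have v: "velocity A (\<rho> \<circ> \<gamma>) {s..t} r \<in> tangent_space A (\<rho> (\<gamma> r))" by simp
  have eq: "velocity A (\<rho> \<circ> \<gamma>) {s..t} r d = velocity A' \<gamma> {s..t} r c"
    using cd(2-5) unfolding velocity_def adaptedD(5)[OF cd(1)] by simp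
  show "differential A' A \<rho> (\<gamma> r) (velocity A' \<gamma> {s..t} r) = velocity A (\<rho> \<circ> \<gamma>) {s..t} r"
    unfolding differential_adapted[OF cd(1,2) v'] eq[symmetric]
    by (rule down.tangent_eq_coord_vec[OF v cd(5,3), symmetric])
  show "velocity A' \<gamma> {s..t} r = (\<lambda>_. 0) \<longleftrightarrow> velocity A (\<rho> \<circ> \<gamma>) {s..t} r = (\<lambda>_. 0)"
    unfolding top.tangent_nonzero[OF v' cd(4,2)] down.tangent_nonzero[OF v cd(5,3)] eq ..
qed

text \<open>The velocity vectors of the projection come from all intervals on which the projection
  is a smooth arc. By \<open>smooth_arc_lift\<close> the curve itself is smooth there, so each of
  them is the image of a velocity vector upstairs with the same inner products.\<close>

lemma nonspacelike_curve_projection: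
  assumes ns: "nonspacelike_curve A' g' T' I \<gamma>"
  shows "nonspacelike_curve A g T I (\<rho> \<circ> \<gamma>)"
proof -
  have I: "is_interval I" "interior I \<noteq> {}" "continuous_on I \<gamma>"
    and pw: "\<And>a b. a < b \<Longrightarrow> {a..b} \<subseteq> I \<Longrightarrow> \<exists>D. finite D \<and>
          (\<forall>s t. a \<le> s \<and> s < t \<and> t \<le> b \<and> {s<..<t} \<inter> D = {} \<longrightarrow> smooth_arc A' \<gamma> s t)"
    and nsl: "\<forall>(p, v) \<in> velocity_vectors A' I \<gamma>. nonspacelike g' p v"
    and sgn: "(\<forall>(p, v) \<in> velocity_vectors A' I \<gamma>. g' p v (T' p) < 0) \<or>
      (\<forall>(p, v) \<in> velocity_vectors A' I \<gamma>. g' p v (T' p) > 0)"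
    using ns unfolding nonspacelike_curve_def piecewise_smooth_curve_def by blast+
  have pw': "piecewise_smooth_curve A I (\<rho> \<circ> \<gamma>)"
    unfolding piecewise_smooth_curve_def
    by (intro conjI I continuous_projection allI impI) (meson pw smooth_arc_projection)
  have vv: "\<exists>p' v'. (p', v') \<in> velocity_vectors A' I \<gamma> \<and> (nonspacelike g' p' v' \<longrightarrow> nonspacelike g p v) \<and>
      g p v (T p) = g' p' v' (T' p')" if "(p, v) \<in> velocity_vectors A I (\<rho> \<circ> \<gamma>)" for p v
  proof -
    have "\<exists>r s t. (p, v) = ((\<rho> \<circ> \<gamma>) r, velocity A (\<rho> \<circ> \<gamma>) {s..t} r) \<and> s < t \<and> {s..t} \<subseteq> I \<and>
        smooth_arc A (\<rho> \<circ> \<gamma>) s t \<and> r \<in> {s..t}"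
      using that unfolding velocity_vectors_def by (rule CollectD)
    then obtain r s t where "(p, v) = ((\<rho> \<circ> \<gamma>) r, velocity A (\<rho> \<circ> \<gamma>) {s..t} r) \<and> s < t \<and> {s..t} \<subseteq> I \<and>
        smooth_arc A (\<rho> \<circ> \<gamma>) s t \<and> r \<in> {s..t}" by (elim exE)
    then have r: "p = \<rho> (\<gamma> r)" "v = velocity A (\<rho> \<circ> \<gamma>) {s..t} r" "s < t" "{s..t} \<subseteq> I"
      "smooth_arc A (\<rho> \<circ> \<gamma>) s t" "r \<in> {s..t}" by simp_all
    have arc: "smooth_arc A' \<gamma> s t"
      by (rule smooth_arc_lift[OF continuous_on_subset[OF I(3) r(4)] r(3,5)])
    let ?v = "velocity A' \<gamma> {s..t} r"
    have v': "?v \<in> tangent_space A' (\<gamma> r)" by (rule up.arc_velocity_tangent[OF r(3) arc r(6)])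
    note D = velocity_projection[OF r(3) arc r(6)]
    have mem: "(\<gamma> r, ?v) \<in> velocity_vectors A' I \<gamma>"
      unfolding velocity_vectors_def using r arc by blast
    have g1: "g' (\<gamma> r) ?v ?v = g p v v"
      using metric_pullback[OF v' v'] unfolding D(1) r(1,2) .
    have g2: "g' (\<gamma> r) ?v (T' (\<gamma> r)) = g p v (T p)"
      using metric_pullback[OF v' orientation_lift(1)] unfolding D(1) orientation_lift(2) r(1,2) .
    show ?thesis
      by (rule exI[of _ "\<gamma> r"], rule exI[of _ ?v])
         (use mem g1 g2 D(2) r(2) in \<open>simp add: nonspacelike_def\<close>)
  qed
  show ?thesis
    unfolding nonspacelike_curve_def
  proof (intro conjI pw')
    show "\<forall>(p, v)\<in>velocity_vectors A I (\<rho> \<circ> \<gamma>). nonspacelike g p v"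
      using vv nsl by fast
    show "(\<forall>(p, v)\<in>velocity_vectors A I (\<rho> \<circ> \<gamma>). g p v (T p) < 0) \<or>
        (\<forall>(p, v)\<in>velocity_vectors A I (\<rho> \<circ> \<gamma>). g p v (T p) > 0)"
      using sgn
    proof
      assume *: "\<forall>(p, v) \<in> velocity_vectors A' I \<gamma>. g' p v (T' p) < 0"
      have "g p v (T p) < 0" if "(p, v) \<in> velocity_vectors A I (\<rho> \<circ> \<gamma>)" for p v
        using vv[OF that] * by auto
      then show ?thesis by blast
    next
      assume *: "\<forall>(p, v) \<in> velocity_vectors A' I \<gamma>. g' p v (T' p) > 0"
      have "g p v (T p) > 0" if "(p, v) \<in> velocity_vectors A I (\<rho> \<circ> \<gamma>)" for p v
        using vv[OF that] * by auto
      then show ?thesis by blast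
    qed
  qed
qed

text \<open>The part of a sheet over a causally convex set is again causally convex: between two
  visits the projection stays in \<open>U1\<close>, hence in the evenly covered \<open>U\<close>,
  and so the curve cannot change sheets.\<close>

lemma strongly_causal_cover:
  assumes sc: "\<And>p. strongly_causal_at A g T p"
  shows "strongly_causal_at A' g' T' p"
  unfolding strongly_causal_at_def
proof (intro allI impI, elim conjE)
  fix W assume W: "open W" "p \<in> W"
  obtain U \<V> where U: "\<rho> p \<in> U" "evenly_covered \<rho> U \<V>" using evenly_covered_at by blast
  obtain V where V: "V \<in> \<V>" "p \<in> V" using sheet_at[OF U(2,1)] by blast
  have oV: "open V" by (rule sheet_open[OF U(2) V(1)])
  have "open (\<rho> ` (W \<inter> V))" by (rule sheet_image_open[OF U(2) V(1)]) (use W oV in auto)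
  then obtain U1 where U1: "causally_convex A g T U1" "\<rho> p \<in> U1" "U1 \<subseteq> \<rho> ` (W \<inter> V)"
    using sc[of "\<rho> p"] W V unfolding strongly_causal_at_def by blast
  have VU: "\<rho> ` V \<subseteq> U" using U(2) V(1) unfolding evenly_covered_def by blast
  have U1U: "U1 \<subseteq> U" using U1(3) VU by blast
  let ?U' = "V \<inter> \<rho> -` U1"
  have sub: "?U' \<subseteq> W"
  proof
    fix x assume x: "x \<in> ?U'"
    then obtain y where "y \<in> W \<inter> V" "\<rho> x = \<rho> y" using U1(3) by blast
    then show "x \<in> W" using sheet_inj[OF U(2) V(1), of x y] x by blast
  qed
  have op: "open ?U'" using oV open_preimage[OF causally_convex_open[OF U1(1)]] by blast
  have "causally_convex A' g' T' ?U'"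
    unfolding causally_convex_def
  proof (intro conjI op allI impI)
    fix I \<gamma> assume ns: "nonspacelike_curve A' g' T' I \<gamma>"
    note ns' = nonspacelike_curve_projection[OF ns]
    note I = nonspacelike_curve_interval[OF ns] nonspacelike_curve_continuous[OF ns]
    let ?S = "{t\<in>I. \<gamma> t \<in> ?U'}"
    have "connected ?S"
      unfolding connected_iff_interval
    proof (intro ballI allI impI)
      fix s t r assume s: "s \<in> ?S" and t: "t \<in> ?S" and r: "s \<le> r" "r \<le> t"
      have stI: "{s..t} \<subseteq> I" using s t I(1) connected_contains_Icc is_interval_connected_1 by blast
      have in1: "\<rho> (\<gamma> x) \<in> U1" if x: "x \<in> {s..t}" for x
      proof -
        have "(\<rho> \<circ> \<gamma>) x \<in> U1"
          by (rule down.causally_convex_parameters[OF sc ns' U1(1), of s t x]) (use s t x in auto)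
        then show ?thesis by simp
      qed
      have "\<gamma> ` {s..t} \<subseteq> V"
      proof (rule sheet_contains_connected[OF U(2) V(1)])
        show "connected (\<gamma> ` {s..t})"
          by (rule connected_continuous_image[OF continuous_on_subset[OF I(2) stI] connected_Icc])
        show "\<gamma> ` {s..t} \<subseteq> \<rho> -` U" using in1 U1U by blast
        have "\<gamma> s \<in> \<gamma> ` {s..t} \<inter> V" using s r by auto
        then show "\<gamma> ` {s..t} \<inter> V \<noteq> {}" by blast
      qed
      then show "r \<in> ?S" using in1[of r] r stI by auto
    qed
    then have "connected (\<gamma> ` ?S)"
      by (rule connected_continuous_image[OF continuous_on_subset[OF I(2)], rotated]) auto
    moreover have "\<gamma> ` ?S = \<gamma> ` I \<inter> ?U'" by blast
    ultimately show "connected (\<gamma> ` I \<inter> ?U')" by simp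
  qed
  then show "\<exists>U. causally_convex A' g' T' U \<and> p \<in> U \<and> U \<subseteq> W"
    using V(2) U1(2) sub by (intro exI[of _ ?U']) simp
qed

end

section \<open>Null geodesics through an event enter a single sheet\<close>

context lorentz_manifold
begin

text \<open>The geodesics that continuous dependence provides may be short. Extending them to
  inextendible ones only enlarges the image, so they still meet \<open>X\<close>.\<close>

lemma null_directions_meeting_open:
  assumes c: "c \<in> A" and X: "open X" and N: "\<And>v. v \<in> N \<Longrightarrow> v \<noteq> 0 \<and> metric_coeff A g c q v v = 0"
  shows "openin (top_of_set N) {v\<in>N. \<exists>J \<gamma>. null_geodesic A g J \<gamma> \<and> initial c 0 (q, v) J \<gamma> \<and> \<gamma> ` J \<inter> X \<noteq> {}}"
    (is "openin _ ?E")
  unfolding openin_contains_ball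
proof (intro conjI ballI)
  fix v assume "v \<in> ?E"
  then obtain J \<gamma> where v: "v \<in> N" and J: "null_geodesic A g J \<gamma> \<and> initial c 0 (q, v) J \<gamma> \<and> \<gamma> ` J \<inter> X \<noteq> {}"
    by (elim CollectE conjE exE) blast
  then obtain t where t: "t \<in> J" "\<gamma> t \<in> X" by blast
  have ini: "initial c 0 (q, v) J \<gamma>" using J by blast
  obtain d where d: "d > 0" "\<And>w. dist w v < d \<Longrightarrow> \<exists>J' \<gamma>'. initial c 0 (q, w) J' \<gamma>' \<and> t \<in> J' \<and> \<gamma>' t \<in> X"
    by (rule geodesics_through_open_set[OF c ini t(1) X t(2)]) (rule that)
  have "w \<in> ?E" if w: "w \<in> ball v d \<inter> N" for w
  proof -
    have "dist w v < d" using w by (simp add: dist_commute)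
    from d(2)[OF this] obtain J' \<gamma>' where J': "initial c 0 (q, w) J' \<gamma>' \<and> t \<in> J' \<and> \<gamma>' t \<in> X" by (elim exE)
    then have "initial c 0 (q, w) J' \<gamma>'" by simp
    then obtain M \<mu> where M: "initial c 0 (q, w) M \<mu>" "inextendible M \<mu>" "J' \<subseteq> M" "\<And>t. t \<in> J' \<Longrightarrow> \<mu> t = \<gamma>' t"
      by (rule maximal_geodesic[OF _ c]) (rule that)
    have "null_geodesic A g M \<mu>"
      by (rule null_geodesicI[OF c M(1,2)]) (use N[of w] w in auto)
    moreover have "t \<in> M" "\<mu> t \<in> X" using J' M(3) M(4)[of t] by auto
    ultimately have "\<exists>J \<gamma>. null_geodesic A g J \<gamma> \<and> initial c 0 (q, w) J \<gamma> \<and> \<gamma> ` J \<inter> X \<noteq> {}"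
      using M(1) by blast
    then show ?thesis using w by simp
  qed
  then show "\<exists>\<epsilon>>0. ball v \<epsilon> \<inter> N \<subseteq> ?E" using d(1) by blast
qed blast

text \<open>The directions in \<open>N\<close> that lead to \<open>W\<close> and those that lead to
  another sheet form two disjoint, relatively open sets covering the connected set \<open>N\<close>.
  The first contains the direction of \<open>\<gamma>0\<close>, up to sign, so the second is
  empty.\<close>

lemma null_geodesics_same_sheet:
  assumes dim: "DIM('e) \<ge> 3" and disj: "pairwise disjnt \<V>" and op: "\<And>V. V \<in> \<V> \<Longrightarrow> open V"
    and enter: "\<And>J \<gamma>. null_geodesic A g J \<gamma> \<Longrightarrow> y \<in> \<gamma> ` J \<Longrightarrow> \<gamma> ` J \<inter> \<Union>\<V> \<noteq> {}"
    and conn: "\<And>J \<gamma>. null_geodesic A g J \<gamma> \<Longrightarrow> y \<in> \<gamma> ` J \<Longrightarrow> connected {t\<in>J. \<gamma> t \<in> \<Union>\<V>}"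
    and W: "W \<in> \<V>" and ex: "null_geodesic A g J0 \<gamma>0" "y \<in> \<gamma>0 ` J0" "\<gamma>0 ` J0 \<inter> W \<noteq> {}"
  shows "all_null_geodesics_enter A g y W"
proof -
  obtain c where c: "c \<in> A" "y \<in> fst c" by (rule chart_at)
  let ?q = "snd c y"
  have q: "?q \<in> snd c ` fst c" using c by blast
  note form = lorentz_coords.form[OF coords[OF c(1)] q]
  obtain N where N: "connected N" "\<And>v. v \<in> N \<Longrightarrow> v \<noteq> 0 \<and> metric_coeff A g c ?q v v = 0"
    "\<And>v. v \<noteq> 0 \<Longrightarrow> metric_coeff A g c ?q v v = 0 \<Longrightarrow> v \<in> N \<or> - v \<in> N"
    by (rule null_cone_connected[OF form dim]) (rule that)
  let ?W' = "\<Union>(\<V> - {W})"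
  define E where "E X = {v\<in>N. \<exists>J \<gamma>. null_geodesic A g J \<gamma> \<and> initial c 0 (?q, v) J \<gamma> \<and> \<gamma> ` J \<inter> X \<noteq> {}}" for X
  have EI: "v \<in> E X" if "v \<in> N" "null_geodesic A g J \<gamma>" "initial c 0 (?q, v) J \<gamma>" "\<gamma> ` J \<inter> X \<noteq> {}" for v X J \<gamma>
    unfolding E_def by (intro CollectI conjI exI[of _ J] exI[of _ \<gamma>] that)
  have un: "\<Union>\<V> = W \<union> ?W'" using W by blast
  have WW: "W \<inter> ?W' = {}"
    using pairwiseD[OF disj W] by (force simp: disjnt_iff)
  have oW: "open W" "open ?W'" using op W by auto
  have openE: "openin (top_of_set N) (E X)" if "open X" for X
    unfolding E_def by (rule null_directions_meeting_open[OF c(1) that N(2)])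
  have base: "y \<in> \<gamma> ` J" if "initial c 0 (?q, v) J \<gamma>" for v J \<gamma>
  proof -
    have "0 \<in> J" "\<gamma> 0 \<in> fst c" "state c \<gamma> 0 = (?q, v)" using that by (simp_all add: initial_def)
    then have "\<gamma> 0 = y" using chart_inj[OF c(1) _ c(2), of "\<gamma> 0"] by (simp add: state_def)
    then show ?thesis using \<open>0 \<in> J\<close> by blast
  qed
  \<comment> \<open>The initial velocity determines the inextendible geodesic, so the existential
    statement in \<open>E\<close> is about one image only.\<close>
  have same: "\<gamma>2 ` J2 = \<gamma>1 ` J1"
    if "null_geodesic A g J1 \<gamma>1" "initial c 0 (?q, v) J1 \<gamma>1" "null_geodesic A g J2 \<gamma>2" "initial c 0 (?q, v) J2 \<gamma>2"
    for v J1 \<gamma>1 J2 \<gamma>2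
  proof -
    have ext: "inextendible J1 \<gamma>1" "inextendible J2 \<gamma>2" using that(1,3) by (simp_all add: null_geodesic_eq)
    have "J1 = J2"
      using inextendible_unique(1)[OF that(2,4) c(1) ext(2)] inextendible_unique(1)[OF that(4,2) c(1) ext(1)] by blast
    moreover have "\<gamma>1 t = \<gamma>2 t" if "t \<in> J1" for t
      by (rule inextendible_unique(2)[OF \<open>initial c 0 (?q, v) J1 \<gamma>1\<close> \<open>initial c 0 (?q, v) J2 \<gamma>2\<close> c(1) ext(2) that])
    ultimately show ?thesis by (auto simp: image_iff)
  qed
  have cover: "N \<subseteq> E W \<union> E ?W'"
  proof
    fix v assume v: "v \<in> N"
    obtain J \<gamma> where J: "null_geodesic A g J \<gamma>" "initial c 0 (?q, v) J \<gamma>"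
      by (rule null_geodesic_exists[OF c, of v]) (use N(2)[OF v] that in auto)
    have "\<gamma> ` J \<inter> (W \<union> ?W') \<noteq> {}" using enter[OF J(1) base[OF J(2)]] unfolding un .
    then have "\<gamma> ` J \<inter> W \<noteq> {} \<or> \<gamma> ` J \<inter> ?W' \<noteq> {}" by blast
    then show "v \<in> E W \<union> E ?W'" using EI[OF v J, of W] EI[OF v J, of ?W'] by blast
  qed
  \<comment> \<open>A geodesic meeting both \<open>W\<close> and another sheet would do so over a
    connected set of parameters, whose image would then be separated by two disjoint open
    sets.\<close>
  have disjE: "E W \<inter> E ?W' = {}"
  proof (rule ccontr)
    assume "E W \<inter> E ?W' \<noteq> {}"
    then obtain v where "v \<in> E W" "v \<in> E ?W'" by blast
    then obtain J1 \<gamma>1 J2 \<gamma>2 where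
      1: "null_geodesic A g J1 \<gamma>1 \<and> initial c 0 (?q, v) J1 \<gamma>1 \<and> \<gamma>1 ` J1 \<inter> W \<noteq> {}" and
      2: "null_geodesic A g J2 \<gamma>2 \<and> initial c 0 (?q, v) J2 \<gamma>2 \<and> \<gamma>2 ` J2 \<inter> ?W' \<noteq> {}"
      unfolding E_def by (elim CollectE conjE exE) blast
    have "\<gamma>2 ` J2 = \<gamma>1 ` J1" using same 1 2 by blast
    then have meets: "\<gamma>1 ` J1 \<inter> W \<noteq> {}" "\<gamma>1 ` J1 \<inter> ?W' \<noteq> {}" using 1 2 by simp_all
    let ?S = "{t\<in>J1. \<gamma>1 t \<in> \<Union>\<V>}"
    have "connected ?S" using conn[of J1 \<gamma>1] base[of v J1 \<gamma>1] 1 by blast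
    moreover have "continuous_on ?S \<gamma>1"
      by (rule continuous_on_subset[OF geodesic_continuous]) (use 1 in \<open>auto simp: null_geodesic_eq\<close>)
    ultimately have "connected (\<gamma>1 ` ?S)" by (intro connected_continuous_image)
    moreover have "\<gamma>1 ` ?S \<subseteq> W \<union> ?W'" using un by blast
    moreover have "\<gamma>1 ` ?S \<inter> W \<noteq> {}" "\<gamma>1 ` ?S \<inter> ?W' \<noteq> {}" using meets un by blast+
    ultimately show False using connectedD[of "\<gamma>1 ` ?S" W ?W'] oW WW by blast
  qed
  \<comment> \<open>Every null geodesic through \<open>y\<close> has the image of one that starts
    with a velocity in \<open>N\<close>; the factor \<open>m\<close> arises from 1 or -1, depending
    on the half-cone.\<close>
  have normalize: "\<exists>v\<in>N. \<exists>J' \<gamma>'. null_geodesic A g J' \<gamma>' \<and> initial c 0 (?q, v) J' \<gamma>' \<and> \<gamma>' ` J' = \<gamma> ` J"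
    if null: "null_geodesic A g J \<gamma>" and y: "y \<in> \<gamma> ` J" for J \<gamma>
  proof -
    obtain t where t: "t \<in> J" "y = \<gamma> t" using y by blast
    have geo: "geodesic A g J \<gamma>" and nv: "null_vec g (\<gamma> t) (velocity A \<gamma> J t)"
      using null t by (simp_all add: null_geodesic_eq)
    let ?v = "snd (state c \<gamma> t)"
    have "?v \<noteq> 0" "metric_coeff A g c ?q ?v ?v = 0"
      using null_vec_state[OF geo c(1) t(1)] nv c(2) t(2) by simp_all
    then have "1 *\<^sub>R ?v \<in> N \<or> (-1) *\<^sub>R ?v \<in> N" using N(3) by simp
    then obtain m :: real where m: "m \<noteq> 0" "m *\<^sub>R ?v \<in> N" by (metis one_neq_zero neg_equal_0_iff_equal)
    have ty: "\<gamma> t \<in> fst c" using c(2) t(2) by simp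
    obtain J' \<gamma>' where J': "null_geodesic A g J' \<gamma>'" "\<gamma>' ` J' = \<gamma> ` J" "initial c 0 (snd c (\<gamma> t), m *\<^sub>R ?v) J' \<gamma>'"
      by (rule null_geodesic_reparametrize[OF null t(1) c(1) ty m(1)]) (rule that)
    show ?thesis
      by (rule bexI[OF _ m(2)], rule exI[of _ J'], rule exI[of _ \<gamma>']) (use J' t(2) in simp)
  qed
  obtain v0 J1 \<gamma>1 where "v0 \<in> N" "null_geodesic A g J1 \<gamma>1" "initial c 0 (?q, v0) J1 \<gamma>1" "\<gamma>1 ` J1 = \<gamma>0 ` J0"
    using normalize[OF ex(1,2)] by blast
  then have "v0 \<in> E W" using ex(3) by (intro EI[of v0 J1 \<gamma>1]) simp_all
  then have "E W \<noteq> {}" by blast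
  then have "E ?W' = {}"
    using N(1) openE[OF oW(1)] openE[OF oW(2)] cover disjE unfolding connected_openin by blast
  then have all: "N \<subseteq> E W" using cover by blast
  show ?thesis
    unfolding all_null_geodesics_enter_def
  proof (intro allI impI, elim conjE)
    fix J \<gamma> assume null: "null_geodesic A g J \<gamma>" and y: "y \<in> \<gamma> ` J"
    obtain v J' \<gamma>' where v: "v \<in> N" and J': "null_geodesic A g J' \<gamma>'" "initial c 0 (?q, v) J' \<gamma>'" "\<gamma>' ` J' = \<gamma> ` J"
      using normalize[OF null y] by blast
    have "v \<in> E W" using all v by blast
    then obtain J1 \<gamma>1 where 1: "null_geodesic A g J1 \<gamma>1 \<and> initial c 0 (?q, v) J1 \<gamma>1 \<and> \<gamma>1 ` J1 \<inter> W \<noteq> {}"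
      unfolding E_def by (elim CollectE conjE exE) blast
    then have "\<gamma>1 ` J1 = \<gamma>' ` J'" using same[OF J'(1,2)] by blast
    then show "\<gamma> ` J \<inter> W \<noteq> {}" using 1 J'(3) by simp
  qed
qed

end

context lorentz_cover
begin

text \<open>A covering need not be normal, so there is no deck transformation moving one lift of \<open>y\<close> to
  another; instead \<open>y'\<close> is found by running backwards along one null geodesic from the given sheet.\<close>

lemma refocusing_lift:
  assumes dim: "DIM('e) \<ge> 3" and sc: "\<And>p. strongly_causal_at A g T p"
    and ev: "evenly_covered \<rho> U \<V>" and U: "causally_convex A g T U"
    and enter: "all_null_geodesics_enter A g y U" and W: "W \<in> \<V>"
  obtains y' where "\<rho> y' = y" "all_null_geodesics_enter A' g' y' W"
proof (cases "\<exists>J \<sigma>. null_geodesic A g J \<sigma> \<and> y \<in> \<sigma> ` J")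
  \<comment> \<open>If no null geodesic passes through \<open>y\<close>, then none passes through an
    event over \<open>y\<close>, and any such event will do.\<close>
  case False
  obtain y' where y': "\<rho> y' = y" using surj_covering by (metis surjD)
  have "\<not> (null_geodesic A' g' J \<gamma> \<and> y' \<in> \<gamma> ` J)" for J \<gamma>
    using null_geodesic_projection[of J \<gamma>] False y' by fastforce
  then have "all_null_geodesics_enter A' g' y' W" unfolding all_null_geodesics_enter_def by blast
  then show ?thesis by (rule that[OF y'])
next
  case True
  then obtain J \<sigma> where \<sigma>: "null_geodesic A g J \<sigma> \<and> y \<in> \<sigma> ` J" by (elim exE)
  then have null: "null_geodesic A g J \<sigma>" by simp
  have "\<sigma> ` J \<inter> U \<noteq> {}" using \<sigma> enter unfolding all_null_geodesics_enter_def by blast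
  then obtain t1 where t1: "t1 \<in> J" "\<sigma> t1 \<in> U" by blast
  obtain t0 where t0: "t0 \<in> J" "\<sigma> t0 = y" using \<sigma> by blast
  obtain q where q: "homeomorphism W U \<rho> q" by (rule sheet_homeomorphism[OF ev W])
  have p: "\<rho> (q (\<sigma> t1)) = \<sigma> t1" "q (\<sigma> t1) \<in> W" using q t1(2) unfolding homeomorphism_def by blast+
  obtain \<gamma> where \<gamma>: "null_geodesic A' g' J \<gamma>" "\<gamma> t1 = q (\<sigma> t1)" "\<And>t. t \<in> J \<Longrightarrow> \<rho> (\<gamma> t) = \<sigma> t"
    by (rule null_geodesic_lift[OF null t1(1) p(1)]) (rule that)
  have y': "\<rho> (\<gamma> t0) = y" using \<gamma>(3)[OF t0(1)] t0(2) by simp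
  have un: "\<Union>\<V> = \<rho> -` U" using ev by (simp add: evenly_covered_def)
  have proj: "null_geodesic A g K (\<rho> \<circ> \<tau>) \<and> y \<in> (\<rho> \<circ> \<tau>) ` K" if "null_geodesic A' g' K \<tau>" "\<gamma> t0 \<in> \<tau> ` K" for K \<tau>
    using null_geodesic_projection[OF that(1)] that(2) y' by auto
  have "all_null_geodesics_enter A' g' (\<gamma> t0) W"
  proof (rule up.null_geodesics_same_sheet[OF dim])
    show "pairwise disjnt \<V>" using ev by (simp add: evenly_covered_def)
    show "open V" if "V \<in> \<V>" for V by (rule sheet_open[OF ev that])
    fix K \<tau> assume K: "null_geodesic A' g' K \<tau>" "\<gamma> t0 \<in> \<tau> ` K"
    note K' = proj[OF K]
    have "(\<rho> \<circ> \<tau>) ` K \<inter> U \<noteq> {}" using enter K' unfolding all_null_geodesics_enter_def by blast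
    then show "\<tau> ` K \<inter> \<Union>\<V> \<noteq> {}" unfolding un by auto
    show "connected {t\<in>K. \<tau> t \<in> \<Union>\<V>}"
      unfolding connected_iff_interval un
    proof (intro ballI allI impI)
      fix s t r assume s: "s \<in> {t\<in>K. \<tau> t \<in> \<rho> -` U}" and t: "t \<in> {t\<in>K. \<tau> t \<in> \<rho> -` U}" and r: "s \<le> r" "r \<le> t"
      have "(\<rho> \<circ> \<tau>) r \<in> U"
        by (rule down.null_geodesic_parameters[OF sc conjunct1[OF K'] U, of s t]) (use s t r in auto)
      moreover have "r \<in> K"
        using up.geodesic_interval[of K \<tau>] K(1) s t r mem_is_interval_1_I[of K s t r] by (simp add: up.null_geodesic_eq)
      ultimately show "r \<in> {t\<in>K. \<tau> t \<in> \<rho> -` U}" by simp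
    qed
  next
    show "W \<in> \<V>" by (rule W)
    show "null_geodesic A' g' J \<gamma>" by (rule \<gamma>(1))
    show "\<gamma> t0 \<in> \<gamma> ` J" using t0(1) by blast
    show "\<gamma> ` J \<inter> W \<noteq> {}" using t1(1) p(2) \<gamma>(2) by force
  qed
  then show ?thesis by (rule that[OF y'])
qed

text \<open>Combines even covering and causal convexity in an arbitrarily small sheet around
  \<open>x'\<close>. The inclusion in the image of \<open>Y\<close> keeps \<open>U\<close> inside
  the neighbourhood \<open>V\<close> of the refocusing condition.\<close>

lemma causally_convex_sheet:
  assumes sc: "\<And>p. strongly_causal_at A g T p" and Y: "open Y" "x' \<in> Y"
  obtains U \<V> W where "causally_convex A g T U" "\<rho> x' \<in> U" "evenly_covered \<rho> U \<V>" "W \<in> \<V>" "x' \<in> W" "W \<subseteq> Y" "U \<subseteq> \<rho> ` Y"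
proof -
  obtain U0 \<V>0 where U0: "\<rho> x' \<in> U0" "evenly_covered \<rho> U0 \<V>0" using evenly_covered_at by blast
  obtain V where V: "V \<in> \<V>0" "x' \<in> V" using sheet_at[OF U0(2,1)] by blast
  have "open (Y \<inter> V)" using Y(1) sheet_open[OF U0(2) V(1)] by blast
  then have "open (\<rho> ` (Y \<inter> V))" by (rule sheet_image_open[OF U0(2) V(1)]) blast
  then obtain U where U: "causally_convex A g T U" "\<rho> x' \<in> U" "U \<subseteq> \<rho> ` (Y \<inter> V)"
    using sc[of "\<rho> x'"] Y(2) V(2) unfolding strongly_causal_at_def by blast
  have "\<rho> ` V \<subseteq> U0" using U0(2) V(1) unfolding evenly_covered_def by blast
  then have sub: "U \<subseteq> U0" using U(3) by blast
  have ev: "evenly_covered \<rho> U ((\<lambda>V. V \<inter> \<rho> -` U) ` \<V>0)"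
    by (rule evenly_covered_restrict[OF U0(2) causally_convex_open[OF U(1)] sub
          open_preimage[OF causally_convex_open[OF U(1)]]])
  have "V \<inter> \<rho> -` U \<subseteq> Y"
  proof
    fix z assume z: "z \<in> V \<inter> \<rho> -` U"
    then obtain w where "w \<in> Y \<inter> V" "\<rho> z = \<rho> w" using U(3) by blast
    then show "z \<in> Y" using sheet_inj[OF U0(2) V(1), of z w] z by blast
  qed
  then show ?thesis
    by (intro that[OF U(1,2) ev imageI[OF V(1)]]) (use U V in auto)
qed

text \<open>The preimage of \<open>V\<close> serves as the neighbourhood upstairs: an event over
  some \<open>y \<notin> V\<close> lies outside it, whichever lift of \<open>y\<close> is taken, so
  the lift can be chosen to suit the sheet.\<close>

lemma refocusing_cover:
  assumes dim: "DIM('e) \<ge> 3" and sc: "\<And>p. strongly_causal_at A g T p" and ref: "refocusing_at A g (\<rho> x')"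
  shows "refocusing_at A' g' x'"
proof -
  obtain V where V: "open V" "\<rho> x' \<in> V"
    and far: "\<And>U. open U \<Longrightarrow> \<rho> x' \<in> U \<Longrightarrow> U \<subseteq> V \<Longrightarrow> \<exists>y. y \<notin> V \<and> all_null_geodesics_enter A g y U"
    using ref unfolding refocusing_at_def by blast
  show ?thesis
    unfolding refocusing_at_def
  proof (rule exI[of _ "\<rho> -` V"], intro conjI allI impI)
    show "open (\<rho> -` V)" by (rule open_preimage[OF V(1)])
    show "x' \<in> \<rho> -` V" using V(2) by simp
    fix Y assume Y: "open Y \<and> x' \<in> Y \<and> Y \<subseteq> \<rho> -` V"
    then have Y': "open Y" "x' \<in> Y" by simp_all
    obtain U \<V> W where U: "causally_convex A g T U" "\<rho> x' \<in> U" "evenly_covered \<rho> U \<V>" "W \<in> \<V>" "x' \<in> W"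
      "W \<subseteq> Y" "U \<subseteq> \<rho> ` Y"
      by (rule causally_convex_sheet[OF sc Y']) (rule that)
    have "U \<subseteq> V" using U(7) Y by blast
    from far[OF causally_convex_open[OF U(1)] U(2) this]
    obtain y where y: "y \<notin> V" "all_null_geodesics_enter A g y U" by blast
    obtain y' where y': "\<rho> y' = y" "all_null_geodesics_enter A' g' y' W"
      by (rule refocusing_lift[OF dim sc U(3,1) y(2) U(4)]) (rule that)
    have "all_null_geodesics_enter A' g' y' Y"
      using y'(2) U(6) unfolding all_null_geodesics_enter_def by blast
    moreover have "y' \<notin> \<rho> -` V" using y y' by simp
    ultimately show "\<exists>y. y \<notin> \<rho> -` V \<and> all_null_geodesics_enter A' g' y Y" by blast
  qed
qed

text \<open>Entering the sheet improves to passing through \<open>x'\<close>: the projection lies in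
  \<open>U\<close> at \<open>t1\<close> and at \<open>\<rho> x'\<close> at \<open>t2\<close>, and
  stays in \<open>U\<close> in between. So the lift stays in \<open>W\<close>, where
  \<open>x'\<close> is the only point over \<open>\<rho> x'\<close>.\<close>

lemma strongly_refocusing_cover:
  assumes dim: "DIM('e) \<ge> 3" and sc: "\<And>p. strongly_causal_at A g T p" and ref: "strongly_refocusing_at A g (\<rho> x')"
  shows "strongly_refocusing_at A' g' x'"
proof -
  obtain y where y: "y \<noteq> \<rho> x'" and hit: "\<And>J \<gamma>. null_geodesic A g J \<gamma> \<Longrightarrow> y \<in> \<gamma> ` J \<Longrightarrow> \<rho> x' \<in> \<gamma> ` J"
    using ref unfolding strongly_refocusing_at_def by blast
  obtain U \<V> W where U: "causally_convex A g T U" "\<rho> x' \<in> U" "evenly_covered \<rho> U \<V>" "W \<in> \<V>" "x' \<in> W"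
    "W \<subseteq> UNIV" "U \<subseteq> \<rho> ` UNIV"
    by (rule causally_convex_sheet[OF sc open_UNIV UNIV_I]) (rule that)
  have enter: "all_null_geodesics_enter A g y U"
    unfolding all_null_geodesics_enter_def using hit U(2) by blast
  obtain y' where y': "\<rho> y' = y" "all_null_geodesics_enter A' g' y' W"
    by (rule refocusing_lift[OF dim sc U(3,1) enter U(4)]) (rule that)
  have "x' \<in> \<gamma> ` J" if null: "null_geodesic A' g' J \<gamma>" and y'J: "y' \<in> \<gamma> ` J" for J \<gamma>
  proof -
    have "\<gamma> ` J \<inter> W \<noteq> {}" using y'(2) null y'J unfolding all_null_geodesics_enter_def by blast
    then obtain t1 where t1: "t1 \<in> J" "\<gamma> t1 \<in> W" by blast
    note null' = null_geodesic_projection[OF null]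
    have "y \<in> (\<rho> \<circ> \<gamma>) ` J" using y'J y'(1) by auto
    from hit[OF null' this] obtain t2 where t2: "t2 \<in> J" "\<rho> (\<gamma> t2) = \<rho> x'" by auto
    have geo: "geodesic A' g' J \<gamma>" using null by (simp add: up.null_geodesic_eq)
    let ?C = "{min t1 t2..max t1 t2}"
    have sub: "?C \<subseteq> J"
    proof
      fix r assume r: "r \<in> ?C"
      show "r \<in> J"
        by (rule mem_is_interval_1_I[OF up.geodesic_interval[OF geo], of "min t1 t2" "max t1 t2"])
           (use r t1(1) t2(1) in \<open>auto simp: min_def max_def\<close>)
    qed
    have W_U: "\<rho> (\<gamma> t1) \<in> U" using t1(2) U(3,4) unfolding evenly_covered_def by blast
    have in_U: "\<rho> (\<gamma> r) \<in> U" if r: "r \<in> ?C" for r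
    proof -
      have "(\<rho> \<circ> \<gamma>) r \<in> U"
        by (rule down.null_geodesic_parameters[OF sc null' U(1), of "min t1 t2" "max t1 t2"])
           (use r t1 t2 W_U U(2) in \<open>auto simp: min_def max_def\<close>)
      then show ?thesis by simp
    qed
    have "\<gamma> ` ?C \<subseteq> W"
    proof (rule sheet_contains_connected[OF U(3,4)])
      show "connected (\<gamma> ` ?C)"
        by (rule connected_continuous_image[OF continuous_on_subset[OF up.geodesic_continuous[OF geo] sub] connected_Icc])
      show "\<gamma> ` ?C \<subseteq> \<rho> -` U" using in_U by blast
      have "\<gamma> t1 \<in> \<gamma> ` ?C \<inter> W" using t1(2) by auto
      then show "\<gamma> ` ?C \<inter> W \<noteq> {}" by blast
    qed
    then have "\<gamma> t2 \<in> W" by auto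
    then have "\<gamma> t2 = x'" using sheet_inj[OF U(3,4) _ U(5), of "\<gamma> t2"] t2(2) by simp
    then show ?thesis using t2(1) by blast
  qed
  moreover have "y' \<noteq> x'" using y y'(1) by blast
  ultimately show ?thesis unfolding strongly_refocusing_at_def by blast
qed

end

theorem theorem3p15:
  fixes A :: "('a::{t2_space, second_countable_topology}, 'e::euclidean_space) chart set"
    and g :: "('a, 'e) metric" and T :: "'a \<Rightarrow> ('a, 'e) tvec"
    and A' :: "('b::{t2_space, second_countable_topology}, 'e) chart set"
    and g' :: "('b, 'e) metric" and T' :: "'b \<Rightarrow> ('b, 'e) tvec"
    and \<rho> :: "'b \<Rightarrow> 'a" and x :: 'a and n :: nat
  assumes "DIM('e) = n + 1" and "n \<ge> 2"
    and "strongly_causal_space_time A g T"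
    and "lorentz_covering A' g' T' A g T \<rho>"
  shows "(refocusing_at A g x \<longrightarrow>
            strongly_causal_space_time A' g' T' \<and>
            (\<forall>x' \<in> \<rho> -` {x}. refocusing_at A' g' x')) \<and>
         (strongly_refocusing_at A g x \<longrightarrow>
            strongly_causal_space_time A' g' T' \<and>
            (\<forall>x' \<in> \<rho> -` {x}. strongly_refocusing_at A' g' x'))"
proof -
  have st: "space_time A g T" and sc: "\<And>p. strongly_causal_at A g T p"
    using assms(3) unfolding strongly_causal_space_time_def by blast+
  interpret lorentz_cover A g T A' g' T' \<rho>
    using st assms(4) unfolding space_time_def by unfold_locales blast+
  \<comment> \<open>This is what \<open>null_cone_connected\<close> requires.\<close>
  have dim: "DIM('e) \<ge> 3" using assms(1,2) by simp
  have "strongly_causal_space_time A' g' T'"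
    unfolding strongly_causal_space_time_def using space_time_cover strongly_causal_cover[OF sc] by blast
  then show ?thesis
    using refocusing_cover[OF dim sc] strongly_refocusing_cover[OF dim sc] by auto
qed

end
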